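(* Let $n<p<\infty$ and $\alpha=(p-n)/(p-1)$. For every domain $\Omega\subset\mathbf{R}^n$ there exists a continuous linear operator $E:\operatorname{tr}_{(\partial\Omega)_\alpha}(W^1_p(\Omega))\to W^1_p(\Omega)$ such that $\operatorname{tr}_{(\partial\Omega)_\alpha}(Ef)=f$ for each $f\in\operatorname{tr}_{(\partial\Omega)_\alpha}(W^1_p(\Omega))$. Its operator norm is bounded by a constant depending only on $n$ and $p$.
   Context: Conventions. $\mathbf{R}^n$ carries the uniform norm $\|x\|=\max_i|x_i|$; distances and arc length are taken with respect to it. $\Omega\subset\mathbf{R}^n$ is a domain (nonempty open connected set) with $\Omega\ne\mathbf{R}^n$. Metrics. For $\alpha\in(0,1]$ and $x,y\in\Omega$, $d_{\alpha,\Omega}(x,y)=\inf_\gamma\int_\gamma\operatorname{dist}(z,\partial\Omega)^{\alpha-1}ds(z)$, the infimum being over rectifiable curves $\gamma\subset\Omega$ joining $x$ to $y$; $\rho_{\alpha,\Omega}(x,y)=d_{\alpha,\Omega}(x,y)+\|x-y\|^\alpha$. Completion. $\Omega^{*,\alpha}$ is the Cauchy completion of $(\Omega,\rho_{\alpha,\Omega})$, i.e. the set of equivalence classes $\omega=[(x_i)]_\alpha$ of $\rho_{\alpha,\Omega}$-Cauchy sequences in $\Omega$, where $(x_i)\stackrel{\alpha}{\sim}(y_i)$ iff $\rho_{\alpha,\Omega}(x_i,y_i)\to0$; $\Omega$ is viewed as a subset via constant sequences. The $\alpha$-boundary is $(\partial\Omega)_\alpha=\Omega^{*,\alpha}\setminus\Omega$.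 Sobolev spaces and traces. $W^1_p(\Omega)$ is normed by $\|F\|_{W^1_p(\Omega)}=\|F\|_{L_p(\Omega)}+\|\nabla F\|_{L_p(\Omega)}$. For $p>n$ each element is identified with its continuous representative; with $\alpha=(p-n)/(p-1)$ this representative is uniformly continuous with respect to $\rho_{\alpha,\Omega}$, so it extends uniquely to a continuous function on $\Omega^{*,\alpha}$, and its trace $\operatorname{tr}_{(\partial\Omega)_\alpha}F$ is the restriction of this extension to $(\partial\Omega)_\alpha$; i.e. $\operatorname{tr}_{(\partial\Omega)_\alpha}F(\omega)=\lim_iF(y_i)$ for any $(y_i)\in\omega$. $\operatorname{tr}_{(\partial\Omega)_\alpha}(W^1_p(\Omega))$ is the Banach space of all such traces, with norm $\inf\{\|F\|_{W^1_p(\Omega)}:F\in W^1_p(\Omega)\text{ continuous},\ \operatorname{tr}_{(\partial\Omega)_\alpha}F=f\}$. *)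

theory Defs
  imports "HOL-Analysis.Analysis"
begin

text \<open>The space \<^typ>\<open>real ^ 'n\<close> carries its Euclidean norm in the library; every metric quantity
  below (distances, arc length, size of the gradient) uses \<^const>\<open>infnorm\<close>, the uniform norm,
  instead. Topology and Lebesgue measure are not affected by this choice.\<close>

definition is_domain :: "(real ^ 'n) set \<Rightarrow> bool" where
  "is_domain \<Omega> \<longleftrightarrow> open \<Omega> \<and> connected \<Omega> \<and> \<Omega> \<noteq> {} \<and> \<Omega> \<noteq> UNIV"

definition infnorm_setdist :: "real ^ 'n \<Rightarrow> (real ^ 'n) set \<Rightarrow> real" where
  "infnorm_setdist z A = (INF a\<in>A. infnorm (z - a))"


subsection \<open>Rectifiable curves and integration with respect to arc length\<close>

definition inscribed_lengths :: "(real \<Rightarrow> real ^ 'n) \<Rightarrow> real \<Rightarrow> real set" where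
  "inscribed_lengths \<gamma> u =
     {\<Sum>i<k. infnorm (\<gamma> (t (Suc i)) - \<gamma> (t i)) | (k :: nat) (t :: nat \<Rightarrow> real).
        (\<forall>i\<le>k. t i \<in> {0..u}) \<and> (\<forall>i<k. t i \<le> t (Suc i))}"

definition rectifiable_path :: "(real \<Rightarrow> real ^ 'n) \<Rightarrow> bool" where
  "rectifiable_path \<gamma> \<longleftrightarrow> path \<gamma> \<and> bdd_above (inscribed_lengths \<gamma> 1)"

text \<open>Length of the restriction of \<open>\<gamma>\<close> to \<open>[0, u]\<close>.\<close>
definition arc_length :: "(real \<Rightarrow> real ^ 'n) \<Rightarrow> real \<Rightarrow> real" where
  "arc_length \<gamma> u = Sup (inscribed_lengths \<gamma> u)"

text \<open>A rectifiable \<open>\<gamma>\<close> is constant on each level set of \<open>arc_length \<gamma>\<close>, so the choice of the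
  parameter value \<open>t\<close> is immaterial; every \<open>u\<close> between 0 and the length of \<open>\<gamma>\<close> has such a \<open>t\<close>.\<close>
definition arc_length_param :: "(real \<Rightarrow> real ^ 'n) \<Rightarrow> real \<Rightarrow> real ^ 'n" where
  "arc_length_param \<gamma> u = \<gamma> (SOME t. t \<in> {0..1} \<and> arc_length \<gamma> t = u)"

definition arc_length_integral :: "(real ^ 'n \<Rightarrow> real) \<Rightarrow> (real \<Rightarrow> real ^ 'n) \<Rightarrow> real" where
  "arc_length_integral w \<gamma> = integral {0..arc_length \<gamma> 1} (\<lambda>u. w (arc_length_param \<gamma> u))"


subsection \<open>The metrics and the boundary of the completion\<close>

definition d_metric :: "real \<Rightarrow> (real ^ 'n) set \<Rightarrow> real ^ 'n \<Rightarrow> real ^ 'n \<Rightarrow> real" where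
  "d_metric \<alpha> \<Omega> x y =
     (INF \<gamma>\<in>{\<gamma>. rectifiable_path \<gamma> \<and> path_image \<gamma> \<subseteq> \<Omega> \<and> pathstart \<gamma> = x \<and> pathfinish \<gamma> = y}.
        arc_length_integral (\<lambda>z. infnorm_setdist z (frontier \<Omega>) powr (\<alpha> - 1)) \<gamma>)"

definition rho_metric :: "real \<Rightarrow> (real ^ 'n) set \<Rightarrow> real ^ 'n \<Rightarrow> real ^ 'n \<Rightarrow> real" where
  "rho_metric \<alpha> \<Omega> x y = d_metric \<alpha> \<Omega> x y + infnorm (x - y) powr \<alpha>"

text \<open>Written out rather than taken from the locale \<^locale>\<open>Metric_space\<close>, whose axioms also
  constrain the values of a metric outside of its carrier.\<close>
definition rho_Cauchy :: "real \<Rightarrow> (real ^ 'n) set \<Rightarrow> (nat \<Rightarrow> real ^ 'n) set" where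
  "rho_Cauchy \<alpha> \<Omega> =
     {x. range x \<subseteq> \<Omega> \<and> (\<forall>e>0. \<exists>N. \<forall>i\<ge>N. \<forall>j\<ge>N. rho_metric \<alpha> \<Omega> (x i) (x j) < e)}"

definition rho_equiv ::
    "real \<Rightarrow> (real ^ 'n) set \<Rightarrow> ((nat \<Rightarrow> real ^ 'n) \<times> (nat \<Rightarrow> real ^ 'n)) set" where
  "rho_equiv \<alpha> \<Omega> =
     {(x, y). x \<in> rho_Cauchy \<alpha> \<Omega> \<and> y \<in> rho_Cauchy \<alpha> \<Omega> \<and>
              (\<lambda>i. rho_metric \<alpha> \<Omega> (x i) (y i)) \<longlonglongrightarrow> 0}"

definition rho_completion :: "real \<Rightarrow> (real ^ 'n) set \<Rightarrow> (nat \<Rightarrow> real ^ 'n) set set" where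
  "rho_completion \<alpha> \<Omega> = rho_Cauchy \<alpha> \<Omega> // rho_equiv \<alpha> \<Omega>"

definition alpha_boundary :: "real \<Rightarrow> (real ^ 'n) set \<Rightarrow> (nat \<Rightarrow> real ^ 'n) set set" where
  "alpha_boundary \<alpha> \<Omega> =
     rho_completion \<alpha> \<Omega> - (\<lambda>x. rho_equiv \<alpha> \<Omega> `` {\<lambda>_. x}) ` \<Omega>"


subsection \<open>Sobolev spaces\<close>

definition partial_deriv :: "'n \<Rightarrow> (real ^ 'n \<Rightarrow> real) \<Rightarrow> real ^ 'n \<Rightarrow> real" where
  "partial_deriv i \<phi> x = frechet_derivative \<phi> (at x) (axis i 1)"

text \<open>For \<open>k \<ge> 1\<close> this says that all iterated partial derivatives of order less than \<open>k\<close> are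
  differentiable and that those of order \<open>k\<close> are continuous, i.e. \<open>\<phi>\<close> is of class \<open>C\<^sup>k\<close>.\<close>
primrec Ck :: "nat \<Rightarrow> (real ^ 'n \<Rightarrow> real) \<Rightarrow> bool" where
  "Ck 0 \<phi> \<longleftrightarrow> continuous_on UNIV \<phi>"
| "Ck (Suc k) \<phi> \<longleftrightarrow> \<phi> differentiable_on UNIV \<and> (\<forall>i. Ck k (partial_deriv i \<phi>))"

definition test_function :: "(real ^ 'n) set \<Rightarrow> (real ^ 'n \<Rightarrow> real) \<Rightarrow> bool" where
  "test_function \<Omega> \<phi> \<longleftrightarrow>
     (\<forall>k. Ck k \<phi>) \<and> (\<exists>K. compact K \<and> K \<subseteq> \<Omega> \<and> (\<forall>x. x \<notin> K \<longrightarrow> \<phi> x = 0))"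

definition has_weak_gradient ::
    "(real ^ 'n) set \<Rightarrow> (real ^ 'n \<Rightarrow> real) \<Rightarrow> (real ^ 'n \<Rightarrow> real ^ 'n) \<Rightarrow> bool" where
  "has_weak_gradient \<Omega> F G \<longleftrightarrow>
     (\<forall>K. compact K \<and> K \<subseteq> \<Omega> \<longrightarrow> F absolutely_integrable_on K \<and> G absolutely_integrable_on K) \<and>
     (\<forall>\<phi> i. test_function \<Omega> \<phi> \<longrightarrow>
        (LINT x|lebesgue_on \<Omega>. F x * partial_deriv i \<phi> x) =
        - (LINT x|lebesgue_on \<Omega>. G x $ i * \<phi> x))"

text \<open>Weak gradients are unique up to null sets, so all choices have the same \<open>L\<^sub>p\<close> norm.\<close>
definition weak_gradient :: "(real ^ 'n) set \<Rightarrow> (real ^ 'n \<Rightarrow> real) \<Rightarrow> real ^ 'n \<Rightarrow> real ^ 'n" where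
  "weak_gradient \<Omega> F = (SOME G. has_weak_gradient \<Omega> F G)"

definition in_Lp :: "real \<Rightarrow> (real ^ 'n) set \<Rightarrow> (real ^ 'n \<Rightarrow> real) \<Rightarrow> bool" where
  "in_Lp p \<Omega> f \<longleftrightarrow>
     f \<in> borel_measurable (lebesgue_on \<Omega>) \<and> integrable (lebesgue_on \<Omega>) (\<lambda>x. \<bar>f x\<bar> powr p)"

definition Lp_norm :: "real \<Rightarrow> (real ^ 'n) set \<Rightarrow> (real ^ 'n \<Rightarrow> real) \<Rightarrow> real" where
  "Lp_norm p \<Omega> f = (LINT x|lebesgue_on \<Omega>. \<bar>f x\<bar> powr p) powr (1 / p)"

definition in_W1p :: "real \<Rightarrow> (real ^ 'n) set \<Rightarrow> (real ^ 'n \<Rightarrow> real) \<Rightarrow> bool" where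
  "in_W1p p \<Omega> F \<longleftrightarrow>
     in_Lp p \<Omega> F \<and> (\<exists>G. has_weak_gradient \<Omega> F G \<and> in_Lp p \<Omega> (\<lambda>x. infnorm (G x)))"

definition W1p_norm :: "real \<Rightarrow> (real ^ 'n) set \<Rightarrow> (real ^ 'n \<Rightarrow> real) \<Rightarrow> real" where
  "W1p_norm p \<Omega> F = Lp_norm p \<Omega> F + Lp_norm p \<Omega> (\<lambda>x. infnorm (weak_gradient \<Omega> F x))"

text \<open>For \<open>p > n\<close> the elements of \<open>W\<^sup>1\<^sub>p(\<Omega>)\<close> are identified with their continuous
  representatives, which are unique as functions on \<open>\<Omega>\<close>. Values outside of \<open>\<Omega>\<close> are irrelevant.\<close>
definition W1p_cont :: "real \<Rightarrow> (real ^ 'n) set \<Rightarrow> (real ^ 'n \<Rightarrow> real) set" where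
  "W1p_cont p \<Omega> = {F. in_W1p p \<Omega> F \<and> continuous_on \<Omega> F}"


subsection \<open>Traces\<close>

text \<open>Traces are functions on the \<open>\<alpha>\<close>-boundary; they are extended by 0 so that equality and the
  pointwise operations are those of functions on the \<open>\<alpha>\<close>-boundary.\<close>
definition alpha_trace ::
    "real \<Rightarrow> (real ^ 'n) set \<Rightarrow> (real ^ 'n \<Rightarrow> real) \<Rightarrow> (nat \<Rightarrow> real ^ 'n) set \<Rightarrow> real" where
  "alpha_trace \<alpha> \<Omega> F \<omega> =
     (if \<omega> \<in> alpha_boundary \<alpha> \<Omega> then THE l. \<forall>y\<in>\<omega>. (\<lambda>i. F (y i)) \<longlonglongrightarrow> l else 0)"

definition trace_space ::
    "real \<Rightarrow> real \<Rightarrow> (real ^ 'n) set \<Rightarrow> ((nat \<Rightarrow> real ^ 'n) set \<Rightarrow> real) set" where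
  "trace_space \<alpha> p \<Omega> = alpha_trace \<alpha> \<Omega> ` W1p_cont p \<Omega>"

definition trace_norm ::
    "real \<Rightarrow> real \<Rightarrow> (real ^ 'n) set \<Rightarrow> ((nat \<Rightarrow> real ^ 'n) set \<Rightarrow> real) \<Rightarrow> real" where
  "trace_norm \<alpha> p \<Omega> f = (INF F\<in>{F \<in> W1p_cont p \<Omega>. alpha_trace \<alpha> \<Omega> F = f}. W1p_norm p \<Omega> F)"

end

theory Submission
  imports Defs
begin

text \<open>
  The extension of a boundary function \<open>f\<close> is a Whitney average: \<open>\<Omega>\<close> is covered by cubes whose size is
  comparable to their distance to the boundary, each cube with centre \<open>z\<close> is assigned the value of \<open>f\<close>
  at the point of the completion where the segment from \<open>z\<close> to a nearest boundary point arrives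
  (\<open>foot\<close>), and these values are glued by a partition of unity. Cubes at distance more than 1 from the
  boundary are assigned the value 0. The construction is linear in \<open>f\<close> by its form; the point is to
  estimate it when \<open>f\<close> is the trace of a Sobolev function \<open>F\<close>.

  The only analytic input about \<open>F\<close> is the Morrey inequality: for \<open>p > n\<close> the \<open>p\<close>-th power of the
  oscillation of \<open>F\<close> on a cube of side \<open>r\<close> is bounded by a multiple of \<open>r\<^sup>p\<^sup>-\<^sup>n\<close> times the energy, the
  integral of \<open>|\<nabla>F|\<^sup>p\<close>, of the concentric cube of twice the side (\<open>morrey\<close>). It is proved directly from the definition of the weak gradient. The
  difference of two mollifiers that are products of functions of one variable is a sum of partial
  derivatives of test functions, one for each exchanged factor (\<open>mollified_difference\<close>), and a
  telescoping sum over shrinking mollifiers reaches the value at a point.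

  Two consequences are needed. First, \<open>F\<close> is uniformly continuous with respect to \<open>\<rho>\<close>, so that traces
  are limits (\<open>rho_uniformly_continuous\<close>). Along a curve one picks vertices by a last-exit rule, such
  that cubes about the vertices overlap boundedly however often the curve returns, and sums the Morrey
  inequality; the exponent \<open>\<alpha>\<close> is the one for which the increments are controlled by the weighted
  length of the curve and the total energy. Second, along the segment from \<open>z\<close> to the boundary the
  increments of \<open>F\<close> decay geometrically, which bounds \<open>F z\<close> minus the value at the foot by a power of
  the distance and a geometrically discounted sum of energies of cubes along the segment
  (\<open>foot_estimate\<close>).

  Consequently the extension and its gradient are bounded pointwise by \<open>|F|\<close> and the discounted
  energies of the finitely many cubes near the point (\<open>extension_pointwise\<close>). After integration all
  cubes contribute. On the \<open>k\<close>-th step of the segments, however, the cubes overlap boundedly with a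
  constant depending on the dimension only, because their starting points are separated on the scale
  of their distance to the boundary; so the sum over all cubes and all \<open>k\<close> is at most a multiple of the
  total energy (\<open>sum_ray_energy\<close>). Towards the boundary the extension approaches \<open>F\<close>, so it has the
  trace \<open>f\<close> (\<open>extension_trace\<close>). All constants depend on \<open>n\<close> and \<open>p\<close> only, and taking the infimum over
  \<open>F\<close> gives the bound by the trace norm.
\<close>

section \<open>Cubes, the distance to the boundary, and packing\<close>

text \<open>The open balls of the uniform norm. They are boxes, so their volume is explicit.\<close>
definition cube :: "real ^ 'n \<Rightarrow> real \<Rightarrow> (real ^ 'n) set" where
  "cube c r = {y. infnorm (y - c) < r}"

lemma infnorm_less_iff: "infnorm (x :: real ^ 'n) < r \<longleftrightarrow> (\<forall>i. \<bar>x $ i\<bar> < r)"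
  by (subst infnorm_Max, subst Max_less_iff)
     (auto simp: Basis_vec_def inner_axis axis_eq_axis)

lemma infnorm_le_iff: "infnorm (x :: real ^ 'n) \<le> r \<longleftrightarrow> (\<forall>i. \<bar>x $ i\<bar> \<le> r)"
  by (subst infnorm_Max, subst Max_le_iff)
     (auto simp: Basis_vec_def inner_axis axis_eq_axis)

lemma infnorm_diff_triangle: "infnorm (x - z) \<le> infnorm (x - y) + infnorm (y - z)"
  using infnorm_triangle[of "x - y" "y - z"] by simp

lemma mem_cube: "y \<in> cube c r \<longleftrightarrow> infnorm (y - c) < r"
  by (simp add: cube_def)

lemma cube_eq_box: "cube c r = box (c - vec r) (c + vec r)"
  by (auto simp: mem_cube infnorm_less_iff mem_box_cart abs_less_iff algebra_simps)

lemma open_cube: "open (cube c r)"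
  unfolding cube_eq_box by (rule open_box)

lemma cube_mono: "infnorm (c - d) + r \<le> s \<Longrightarrow> cube c r \<subseteq> cube d s"
  unfolding mem_cube subset_iff
  by (smt (verit, best) infnorm_diff_triangle)

lemma emeasure_cube:
  assumes "0 \<le> r"
  shows "emeasure lborel (cube (c :: real ^ 'n) r) = ennreal ((2 * r) ^ CARD('n))"
proof -
  have 2: "vec r \<bullet> b = r" if "b \<in> Basis" for b :: "real ^ 'n"
    using that by (auto simp: Basis_vec_def inner_axis)
  have 3: "(c + vec r - (c - vec r)) \<bullet> b = 2 * r" if "b \<in> Basis" for b
    unfolding inner_diff_left inner_add_left 2[OF that] by simp
  have "emeasure lborel (cube c r) = (\<Prod>b\<in>Basis. (c + vec r - (c - vec r)) \<bullet> (b :: real ^ 'n))"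
    unfolding cube_eq_box
    using assms by (subst emeasure_lborel_box) (auto simp: inner_diff_left inner_add_left 2)
  also have "(\<Prod>b\<in>Basis. (c + vec r - (c - vec r)) \<bullet> (b :: real ^ 'n)) = (\<Prod>b\<in>(Basis :: (real ^ 'n) set). 2 * r)"
    by (intro prod.cong refl 3)
  finally show ?thesis by simp
qed

abbreviation bd :: "(real ^ 'n) set \<Rightarrow> real ^ 'n \<Rightarrow> real" where
  "bd \<Omega> z \<equiv> infnorm_setdist z (frontier \<Omega>)"

lemma frontier_ne: "is_domain \<Omega> \<Longrightarrow> frontier \<Omega> \<noteq> {}"
  unfolding is_domain_def using frontier_eq_empty by blast

lemma bd_le: "a \<in> frontier \<Omega> \<Longrightarrow> bd \<Omega> z \<le> infnorm (z - a)"
  unfolding infnorm_setdist_def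
  by (rule cINF_lower) (auto intro!: bdd_belowI[of _ 0] simp: infnorm_pos_le)

lemma bd_Lipschitz:
  assumes "is_domain \<Omega>"
  shows "bd \<Omega> x \<le> bd \<Omega> y + infnorm (x - y)"
proof -
  have "bd \<Omega> x - infnorm (x - y) \<le> infnorm (y - a)" if "a \<in> frontier \<Omega>" for a
    using bd_le[OF that, of x] infnorm_diff_triangle[of x a y] by simp
  then have "bd \<Omega> x - infnorm (x - y) \<le> bd \<Omega> y"
    unfolding infnorm_setdist_def[of y] using frontier_ne[OF assms] by (intro cINF_greatest) auto
  then show ?thesis by simp
qed

lemma bd_nonneg: "is_domain \<Omega> \<Longrightarrow> 0 \<le> bd \<Omega> x"
  unfolding infnorm_setdist_def using frontier_ne by (intro cINF_greatest) (auto simp: infnorm_pos_le)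

lemma continuous_on_bd:
  assumes "is_domain \<Omega>"
  shows "continuous_on S (bd \<Omega>)"
proof -
  have "\<bar>bd \<Omega> x - bd \<Omega> y\<bar> \<le> norm (x - y)" for x y
    using bd_Lipschitz[OF assms, of x y] bd_Lipschitz[OF assms, of y x] infnorm_le_norm[of "x - y"]
    by (auto simp: infnorm_sub[of y x])
  then show ?thesis
    unfolding continuous_on_iff dist_norm real_norm_def by (meson le_less_trans)
qed

text \<open>Only boundary points as close to \<open>z\<close>, in Euclidean distance, as \<open>sqrt n\<close> times the distance to
  one fixed boundary point compete for the minimum, and these form a compact set.\<close>
lemma bd_attained:
  fixes z :: "real ^ 'n"
  assumes "is_domain \<Omega>"
  obtains a where "a \<in> frontier \<Omega>" "bd \<Omega> z = infnorm (z - a)"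
proof -
  obtain b where b: "b \<in> frontier \<Omega>" using frontier_ne[OF assms] by blast
  let ?R = "norm (z - b) * sqrt (real CARD('n))"
  let ?K = "cball z ?R \<inter> frontier \<Omega>"
  have nle: "norm (z - x) \<le> infnorm (z - x) * sqrt (real CARD('n))" for x
    using norm_le_infnorm[of "z - x"] by (simp add: mult.commute)
  have K: "compact ?K" by (simp add: compact_Int_closed)
  have "norm (z - b) * 1 \<le> ?R" by (intro mult_left_mono) (auto simp: DIM_positive Suc_le_eq)
  then have "b \<in> ?K" using b by (simp add: dist_norm)
  then obtain a where a: "a \<in> ?K" "\<And>x. x \<in> ?K \<Longrightarrow> infnorm (z - a) \<le> infnorm (z - x)"
    using continuous_attains_inf[OF K, of "\<lambda>x. infnorm (z - x)"] that
    by (metis continuous_on_infnorm continuous_on_diff[OF continuous_on_const continuous_on_id] empty_iff)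
  have "infnorm (z - a) \<le> infnorm (z - x)" if x: "x \<in> frontier \<Omega>" for x
  proof (cases "x \<in> ?K")
    case False
    then have "?R < norm (z - x)" using x by (auto simp: dist_norm)
    then have "norm (z - b) * sqrt (real CARD('n)) < infnorm (z - x) * sqrt (real CARD('n))"
      using nle[of x] by linarith
    then have "norm (z - b) < infnorm (z - x)" by (simp add: mult_less_cancel_right)
    then show ?thesis using a(2)[OF \<open>b \<in> ?K\<close>] infnorm_le_norm[of "z - b"] by linarith
  qed (use a in auto)
  then have "bd \<Omega> z = infnorm (z - a)"
    using a(1) by (intro antisym bd_le) (auto simp: infnorm_setdist_def intro!: cINF_greatest)
  then show ?thesis using a(1) that by auto
qed

lemma convex_cube: "convex (cube c r)"
  by (simp add: cube_eq_box convex_box)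

text \<open>A cube is connected: if it met the complement of \<open>\<Omega>\<close> as well, it would contain a boundary point
  at distance less than \<open>bd \<Omega> z\<close>.\<close>
lemma cube_bd_subset:
  assumes "is_domain \<Omega>" "z \<in> \<Omega>" "r \<le> bd \<Omega> z"
  shows "cube z r \<subseteq> \<Omega>"
proof (rule ccontr)
  assume "\<not> cube z r \<subseteq> \<Omega>"
  then obtain y where y: "y \<in> cube z r" "y \<notin> \<Omega>" by blast
  then have "0 < r" using infnorm_pos_le[of "y - z"] unfolding mem_cube by linarith
  then have "z \<in> cube z r" by (simp add: mem_cube infnorm_0)
  then have "cube z r \<inter> frontier \<Omega> \<noteq> {}"
    using connected_Int_frontier[of "cube z r" \<Omega>] convex_connected[OF convex_cube] y assms by blast
  then obtain a where "a \<in> cube z r" "a \<in> frontier \<Omega>" by blast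
  then show False using bd_le[of a \<Omega> z] assms by (simp add: mem_cube infnorm_sub[of z])
qed

lemma frontier_notin: "is_domain \<Omega> \<Longrightarrow> a \<in> frontier \<Omega> \<Longrightarrow> a \<notin> \<Omega>"
  by (simp add: is_domain_def frontier_def interior_open)

lemma bd_pos: "is_domain \<Omega> \<Longrightarrow> z \<in> \<Omega> \<Longrightarrow> 0 < bd \<Omega> z"
  by (metis bd_attained frontier_notin infnorm_pos_lt right_minus_eq)

text \<open>Points that are \<open>d\<close>-separated lie in different cells of the grid of mesh \<open>d\<close>.\<close>
lemma packing:
  fixes P :: "(real ^ 'n) set"
  assumes "0 < d" and near: "\<And>z. z \<in> P \<Longrightarrow> infnorm (z - x) \<le> R"
    and sep: "\<And>z w. z \<in> P \<Longrightarrow> w \<in> P \<Longrightarrow> z \<noteq> w \<Longrightarrow> d \<le> infnorm (z - w)"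
  shows "finite P" and "0 \<le> R \<Longrightarrow> real (card P) \<le> (2 * R / d + 2) ^ CARD('n)"
proof -
  define I where "I = {\<lfloor>- R / d\<rfloor>..\<lfloor>R / d\<rfloor>}"
  define f where "f z = (\<lambda>i. \<lfloor>(z $ i - x $ i) / d\<rfloor>)" for z
  have inj: "inj_on f P"
  proof (rule inj_onI, rule ccontr)
    fix z w assume zw: "z \<in> P" "w \<in> P" "f z = f w" "z \<noteq> w"
    have "\<bar>(z - w) $ i\<bar> < d" for i
    proof -
      have "\<lfloor>(z $ i - x $ i) / d\<rfloor> = \<lfloor>(w $ i - x $ i) / d\<rfloor>" using zw(3) by (metis f_def)
      then have "\<bar>(z $ i - x $ i) / d - (w $ i - x $ i) / d\<bar> < 1" by linarith
      then show ?thesis using \<open>0 < d\<close> by (simp add: diff_divide_distrib[symmetric] abs_divide)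
    qed
    then show False using sep[OF zw(1,2,4)] by (smt (verit) infnorm_less_iff)
  qed
  have sub: "f ` P \<subseteq> UNIV \<rightarrow>\<^sub>E I"
  proof -
    have "f z i \<in> I" if "z \<in> P" for z i
    proof -
      have "\<bar>z $ i - x $ i\<bar> \<le> R" using near[OF that] by (auto simp: infnorm_le_iff)
      then have "- R / d \<le> (z $ i - x $ i) / d" "(z $ i - x $ i) / d \<le> R / d"
        using \<open>0 < d\<close> by (intro divide_right_mono; simp add: abs_le_iff)+
      then show ?thesis unfolding f_def I_def by (auto intro: floor_mono)
    qed
    then show ?thesis by auto
  qed
  have fin: "finite (UNIV \<rightarrow>\<^sub>E I :: ('n \<Rightarrow> int) set)" unfolding I_def by (intro finite_PiE) auto
  show "finite P" using finite_imageD[OF finite_subset[OF sub fin] inj] .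
  assume "0 \<le> R"
  have "card P = card (f ` P)" using card_image[OF inj] by simp
  also have "\<dots> \<le> card (UNIV \<rightarrow>\<^sub>E I :: ('n \<Rightarrow> int) set)" by (rule card_mono[OF fin sub])
  also have "\<dots> = card I ^ CARD('n)" by (simp add: card_PiE)
  finally have "real (card P) \<le> real (card I) ^ CARD('n)"
    by (metis of_nat_le_iff of_nat_power)
  also have "\<dots> \<le> (2 * R / d + 2) ^ CARD('n)"
  proof (rule power_mono)
    have "0 \<le> R / d" using \<open>0 \<le> R\<close> \<open>0 < d\<close> by simp
    then have "real (card I) = real_of_int (\<lfloor>R / d\<rfloor> - \<lfloor>- R / d\<rfloor> + 1)"
      unfolding I_def by simp linarith
    then show "real (card I) \<le> 2 * R / d + 2" by simp linarith
  qed simp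
  finally show "real (card P) \<le> (2 * R / d + 2) ^ CARD('n)" .
qed

text \<open>Jensen's inequality for \<open>a\<^sup>p\<close> and the weights \<open>w i\<close> divided by their sum. It plays the part of
  Hoelder's inequality for sums along chains of cubes, where the weights are chosen to absorb all
  powers of the side lengths.\<close>
lemma weighted_power_mean:
  fixes p :: real
  assumes "1 < p" "finite I" "\<And>i. i \<in> I \<Longrightarrow> 0 \<le> w i" "\<And>i. i \<in> I \<Longrightarrow> 0 \<le> a i"
  shows "(\<Sum>i\<in>I. w i * a i) powr p \<le> (\<Sum>i\<in>I. w i) powr (p - 1) * (\<Sum>i\<in>I. w i * a i powr p)"
proof -
  let ?W = "\<Sum>i\<in>I. w i" and ?S = "\<Sum>i\<in>I. w i * a i"
  have W0: "0 \<le> ?W" and S0: "0 \<le> ?S" using assms by (auto intro!: sum_nonneg)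
  show ?thesis
  proof (cases "?S = 0")
    case True
    then show ?thesis using assms W0 by (auto intro!: mult_nonneg_nonneg sum_nonneg)
  next
    case False
    have "?W \<noteq> 0"
    proof
      assume "?W = 0"
      then have "\<forall>i\<in>I. w i = 0" using assms by (simp add: sum_nonneg_eq_0_iff)
      then show False using False by simp
    qed
    then have Wp: "0 < ?W" and Sp: "0 < ?S" using W0 S0 False by auto
    define m where "m = ?S / ?W"
    have m: "0 < m" using Wp Sp by (simp add: m_def)
    \<comment> \<open>the tangent of \<open>a \<mapsto> a\<^sup>p\<close> at the mean lies below the graph\<close>
    have tangent: "m powr p + p * m powr (p - 1) * (x - m) \<le> x powr p" if "0 \<le> x" for x
    proof -
      define q where "q = p / (p - 1)"
      have "1 < q" "1 / p + 1 / q = 1" unfolding q_def using \<open>1 < p\<close> by (auto simp: field_simps)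
      then have "x / m * 1 \<le> (x / m) powr p / p + 1 powr q / q"
        using \<open>1 < p\<close> that m by (intro Youngs_inequality) auto
      moreover have "1 / q = 1 - 1 / p" using \<open>1 / p + 1 / q = 1\<close> by simp
      ultimately have "p * (x / m) \<le> p * ((x / m) powr p / p + (1 - 1 / p))"
        using \<open>1 < p\<close> by (intro mult_left_mono) auto
      then have "p * (x / m) \<le> (x / m) powr p + p - 1"
        using \<open>1 < p\<close> by (simp add: distrib_left right_diff_distrib)
      then have "m powr p * (p * (x / m)) \<le> m powr p * ((x / m) powr p + p - 1)"
        by (intro mult_left_mono) auto
      moreover have "m powr p * (x / m) powr p = x powr p"
        using m that by (simp add: powr_mult[symmetric])
      moreover have "m powr (p - 1) = m powr p / m" using m by (simp add: powr_diff)
      ultimately have "m powr p * (p * (x / m)) \<le> x powr p + (p - 1) * m powr p"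
        by (simp add: algebra_simps)
      moreover have "m powr p + p * m powr (p - 1) * (x - m) = m powr p * (p * (x / m)) - (p - 1) * m powr p"
        unfolding \<open>m powr (p - 1) = m powr p / m\<close> using m by (simp add: field_simps)
      ultimately show ?thesis by linarith
    qed
    have "?W * m powr p = (\<Sum>i\<in>I. w i * (m powr p + p * m powr (p - 1) * (a i - m)))"
    proof -
      have "(\<Sum>i\<in>I. w i * (m powr p + p * m powr (p - 1) * (a i - m)))
          = ?W * m powr p + p * m powr (p - 1) * (?S - ?W * m)"
        by (simp add: algebra_simps sum.distrib sum_subtractf sum_distrib_left sum_distrib_right)
      then show ?thesis using Wp by (simp add: m_def)
    qed
    also have "\<dots> \<le> (\<Sum>i\<in>I. w i * a i powr p)"
      using assms tangent by (intro sum_mono mult_left_mono) auto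
    finally have *: "?W * m powr p \<le> (\<Sum>i\<in>I. w i * a i powr p)" .
    have "?S powr p = ?W powr p * m powr p"
      using Wp Sp by (simp add: m_def powr_divide)
    also have "\<dots> = ?W powr (p - 1) * (?W * m powr p)"
      using Wp by (simp add: powr_diff)
    also have "\<dots> \<le> ?W powr (p - 1) * (\<Sum>i\<in>I. w i * a i powr p)"
      using * by (intro mult_left_mono) auto
    finally show ?thesis .
  qed
qed

lemma sum_powr_le:
  fixes p :: real
  assumes "1 < p" "finite I" "\<And>i. i \<in> I \<Longrightarrow> 0 \<le> a i"
  shows "(\<Sum>i\<in>I. a i) powr p \<le> real (card I) powr (p - 1) * (\<Sum>i\<in>I. a i powr p)"
  using weighted_power_mean[OF assms(1,2), of "\<lambda>_. 1" a] assms(3) by simp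

lemma add_powr_le:
  fixes p :: real
  assumes "1 < p" "0 \<le> a" "0 \<le> b"
  shows "(a + b) powr p \<le> 2 powr (p - 1) * (a powr p + b powr p)"
  using sum_powr_le[OF assms(1), of "UNIV :: bool set" "\<lambda>c. if c then a else b"] assms
  by (simp add: UNIV_bool add.commute split: if_splits)

section \<open>Smooth step functions and tensor products\<close>

text \<open>The one-dimensional counterpart of \<^const>\<open>Ck\<close>. The derivative is quantified existentially,
  so that closure properties follow by induction on the order without computing derivatives.\<close>
primrec Ck1 :: "nat \<Rightarrow> (real \<Rightarrow> real) \<Rightarrow> bool" where
  "Ck1 0 f \<longleftrightarrow> continuous_on UNIV f"
| "Ck1 (Suc k) f \<longleftrightarrow> (\<exists>f'. (\<forall>x. (f has_real_derivative f' x) (at x)) \<and> Ck1 k f')"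

definition smooth1 :: "(real \<Rightarrow> real) \<Rightarrow> bool" where
  "smooth1 f \<longleftrightarrow> (\<forall>k. Ck1 k f)"

lemma Ck1_continuous: "Ck1 k f \<Longrightarrow> continuous_on UNIV f"
  by (cases k) (auto simp: continuous_on_eq_continuous_at intro: DERIV_isCont)

lemma Ck1_Suc_imp: "Ck1 (Suc k) f \<Longrightarrow> Ck1 k f"
  by (induction k arbitrary: f) (use Ck1_continuous in fastforce)+

lemma Ck1_const: "Ck1 k (\<lambda>_. c)"
  by (induction k arbitrary: c) (auto intro!: exI[of _ "\<lambda>_. 0"])

lemma Ck1_add: "Ck1 k f \<Longrightarrow> Ck1 k g \<Longrightarrow> Ck1 k (\<lambda>x. f x + g x)"
proof (induction k arbitrary: f g)
  case (Suc k)
  then obtain f' g' where "\<forall>x. (f has_real_derivative f' x) (at x)" "Ck1 k f'"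
    "\<forall>x. (g has_real_derivative g' x) (at x)" "Ck1 k g'" by auto
  with Suc show ?case by (auto intro!: exI[of _ "\<lambda>x. f' x + g' x"] derivative_intros)
qed (auto intro: continuous_intros)

lemma Ck1_mult: "Ck1 k f \<Longrightarrow> Ck1 k g \<Longrightarrow> Ck1 k (\<lambda>x. f x * g x)"
proof (induction k arbitrary: f g)
  case (Suc k)
  then obtain f' g' where *: "\<forall>x. (f has_real_derivative f' x) (at x)" "Ck1 k f'"
    "\<forall>x. (g has_real_derivative g' x) (at x)" "Ck1 k g'" by auto
  have "Ck1 k f" "Ck1 k g" using Suc.prems Ck1_Suc_imp by blast+
  then have "Ck1 k (\<lambda>x. f' x * g x + g' x * f x)"
    using * Suc.IH by (intro Ck1_add) auto
  moreover have "\<forall>x. ((\<lambda>x. f x * g x) has_real_derivative f' x * g x + g' x * f x) (at x)"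
    using * by (auto intro!: DERIV_mult)
  ultimately show ?case by auto
qed (auto intro: continuous_intros)

lemma Ck1_affine: "Ck1 k f \<Longrightarrow> Ck1 k (\<lambda>x. f (a * x + b))"
proof (induction k arbitrary: f)
  case (Suc k)
  then obtain f' where *: "\<forall>x. (f has_real_derivative f' x) (at x)" "Ck1 k f'" by auto
  have "((\<lambda>x. f (a * x + b)) has_real_derivative a * f' (a * x + b)) (at x)" for x
    by (rule DERIV_cong[OF DERIV_chain2[OF *(1)[rule_format]]]) (auto intro!: derivative_eq_intros)
  moreover have "Ck1 k (\<lambda>x. a * f' (a * x + b))"
    using Suc.IH[OF *(2)] by (intro Ck1_mult Ck1_const)
  ultimately show ?case unfolding Ck1.simps by (intro exI[of _ "\<lambda>x. a * f' (a * x + b)"]) blast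
next
  case 0
  then have "continuous_on UNIV f" by simp
  then show ?case by (auto intro!: continuous_intros continuous_on_compose2[of UNIV f])
qed

lemma smooth1_const: "smooth1 (\<lambda>_. c)"
  and smooth1_add: "smooth1 f \<Longrightarrow> smooth1 g \<Longrightarrow> smooth1 (\<lambda>x. f x + g x)"
  and smooth1_mult: "smooth1 f \<Longrightarrow> smooth1 g \<Longrightarrow> smooth1 (\<lambda>x. f x * g x)"
  and smooth1_affine: "smooth1 f \<Longrightarrow> smooth1 (\<lambda>x. f (a * x + b))"
  by (simp_all add: smooth1_def Ck1_const Ck1_add Ck1_mult Ck1_affine)

lemma smooth1_diff: "smooth1 f \<Longrightarrow> smooth1 g \<Longrightarrow> smooth1 (\<lambda>x. f x - g x)"
  using smooth1_add[of f "\<lambda>x. (-1) * g x"] smooth1_mult[OF smooth1_const, of g "-1"] by simp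

lemma smooth1_continuous: "smooth1 f \<Longrightarrow> continuous_on UNIV f"
  using Ck1_continuous smooth1_def by blast

lemma smooth1_scale: "smooth1 f \<Longrightarrow> smooth1 (\<lambda>x. f ((x - b) / a))"
  using smooth1_affine[of f "1 / a" "- b / a"] by (simp add: diff_divide_distrib)

lemma smooth1_has_derivative:
  assumes "smooth1 f"
  obtains f' where "\<And>x. (f has_real_derivative f' x) (at x)" "smooth1 f'"
proof -
  have ex: "\<exists>f'. (\<forall>x. (f has_real_derivative f' x) (at x)) \<and> Ck1 k f'" for k
    using assms unfolding smooth1_def by (metis Ck1.simps(2))
  then obtain f' where f': "\<And>x. (f has_real_derivative f' x) (at x)" by blast
  have "Ck1 k f'" for k
  proof -
    obtain g where "\<And>x. (f has_real_derivative g x) (at x)" "Ck1 k g" using ex by blast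
    moreover then have "g = f'" using f' DERIV_unique by blast
    ultimately show ?thesis by simp
  qed
  then show ?thesis using that f' smooth1_def by blast
qed

text \<open>The family \<open>x\<^sup>-\<^sup>m exp (- 1 / x)\<close>, extended by 0 to \<open>x \<le> 0\<close>, is closed under differentiation up
  to linear combinations; this makes each of its members smooth.\<close>
definition flat :: "nat \<Rightarrow> real \<Rightarrow> real" where
  "flat m x = (if x > 0 then inverse x ^ m * exp (- inverse x) else 0)"

lemma flat_tendsto_0: "((\<lambda>x. inverse x ^ m * exp (- inverse x)) \<longlongrightarrow> (0::real)) (at_right 0)"
  using filterlim_compose[OF tendsto_power_div_exp_0[of m] filterlim_inverse_at_top_right]
  by (simp add: exp_minus field_simps)

lemma flat_derivative:
  "(flat m has_real_derivative (flat (m + 2) x - real m * flat (m + 1) x)) (at x)"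
proof -
  consider "x < 0" | "x = 0" | "x > 0" by linarith
  then show ?thesis
  proof cases
    case 1
    have "((\<lambda>_. 0) has_real_derivative 0) (at x)" by simp
    then have "(flat m has_real_derivative 0) (at x)"
      by (rule DERIV_cong_ev[THEN iffD1, rotated -1])
         (use 1 eventually_nhds_in_open[of "{..<0}" x] in \<open>auto elim!: eventually_mono simp: flat_def\<close>)
    then show ?thesis using 1 by (simp add: flat_def)
  next
    case 3
    have "((\<lambda>x. inverse x ^ m * exp (- inverse x)) has_real_derivative
        (flat (m + 2) x - real m * flat (m + 1) x)) (at x)"
    proof (cases m)
      case 0
      then show ?thesis using 3
        by (auto intro!: derivative_eq_intros simp: flat_def power2_eq_square)
    next
      case (Suc k)
      then show ?thesis using 3
        by (auto intro!: derivative_eq_intros simp: flat_def power2_eq_square algebra_simps power_Suc[symmetric] simp del: power_Suc)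
    qed
    then show ?thesis
      by (rule DERIV_cong_ev[THEN iffD1, rotated -1])
         (use 3 eventually_nhds_in_open[of "{0<..}" x] in \<open>auto elim!: eventually_mono simp: flat_def\<close>)
  next
    case 2
    have "((\<lambda>y. (flat m y - flat m 0) / (y - 0)) \<longlongrightarrow> 0) (at 0)"
    proof (rule filterlim_split_at)
      show "((\<lambda>y. (flat m y - flat m 0) / (y - 0)) \<longlongrightarrow> 0) (at_left 0)"
        by (rule tendsto_eventually) (auto simp: flat_def eventually_at_filter)
      show "((\<lambda>y. (flat m y - flat m 0) / (y - 0)) \<longlongrightarrow> 0) (at_right 0)"
        using flat_tendsto_0[of "Suc m"]
        by (rule Lim_transform_eventually) (auto simp: flat_def eventually_at_filter field_simps)
    qed
    then have "(flat m has_real_derivative 0) (at 0)"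
      by (simp add: has_field_derivative_iff)
    then show ?thesis using 2 by (simp add: flat_def)
  qed
qed

lemma smooth1_flat: "smooth1 (flat m)"
proof -
  have "Ck1 k (flat m)" for k
  proof (induction k arbitrary: m)
    case 0
    then show ?case using flat_derivative
      by (auto simp: continuous_on_eq_continuous_at intro: DERIV_isCont)
  next
    case (Suc k)
    have "Ck1 k (\<lambda>x. flat (m + 2) x + (- real m) * flat (m + 1) x)"
      using Suc by (intro Ck1_add Ck1_mult Ck1_const)
    then have "Ck1 k (\<lambda>x. flat (m + 2) x - real m * flat (m + 1) x)" by simp
    then show ?case unfolding Ck1.simps
      by (intro exI[of _ "\<lambda>x. flat (m + 2) x - real m * flat (m + 1) x"] conjI allI flat_derivative)
  qed
  then show ?thesis by (simp add: smooth1_def)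
qed

text \<open>The step is the normalised primitive of \<open>flat 0 (1 + x) * flat 0 (1 - x)\<close>.\<close>
lemma smooth_step_exists:
  "\<exists>H \<psi>. smooth1 H \<and> smooth1 \<psi> \<and> (\<forall>x. (H has_real_derivative \<psi> x) (at x)) \<and>
     (\<forall>x\<le>-1. H x = 0) \<and> (\<forall>x\<ge>1. H x = 1) \<and> (\<forall>x. \<bar>x\<bar> \<ge> 1 \<longrightarrow> \<psi> x = 0) \<and> (\<forall>x. \<bar>x\<bar> < 1 \<longrightarrow> 0 < \<psi> x)"
proof -
  define w where "w x = flat 0 (1 * x + 1) * flat 0 ((-1) * x + 1)" for x
  have sw: "smooth1 w" unfolding w_def by (intro smooth1_mult smooth1_affine smooth1_flat)
  have w0: "w x = 0" if "\<bar>x\<bar> \<ge> 1" for x using that by (auto simp: w_def flat_def)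
  have wpos: "0 < w x" if "\<bar>x\<bar> < 1" for x using that by (auto simp: w_def flat_def)
  have wnn: "0 \<le> w x" for x using w0[of x] wpos[of x] by (cases "\<bar>x\<bar> < 1") auto
  have cw: "continuous_on S w" for S using smooth1_continuous[OF sw] continuous_on_subset by blast
  define W where "W x = integral {-2..x} w" for x
  have Wl: "W x = 0" if "x \<le> -1" for x
    unfolding W_def using that w0 by (intro integral_unique has_integral_is_0) auto
  have dW: "(W has_real_derivative w x) (at x)" for x
  proof (cases "x < -1")
    case True
    have "((\<lambda>_. 0) has_real_derivative w x) (at x)" using True w0 by simp
    then show ?thesis
      by (rule DERIV_cong_ev[THEN iffD1, rotated -1])
         (use True eventually_nhds_in_open[of "{..<-1}" x] in \<open>auto elim!: eventually_mono simp: Wl\<close>)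
  next
    case False
    have "(W has_real_derivative w x) (at x within {-2..x + 1})"
      unfolding W_def using False cw by (intro integral_has_real_derivative) auto
    moreover have "at x within {-2..x + 1} = at x"
      using False by (intro at_within_interior) auto
    ultimately show ?thesis by simp
  qed
  have Wr: "W x = W 1" if "x \<ge> 1" for x
  proof -
    have "W x = W 1 + integral {1..x} w"
      unfolding W_def using that
      by (intro Henstock_Kurzweil_Integration.integral_combine[symmetric] integrable_continuous_real cw) auto
    moreover have "integral {1..x} w = 0"
      using w0 by (intro integral_unique has_integral_is_0) auto
    ultimately show ?thesis by simp
  qed
  obtain z where z: "-1 < z" "z < 1" "W 1 - W (-1) = (1 - (-1)) * w z"
    using MVT2[of "-1" 1 W w] dW by auto
  then have W1: "0 < W 1" using Wl[of "-1"] wpos[of z] by auto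
  have smW: "smooth1 W"
    unfolding smooth1_def
  proof
    fix k show "Ck1 k W"
    proof (cases k)
      case 0
      then show ?thesis using dW by (auto simp: continuous_on_eq_continuous_at intro: DERIV_isCont)
    next
      case (Suc k)
      then show ?thesis using dW sw by (auto simp: smooth1_def)
    qed
  qed
  define H \<psi> where "H x = (1 / W 1) * W x" and "\<psi> x = (1 / W 1) * w x" for x
  have "smooth1 H" "smooth1 \<psi>"
    unfolding H_def[abs_def] \<psi>_def[abs_def] by (intro smooth1_mult smooth1_const smW sw)+
  moreover have "(H has_real_derivative \<psi> x) (at x)" for x
    unfolding H_def[abs_def] \<psi>_def by (rule DERIV_cmult[OF dW])
  moreover have "H x = 0" if "x \<le> -1" for x
    unfolding H_def Wl[OF that] by simp
  moreover have "H x = 1" if "x \<ge> 1" for x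
    unfolding H_def Wr[OF that] using W1 by simp
  moreover have "\<forall>x. \<bar>x\<bar> \<ge> 1 \<longrightarrow> \<psi> x = 0" "\<forall>x. \<bar>x\<bar> < 1 \<longrightarrow> 0 < \<psi> x"
    using w0 wpos W1 by (auto simp: \<psi>_def)
  ultimately show ?thesis by blast
qed

definition step :: "real \<Rightarrow> real" where
  "step = (SOME H. \<exists>\<psi>. smooth1 H \<and> smooth1 \<psi> \<and> (\<forall>x. (H has_real_derivative \<psi> x) (at x)) \<and>
     (\<forall>x\<le>-1. H x = 0) \<and> (\<forall>x\<ge>1. H x = 1) \<and> (\<forall>x. \<bar>x\<bar> \<ge> 1 \<longrightarrow> \<psi> x = 0) \<and> (\<forall>x. \<bar>x\<bar> < 1 \<longrightarrow> 0 < \<psi> x))"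

definition bump :: "real \<Rightarrow> real" where
  "bump = deriv step"

lemma step_bump:
  "smooth1 step" "smooth1 bump" "(step has_real_derivative bump x) (at x)"
  "x \<le> -1 \<Longrightarrow> step x = 0" "x \<ge> 1 \<Longrightarrow> step x = 1"
  "\<bar>x\<bar> \<ge> 1 \<Longrightarrow> bump x = 0" "\<bar>x\<bar> < 1 \<Longrightarrow> 0 < bump x"
proof -
  obtain \<psi> where *: "smooth1 step \<and> smooth1 \<psi> \<and> (\<forall>x. (step has_real_derivative \<psi> x) (at x)) \<and>
     (\<forall>x\<le>-1. step x = 0) \<and> (\<forall>x\<ge>1. step x = 1) \<and> (\<forall>x. \<bar>x\<bar> \<ge> 1 \<longrightarrow> \<psi> x = 0) \<and> (\<forall>x. \<bar>x\<bar> < 1 \<longrightarrow> 0 < \<psi> x)"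
    using someI_ex[OF smooth_step_exists] unfolding step_def by blast
  have "\<psi> = bump" unfolding bump_def using * by (metis DERIV_imp_deriv ext)
  with * show "smooth1 step" "smooth1 bump" "(step has_real_derivative bump x) (at x)"
    "x \<le> -1 \<Longrightarrow> step x = 0" "x \<ge> 1 \<Longrightarrow> step x = 1"
    "\<bar>x\<bar> \<ge> 1 \<Longrightarrow> bump x = 0" "\<bar>x\<bar> < 1 \<Longrightarrow> 0 < bump x" by auto
qed

lemma bump_nonneg: "0 \<le> bump x"
  using step_bump(6,7)[of x] by (cases "\<bar>x\<bar> < 1") auto

lemma step_mono: "x \<le> y \<Longrightarrow> step x \<le> step y"
  by (rule DERIV_nonneg_imp_nondecreasing) (use step_bump(3) bump_nonneg in blast)+

lemma step_bounds: "0 \<le> step x" "step x \<le> 1"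
  using step_mono[of "min x (-1)" x] step_mono[of x "max x 1"] step_bump(4,5) by (auto simp: min_def max_def split: if_splits)

lemma smooth1_bounded:
  assumes "smooth1 f" "\<And>x. 1 \<le> \<bar>x\<bar> \<Longrightarrow> f x = 0"
  obtains B where "1 \<le> B" "\<And>x. \<bar>f x\<bar> \<le> B"
proof -
  have "bounded (f ` {-1..1})"
    using assms(1) by (intro compact_imp_bounded compact_continuous_image)
      (auto intro: continuous_on_subset smooth1_continuous)
  then obtain B where B: "\<And>x. x \<in> {-1..1} \<Longrightarrow> \<bar>f x\<bar> \<le> B"
    unfolding bounded_iff by (metis imageI real_norm_def)
  have "\<bar>f x\<bar> \<le> max 1 B" for x
    using B[of x] assms(2)[of x] by (cases "\<bar>x\<bar> < 1") (auto simp: abs_less_iff intro: max.coboundedI2)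
  then show ?thesis using that[of "max 1 B"] by auto
qed

text \<open>Products of functions of single coordinates. A partial derivative replaces one factor by its
  derivative, so that smoothness is inherited from the factors, and two such products can be
  compared by exchanging one factor at a time.\<close>
definition tensor :: "('n \<Rightarrow> real \<Rightarrow> real) \<Rightarrow> real ^ 'n \<Rightarrow> real" where
  "tensor f y = (\<Prod>j\<in>UNIV. f j (y $ j))"

lemma has_derivative_tensor:
  assumes "\<And>j x. (f j has_real_derivative f' j x) (at x)"
  shows "(tensor f has_derivative (\<lambda>h. \<Sum>i\<in>UNIV. h $ i * tensor (f(i := f' i)) x)) (at x)"
proof -
  have "((\<lambda>y. f j (y $ j)) has_derivative (\<lambda>h. h $ j * f' j (x $ j))) (at x)" for j
    using DERIV_compose_FDERIV[OF assms, of "\<lambda>y. y $ j" "\<lambda>h. h $ j" x UNIV j]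
    by (simp add: bounded_linear_imp_has_derivative bounded_linear_vec_nth)
  then have "((\<lambda>y. \<Prod>j\<in>UNIV. f j (y $ j)) has_derivative
      (\<lambda>h. \<Sum>i\<in>UNIV. (h $ i * f' i (x $ i)) * (\<Prod>j\<in>UNIV - {i}. f j (x $ j)))) (at x)"
    by (intro has_derivative_prod) auto
  moreover have "f' i (x $ i) * (\<Prod>j\<in>UNIV - {i}. f j (x $ j)) = tensor (f(i := f' i)) x" for i
    unfolding tensor_def by (subst prod.remove[of UNIV i]) (auto intro!: prod.cong)
  ultimately show ?thesis unfolding tensor_def[abs_def] by (simp add: mult.assoc)
qed

lemma partial_deriv_tensor:
  assumes "\<And>j x. (f j has_real_derivative f' j x) (at x)"
  shows "partial_deriv i (tensor f) x = tensor (f(i := f' i)) x"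
  unfolding partial_deriv_def frechet_derivative_at[OF has_derivative_tensor[OF assms], symmetric]
  by (simp add: axis_def if_distrib[of "\<lambda>u. u * _"] cong: if_cong)

lemma Ck_tensor: "(\<And>j. smooth1 (f j)) \<Longrightarrow> Ck k (tensor f)"
proof (induction k arbitrary: f)
  case 0
  have "continuous_on UNIV (\<lambda>y. f j (y $ j))" for j
    by (rule continuous_on_compose2[OF smooth1_continuous[OF 0]]) (auto intro: continuous_intros)
  then show ?case unfolding Ck.simps tensor_def[abs_def] by (intro continuous_on_prod) auto
next
  case (Suc k)
  have "\<exists>f'. \<forall>j. (\<forall>x. (f j has_real_derivative f' j x) (at x)) \<and> smooth1 (f' j)"
    by (rule choice) (metis Suc.prems smooth1_has_derivative)
  then obtain f' where f': "\<And>j x. (f j has_real_derivative f' j x) (at x)" "\<And>j. smooth1 (f' j)" by blast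
  have "Ck k (partial_deriv i (tensor f))" for i
    unfolding partial_deriv_tensor[OF f'(1), abs_def]
    by (rule Suc.IH) (use f' Suc.prems in auto)
  moreover have "tensor f differentiable_on UNIV"
    unfolding differentiable_on_def differentiable_def
    using has_derivative_tensor[of f f', OF f'(1)] by blast
  ultimately show ?case by simp
qed

lemma test_function_tensor:
  assumes "\<And>j. smooth1 (f j)" "\<And>j s. s \<notin> {a $ j..b $ j} \<Longrightarrow> f j s = 0" "cbox a b \<subseteq> \<Omega>"
  shows "test_function \<Omega> (tensor f)"
proof -
  have "tensor f x = 0" if "x \<notin> cbox a b" for x
  proof -
    have "\<exists>j. x $ j \<notin> {a $ j..b $ j}" using that by (simp add: mem_box_cart)
    then obtain j where "x $ j \<notin> {a $ j..b $ j}" by blast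
    then have "f j (x $ j) = 0" using assms(2) by blast
    then show ?thesis by (auto simp: tensor_def intro!: prod_zero)
  qed
  then show ?thesis
    unfolding test_function_def
    by (intro conjI allI exI[of _ "cbox a b"] impI Ck_tensor assms compact_cbox)
qed

lemma tensor_fun_upd:
  "tensor (f(i := u)) x = u (x $ i) * (\<Prod>j\<in>UNIV - {i}. f j (x $ j))"
  unfolding tensor_def by (subst prod.remove[of UNIV i]) (auto intro!: prod.cong)

section \<open>Weak gradients: continuously differentiable functions and uniqueness\<close>

lemma integral_lebesgue_on:
  fixes f :: "real ^ 'n \<Rightarrow> real"
  assumes "open \<Omega>"
  shows "(LINT x|lebesgue_on \<Omega>. f x) = (LINT x|lebesgue. indicator \<Omega> x * f x)"
    and "integrable (lebesgue_on \<Omega>) f \<longleftrightarrow> integrable lebesgue (\<lambda>x. indicator \<Omega> x * f x)"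
  using assms by (simp_all add: integral_restrict_space integrable_restrict_space)

text \<open>The two open sets \<open>\<Omega>\<close> and \<open>- K\<close> cover the space, and \<open>f\<close> is continuous on each of them.\<close>
lemma continuous_zero_extension:
  fixes f :: "real ^ 'n \<Rightarrow> real"
  assumes "open \<Omega>" "closed K" "K \<subseteq> \<Omega>" "continuous_on \<Omega> f" "\<And>x. x \<notin> K \<Longrightarrow> f x = 0"
  shows "continuous_on UNIV f"
proof -
  have "continuous_on (- K) f"
    using assms(5) by (subst continuous_on_cong[OF refl, of _ _ "\<lambda>_. 0"]) auto
  then have "continuous_on (\<Omega> \<union> - K) f"
    using assms by (intro continuous_on_open_Un) (auto simp: open_Compl)
  moreover have "\<Omega> \<union> - K = UNIV" using assms(3) by auto
  ultimately show ?thesis by simp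
qed

lemma integrable_compact_support:
  fixes f :: "real ^ 'n \<Rightarrow> real"
  assumes "continuous_on UNIV f" "compact K" "\<And>x. x \<notin> K \<Longrightarrow> f x = 0"
  shows "integrable lborel f"
proof -
  have "integrable lborel (\<lambda>x. indicator K x *\<^sub>R f x)"
    by (intro borel_integrable_compact assms(2) continuous_on_subset[OF assms(1)]) auto
  moreover have "(\<lambda>x. indicator K x *\<^sub>R f x) = f"
    using assms(3) by (auto simp: indicator_def fun_eq_iff)
  ultimately show ?thesis by simp
qed

lemma integral_shift:
  fixes f :: "real ^ 'n \<Rightarrow> real"
  assumes "f \<in> borel_measurable borel"
  shows "(LINT x|lborel. f (c + x)) = (LINT x|lborel. f x)"
proof -
  have "(LINT x|lborel. f x) = (LINT x|distr lborel borel ((+) c). f x)"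
    by (simp add: lborel_distr_plus)
  also have "\<dots> = (LINT x|lborel. f (c + x))"
    using assms by (subst integral_distr) auto
  finally show ?thesis by simp
qed

text \<open>Difference quotients of \<open>u\<close> integrate to 0 by translation invariance, and converge boundedly to
  the directional derivative.\<close>
lemma integral_directional_derivative_eq_0:
  fixes u v :: "real ^ 'n \<Rightarrow> real"
  assumes v: "continuous_on UNIV v" and u: "continuous_on UNIV u" and K: "compact K"
    and u0: "\<And>x. x \<notin> K \<Longrightarrow> u x = 0" and v0: "\<And>x. x \<notin> K \<Longrightarrow> v x = 0"
    and der: "\<And>x. ((\<lambda>t. u (x + t *\<^sub>R e)) has_real_derivative v x) (at 0)"
  shows "(LINT x|lborel. v x) = 0"
proof -
  define h where "h n = inverse (real (Suc n))" for n
  have hpos: "0 < h n" "h n \<le> 1" for n by (auto simp: h_def field_simps)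
  have h0: "h \<longlonglongrightarrow> 0" unfolding h_def by (rule LIMSEQ_inverse_real_of_nat)
  define s where "s n x = (u (h n *\<^sub>R e + x) - u x) / h n" for n x
  have iu: "integrable lborel u" by (rule integrable_compact_support[OF u K u0])
  have ub: "u \<in> borel_measurable borel" using u by (rule borel_measurable_continuous_onI)
  have ius: "integrable lborel (\<lambda>x. u (c + x))" for c
  proof -
    have "integrable (distr lborel borel ((+) c)) u" using iu by (simp add: lborel_distr_plus)
    then show ?thesis by (subst (asm) integrable_distr_eq) (use ub in auto)
  qed
  have s0: "(LINT x|lborel. s n x) = 0" for n
    unfolding s_def using iu ius integral_shift[OF ub] by simp
  have "bounded (v ` K)"
    by (intro compact_imp_bounded compact_continuous_image K continuous_on_subset[OF v]) auto
  then obtain B0 where B0: "\<And>x. x \<in> K \<Longrightarrow> \<bar>v x\<bar> \<le> B0" unfolding bounded_iff by (metis imageI real_norm_def)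
  define B where "B = max 0 B0"
  have B: "\<bar>v x\<bar> \<le> B" for x using B0[of x] v0[of x] unfolding B_def by (cases "x \<in> K") auto
  obtain R where R: "\<And>x. x \<in> K \<Longrightarrow> norm x \<le> R" using K compact_imp_bounded bounded_iff by metis
  define K' where "K' = cball (0 :: real ^ 'n) (R + norm e)"
  have der': "((\<lambda>t. u (x + t *\<^sub>R e)) has_real_derivative v (x + t *\<^sub>R e)) (at t)" for x t
  proof -
    have "((\<lambda>z. u ((x + t *\<^sub>R e) + z *\<^sub>R e)) has_real_derivative v (x + t *\<^sub>R e)) (at 0)" by (rule der)
    then have "((\<lambda>z. u (x + (t + z) *\<^sub>R e)) has_real_derivative v (x + t *\<^sub>R e)) (at 0)"
      by (simp add: algebra_simps)
    then show ?thesis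
      using DERIV_shift[of "\<lambda>t. u (x + t *\<^sub>R e)" "v (x + t *\<^sub>R e)" 0 t] by (simp add: add.commute)
  qed
  have sb: "norm (s n x) \<le> B * indicator K' x" for n x
  proof -
    obtain t where t: "0 < t" "t < h n" "u (x + h n *\<^sub>R e) - u (x + 0 *\<^sub>R e) = (h n - 0) * v (x + t *\<^sub>R e)"
      using MVT2[of 0 "h n" "\<lambda>t. u (x + t *\<^sub>R e)" "\<lambda>t. v (x + t *\<^sub>R e)"] der' hpos[of n] by auto
    then have st: "s n x = v (x + t *\<^sub>R e)" unfolding s_def using hpos[of n] by (simp add: add.commute)
    show ?thesis
    proof (cases "x \<in> K'")
      case True then show ?thesis using B st by simp
    next
      case False
      have "norm (t *\<^sub>R e) \<le> norm e" using t hpos(2)[of n] by (simp add: mult_left_le_one_le)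
      moreover have "R + norm e < norm x" using False by (simp add: K'_def)
      ultimately have "R < norm (x + t *\<^sub>R e)" using norm_diff_ineq[of x "t *\<^sub>R e"] by linarith
      then have "x + t *\<^sub>R e \<notin> K" using R by force
      then show ?thesis using v0 st False by simp
    qed
  qed
  have lim: "(\<lambda>n. s n x) \<longlonglongrightarrow> v x" for x
  proof -
    have "((\<lambda>t. (u (x + t *\<^sub>R e) - u x) / t) \<longlongrightarrow> v x) (at 0)"
      using der[of x] by (simp add: has_field_derivative_iff)
    then have "(\<lambda>n. (u (x + h n *\<^sub>R e) - u x) / h n) \<longlonglongrightarrow> v x"
      by (rule filterlim_compose) (use h0 hpos in \<open>auto simp: filterlim_at intro!: always_eventually less_imp_neq[symmetric]\<close>)
    then show ?thesis by (simp add: s_def add.commute)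
  qed
  have "(\<lambda>n. LINT x|lborel. s n x) \<longlonglongrightarrow> (LINT x|lborel. v x)"
  proof (rule integral_dominated_convergence)
    show "integrable lborel (\<lambda>x. B * indicator K' x)"
      unfolding K'_def using emeasure_bounded_finite[of "cball (0 :: real ^ 'n) (R + norm e)"] by (intro integrable_mult_right integrable_real_indicator) auto
    show "v \<in> borel_measurable lborel" using v borel_measurable_continuous_onI by simp
    show "s n \<in> borel_measurable lborel" for n
      unfolding s_def[abs_def] using ius iu by (intro borel_measurable_integrable) auto
  qed (use sb lim in auto)
  then show ?thesis unfolding s0 by (simp add: LIMSEQ_const_iff)
qed

lemma has_derivative_nhds_cong:
  assumes "(f has_derivative D) (at x)" "eventually (\<lambda>y. f y = g y) (nhds x)"
  shows "(g has_derivative D) (at x)"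
proof (rule has_derivative_transform_eventually[OF assms(1)])
  show "eventually (\<lambda>y. f y = g y) (at x)"
    using assms(2) by (auto simp: eventually_at_filter elim: eventually_mono)
  show "f x = g x" using eventually_nhds_x_imp_x[OF assms(2)] .
qed simp

lemma test_function_props:
  fixes \<phi> :: "real ^ 'n \<Rightarrow> real"
  assumes "test_function \<Omega> \<phi>"
  obtains K where "compact K" "K \<subseteq> \<Omega>" "\<And>x. x \<notin> K \<Longrightarrow> \<phi> x = 0" "\<And>i x. x \<notin> K \<Longrightarrow> partial_deriv i \<phi> x = 0"
    "continuous_on UNIV \<phi>" "\<And>i. continuous_on UNIV (partial_deriv i \<phi>)"
    "\<And>x. (\<phi> has_derivative (\<lambda>h. \<Sum>i\<in>UNIV. h $ i * partial_deriv i \<phi> x)) (at x)"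
proof -
  obtain K where K: "compact K" "K \<subseteq> \<Omega>" "\<And>x. x \<notin> K \<Longrightarrow> \<phi> x = 0"
    using assms unfolding test_function_def by blast
  have C: "Ck 0 \<phi>" "Ck 1 \<phi>" using assms unfolding test_function_def by blast+
  have d: "(\<phi> has_derivative frechet_derivative \<phi> (at x)) (at x)" for x
    using C(2) by (simp add: differentiable_on_def frechet_derivative_works)
  have "frechet_derivative \<phi> (at x) h = (\<Sum>i\<in>UNIV. h $ i * partial_deriv i \<phi> x)" for x h
  proof -
    interpret linear "frechet_derivative \<phi> (at x)"
      using d has_derivative_linear by blast
    have "frechet_derivative \<phi> (at x) h = frechet_derivative \<phi> (at x) (\<Sum>i\<in>UNIV. h $ i *\<^sub>R axis i 1)"
      by (simp only: basis_expansion[of h, unfolded scalar_mult_eq_scaleR])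
    also have "\<dots> = (\<Sum>i\<in>UNIV. h $ i * partial_deriv i \<phi> x)"
      by (simp add: sum scale partial_deriv_def)
    finally show ?thesis .
  qed
  then have d': "(\<phi> has_derivative (\<lambda>h. \<Sum>i\<in>UNIV. h $ i * partial_deriv i \<phi> x)) (at x)" for x
    using d[of x] by presburger
  have pd: "partial_deriv i \<phi> x = 0" if "x \<notin> K" for i x
  proof -
    have "eventually (\<lambda>y. 0 = \<phi> y) (nhds x)"
      using K that eventually_nhds_in_open[of "- K" x] compact_imp_closed[OF K(1)]
      by (auto elim!: eventually_mono simp: open_Compl)
    moreover have "((\<lambda>_. 0) has_derivative (\<lambda>_. 0 :: real)) (at x)" by simp
    ultimately have "(\<phi> has_derivative (\<lambda>_. 0)) (at x)"
      by (rule has_derivative_nhds_cong[rotated])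
    then have "frechet_derivative \<phi> (at x) = (\<lambda>_. 0)" by (simp add: frechet_derivative_at[symmetric])
    then show ?thesis by (simp add: partial_deriv_def)
  qed
  have cp: "continuous_on UNIV (partial_deriv i \<phi>)" for i using C(2) by simp
  have c\<phi>: "continuous_on UNIV \<phi>" using C(1) by simp
  show ?thesis
  proof (rule that)
    show "compact K" "K \<subseteq> \<Omega>" "continuous_on UNIV \<phi>" by fact+
    show "\<phi> x = 0" if "x \<notin> K" for x by (rule K(3)[OF that])
    show "partial_deriv i \<phi> x = 0" if "x \<notin> K" for i x by (rule pd[OF that])
    show "continuous_on UNIV (partial_deriv i \<phi>)" for i by (rule cp)
    show "(\<phi> has_derivative (\<lambda>h. \<Sum>i\<in>UNIV. h $ i * partial_deriv i \<phi> x)) (at x)" for x by (rule d')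
  qed
qed

text \<open>For a test function \<open>\<phi>\<close> the product \<open>F * \<phi>\<close>, extended by 0, is continuously differentiable with
  compact support, so its partial derivatives have integral 0; the product rule does the rest.\<close>
lemma has_weak_gradient_C1:
  fixes F :: "real ^ 'n \<Rightarrow> real"
  assumes op: "open \<Omega>" and dF: "\<And>x. x \<in> \<Omega> \<Longrightarrow> (F has_derivative (\<lambda>h. \<Sum>i\<in>UNIV. h $ i * G x $ i)) (at x)"
    and cG: "continuous_on \<Omega> G"
  shows "has_weak_gradient \<Omega> F G"
proof -
  have cF: "continuous_on \<Omega> F"
    using dF op by (auto simp: continuous_on_eq_continuous_at dest: has_derivative_continuous)
  have abs_int: "f absolutely_integrable_on K" if "compact K" "K \<subseteq> \<Omega>" "continuous_on \<Omega> f"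
    for f :: "real ^ 'n \<Rightarrow> 'b::{banach, second_countable_topology}" and K
  proof -
    have "integrable lborel (\<lambda>x. indicator K x *\<^sub>R f x)"
      by (intro borel_integrable_compact continuous_on_subset[OF that(3)] that)
    then show ?thesis
      unfolding set_integrable_def by (subst integrable_completion) auto
  qed
  have "(LINT x|lebesgue_on \<Omega>. F x * partial_deriv i \<phi> x) = - (LINT x|lebesgue_on \<Omega>. G x $ i * \<phi> x)"
    if \<phi>: "test_function \<Omega> \<phi>" for \<phi> i
  proof -
    obtain K where K: "compact K" "K \<subseteq> \<Omega>" "\<And>x. x \<notin> K \<Longrightarrow> \<phi> x = 0" "\<And>i x. x \<notin> K \<Longrightarrow> partial_deriv i \<phi> x = 0"
      and c: "continuous_on UNIV \<phi>" "\<And>i. continuous_on UNIV (partial_deriv i \<phi>)"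
      and d: "\<And>x. (\<phi> has_derivative (\<lambda>h. \<Sum>i\<in>UNIV. h $ i * partial_deriv i \<phi> x)) (at x)"
      by (rule test_function_props[OF \<phi>]) (blast intro: that)
    have clK: "closed K" by (rule compact_imp_closed[OF K(1)])
    define ind where "ind x = (indicator \<Omega> x :: real)" for x
    have cG': "continuous_on \<Omega> (\<lambda>x. G x $ i)" for i using cG by (intro continuous_intros)
    have cext: "continuous_on UNIV (\<lambda>x. ind x * (f x * g x))"
      if "continuous_on \<Omega> f" "continuous_on UNIV g" "\<And>x. x \<notin> K \<Longrightarrow> g x = 0" for f g :: "real ^ 'n \<Rightarrow> real"
    proof (rule continuous_zero_extension[OF op clK K(2)])
      have "continuous_on \<Omega> (\<lambda>x. f x * g x)"
        using that by (intro continuous_on_mult) (auto intro: continuous_on_subset)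
      then show "continuous_on \<Omega> (\<lambda>x. ind x * (f x * g x))"
        by (rule continuous_on_eq) (simp add: ind_def)
    qed (use that in auto)
    let ?A = "\<lambda>x. ind x * (F x * partial_deriv i \<phi> x)" and ?B = "\<lambda>x. ind x * (G x $ i * \<phi> x)"
    have cA: "continuous_on UNIV ?A" by (intro cext cF c K)
    have cB: "continuous_on UNIV ?B" by (intro cext cG' c K)
    have iA: "integrable lborel ?A" using K by (intro integrable_compact_support[OF cA K(1)]) auto
    have iB: "integrable lborel ?B" using K by (intro integrable_compact_support[OF cB K(1)]) auto
    define e :: "real ^ 'n" where "e = axis i 1"
    have "(LINT x|lborel. ?A x + ?B x) = 0"
    proof (rule integral_directional_derivative_eq_0[where K = K and u = "\<lambda>x. ind x * (F x * \<phi> x)" and e = e])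
      show "continuous_on UNIV (\<lambda>x. ?A x + ?B x)" by (intro continuous_on_add cA cB)
      show "continuous_on UNIV (\<lambda>x. ind x * (F x * \<phi> x))" by (intro cext cF c K)
      fix x
      have line: "((\<lambda>t. x + t *\<^sub>R e) has_derivative (\<lambda>t. t *\<^sub>R e)) (at 0)"
        by (auto intro!: derivative_eq_intros)
      have ax: "(\<Sum>j\<in>UNIV. (t *\<^sub>R e) $ j * w j) = t * w i" for t and w :: "'n \<Rightarrow> real"
        by (simp add: e_def axis_def if_distrib[of "\<lambda>u. _ * u"] if_distrib[of "\<lambda>u. u * _"] cong: if_cong)
      show "((\<lambda>t. ind (x + t *\<^sub>R e) * (F (x + t *\<^sub>R e) * \<phi> (x + t *\<^sub>R e)))
          has_real_derivative ?A x + ?B x) (at 0)"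
      proof (cases "x \<in> \<Omega>")
        case True
        have "((\<lambda>y. F y * \<phi> y) has_derivative
            (\<lambda>h. F x * (\<Sum>j\<in>UNIV. h $ j * partial_deriv j \<phi> x) + (\<Sum>j\<in>UNIV. h $ j * G x $ j) * \<phi> x)) (at x)"
          by (rule has_derivative_mult[OF dF[OF True] d])
        moreover have "eventually (\<lambda>y. F y * \<phi> y = ind y * (F y * \<phi> y)) (nhds x)"
          using eventually_nhds_in_open[OF op True] by (auto elim!: eventually_mono simp: ind_def)
        ultimately have "((\<lambda>y. ind y * (F y * \<phi> y)) has_derivative
            (\<lambda>h. F x * (\<Sum>j\<in>UNIV. h $ j * partial_deriv j \<phi> x) + (\<Sum>j\<in>UNIV. h $ j * G x $ j) * \<phi> x)) (at x)"
          by (rule has_derivative_nhds_cong)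
        then have "((\<lambda>t. ind (x + t *\<^sub>R e) * (F (x + t *\<^sub>R e) * \<phi> (x + t *\<^sub>R e))) has_derivative
            (\<lambda>t. F x * (\<Sum>j\<in>UNIV. (t *\<^sub>R e) $ j * partial_deriv j \<phi> x) + (\<Sum>j\<in>UNIV. (t *\<^sub>R e) $ j * G x $ j) * \<phi> x)) (at 0)"
          by (intro has_derivative_compose[OF line]) simp
        moreover have "ind x = 1" using True by (simp add: ind_def)
        ultimately show ?thesis unfolding ax has_field_derivative_def
          by (elim has_derivative_eq_rhs) (simp add: fun_eq_iff algebra_simps)
      next
        case False
        then have x: "x \<in> - K" using K(2) by auto
        have "isCont (\<lambda>t. x + t *\<^sub>R e) 0" by (intro continuous_intros)
        moreover have "open (- K)" using clK by (simp add: open_Compl)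
        ultimately have "eventually (\<lambda>t. x + t *\<^sub>R e \<in> - K) (nhds 0)"
          using x unfolding isCont_def by (intro topological_tendstoD[of _ "x"]) (auto simp: tendsto_nhds_iff continuous_at)
        then have "eventually (\<lambda>t. 0 = ind (x + t *\<^sub>R e) * (F (x + t *\<^sub>R e) * \<phi> (x + t *\<^sub>R e))) (nhds 0)"
          by (auto elim!: eventually_mono simp: K(3))
        moreover have "((\<lambda>t. 0) has_real_derivative ?A x + ?B x) (at 0)" using x K by simp
        ultimately show ?thesis
          unfolding has_field_derivative_def by (rule has_derivative_nhds_cong[rotated])
      qed
    qed (use K in auto)
    then have "(LINT x|lborel. ?A x) = - (LINT x|lborel. ?B x)" using iA iB by simp
    moreover have "(LINT x|lebesgue. w x) = (LINT x|lborel. w x)" if "continuous_on UNIV w" for w :: "real ^ 'n \<Rightarrow> real"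
      using that by (intro integral_completion) (simp add: borel_measurable_continuous_onI)
    ultimately show ?thesis
      using cA cB unfolding integral_lebesgue_on[OF op] ind_def by simp
  qed
  then show ?thesis
    unfolding has_weak_gradient_def using abs_int[OF _ _ cF] abs_int[OF _ _ cG] by simp
qed

text \<open>A smooth approximation from inside of the indicator function of the interval from \<open>a $ j\<close> to
  \<open>b $ j\<close>, with transition zones of width \<open>2 / m\<close> at both ends.\<close>
definition cutoff :: "real ^ 'n \<Rightarrow> real ^ 'n \<Rightarrow> real \<Rightarrow> 'n \<Rightarrow> real \<Rightarrow> real" where
  "cutoff a b m j s = step (m * s + (- m * a $ j - 1)) - step (m * s + (- m * b $ j + 1))"

lemma smooth1_cutoff: "smooth1 (cutoff a b m j)"
  unfolding cutoff_def by (intro smooth1_diff smooth1_affine step_bump)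

lemma cutoff_bound: "\<bar>cutoff a b m j s\<bar> \<le> 1"
  unfolding cutoff_def by (smt (verit) step_bounds)

lemma cutoff_eq_0:
  assumes "0 < m" "2 \<le> m * (b $ j - a $ j)" "s \<notin> {a $ j<..<b $ j}"
  shows "cutoff a b m j s = 0"
proof -
  have ex: "m * (b $ j - a $ j) = m * b $ j - m * a $ j" by (simp add: algebra_simps)
  consider "s \<le> a $ j" | "b $ j \<le> s" using assms(3) by auto
  then show ?thesis
  proof cases
    case 1
    then have "m * s \<le> m * a $ j" using assms(1) by simp
    then show ?thesis unfolding cutoff_def using assms(2) ex by (simp add: step_bump(4))
  next
    case 2
    then have "m * b $ j \<le> m * s" using assms(1) by simp
    then show ?thesis unfolding cutoff_def using assms(2) ex by (simp add: step_bump(5))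
  qed
qed

lemma cutoff_eq_1:
  assumes "2 \<le> m * (s - a $ j)" "2 \<le> m * (b $ j - s)"
  shows "cutoff a b m j s = 1"
  unfolding cutoff_def using assms by (simp add: step_bump(4,5) algebra_simps)

text \<open>Tensor products of cutoffs are test functions that converge boundedly to the indicator of the
  box.\<close>
lemma integral_box_eq_0:
  fixes g :: "real ^ 'n \<Rightarrow> real"
  assumes op: "open \<Omega>" and sub: "cbox a b \<subseteq> \<Omega>"
    and int: "integrable lebesgue (\<lambda>x. indicator (cbox a b) x * g x)"
    and zero: "\<And>\<phi>. test_function \<Omega> \<phi> \<Longrightarrow> (LINT x|lebesgue_on \<Omega>. g x * \<phi> x) = 0"
  shows "(LINT x|lebesgue. indicator (box a b) x * g x) = 0"
proof (cases "box a b = {}")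
  case False
  then have ab: "a $ j < b $ j" for j using interval_ne_empty_cart(2) by blast
  \<comment> \<open>so large that the two transition zones in each coordinate do not overlap\<close>
  define M where "M = (\<Sum>j\<in>UNIV. 2 / (b $ j - a $ j)) + 1"
  have M: "0 < M" "2 \<le> M * (b $ j - a $ j)" for j
  proof -
    have "2 / (b $ j - a $ j) \<le> (\<Sum>j\<in>UNIV. 2 / (b $ j - a $ j))"
      using ab by (intro member_le_sum) (auto simp: less_imp_le)
    then have "2 / (b $ j - a $ j) \<le> M" unfolding M_def by simp
    then show "2 \<le> M * (b $ j - a $ j)" using ab[of j] by (simp add: divide_le_eq)
    show "0 < M" unfolding M_def using ab by (intro add_nonneg_pos sum_nonneg) (auto simp: less_imp_le)
  qed
  define m where "m k = M + real k" for k
  have m: "0 < m k" "2 \<le> m k * (b $ j - a $ j)" for k j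
  proof -
    have "M * (b $ j - a $ j) \<le> m k * (b $ j - a $ j)"
      using ab[of j] by (intro mult_right_mono) (auto simp: m_def)
    then show "2 \<le> m k * (b $ j - a $ j)" using M(2)[of j] by linarith
    show "0 < m k" using M(1) by (simp add: m_def)
  qed
  define \<phi> where "\<phi> k = tensor (cutoff a b (m k))" for k
  have sm: "test_function \<Omega> (\<phi> k)" for k
    unfolding \<phi>_def
    by (rule test_function_tensor[OF smooth1_cutoff _ sub], rule cutoff_eq_0[OF m(1) m(2)]) auto
  have \<phi>0: "\<phi> k x = 0" if "x \<notin> box a b" for k x
  proof -
    have "\<exists>j. x $ j \<notin> {a $ j<..<b $ j}" using that by (simp add: mem_box_cart)
    then have "\<exists>j. cutoff a b (m k) j (x $ j) = 0" using cutoff_eq_0[OF m(1) m(2)] by blast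
    then show ?thesis unfolding \<phi>_def tensor_def by (simp add: prod_zero)
  qed
  have \<phi>1: "\<bar>\<phi> k x\<bar> \<le> 1" for k x
    unfolding \<phi>_def tensor_def abs_prod by (intro prod_le_1) (simp add: cutoff_bound)
  have lim: "(\<lambda>k. \<phi> k x) \<longlonglongrightarrow> indicator (box a b) x" for x
  proof (cases "x \<in> box a b")
    case False then show ?thesis by (simp add: \<phi>0)
  next
    case True
    have "(\<lambda>k. cutoff a b (m k) j (x $ j)) \<longlonglongrightarrow> 1" for j
    proof (rule tendsto_eventually)
      have j: "0 < x $ j - a $ j" "0 < b $ j - x $ j" using True by (auto simp: mem_box_cart)
      define c where "c = min (x $ j - a $ j) (b $ j - x $ j)"
      have c: "0 < c" "c \<le> x $ j - a $ j" "c \<le> b $ j - x $ j" using j by (auto simp: c_def)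
      have "filterlim m at_top sequentially"
        unfolding m_def by (intro filterlim_tendsto_add_at_top[OF tendsto_const] filterlim_real_sequentially)
      then have "eventually (\<lambda>k. 2 / c \<le> m k) sequentially" by (simp add: filterlim_at_top)
      then show "eventually (\<lambda>k. cutoff a b (m k) j (x $ j) = 1) sequentially"
      proof (rule eventually_mono)
        fix k assume "2 / c \<le> m k"
        then have "2 \<le> m k * c" using c by (simp add: divide_le_eq)
        moreover have "m k * c \<le> m k * (x $ j - a $ j)" "m k * c \<le> m k * (b $ j - x $ j)"
          using c m(1)[of k] by simp_all
        ultimately show "cutoff a b (m k) j (x $ j) = 1" by (intro cutoff_eq_1) linarith+
      qed
    qed
    then have "(\<lambda>k. \<phi> k x) \<longlonglongrightarrow> (\<Prod>j\<in>(UNIV :: 'n set). 1)"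
      unfolding \<phi>_def tensor_def by (intro tendsto_prod)
    then show ?thesis using True by simp
  qed
  let ?g = "\<lambda>x. indicator (cbox a b) x * g x"
  have bc: "box a b \<subseteq> cbox a b" by (rule box_subset_cbox)
  have eq: "indicator \<Omega> x * (g x * \<phi> k x) = ?g x * \<phi> k x" for k x
    using \<phi>0[of x k] sub bc by (cases "x \<in> box a b") (auto simp: indicator_def)
  have int0: "(LINT x|lebesgue. ?g x * \<phi> k x) = 0" for k
    using zero[OF sm] unfolding integral_lebesgue_on[OF op] eq .
  have "(\<lambda>k. LINT x|lebesgue. ?g x * \<phi> k x) \<longlonglongrightarrow> (LINT x|lebesgue. ?g x * indicator (box a b) x)"
  proof (rule integral_dominated_convergence)
    show "integrable lebesgue (\<lambda>x. \<bar>?g x\<bar>)" using int by (rule integrable_abs)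
    show "(\<lambda>x. ?g x * indicator (box a b) x) \<in> borel_measurable lebesgue"
      by (rule borel_measurable_times[OF borel_measurable_integrable[OF int]]) (intro borel_measurable_indicator, simp)
    show "(\<lambda>x. ?g x * \<phi> k x) \<in> borel_measurable lebesgue" for k
    proof -
      have "continuous_on UNIV (\<phi> k)" using sm[of k] unfolding test_function_def by (metis Ck.simps(1))
      then have "\<phi> k \<in> borel_measurable lebesgue"
        by (intro measurable_completion) (simp add: borel_measurable_continuous_onI)
      then show ?thesis by (rule borel_measurable_times[OF borel_measurable_integrable[OF int]])
    qed
    show "AE x in lebesgue. (\<lambda>k. ?g x * \<phi> k x) \<longlonglongrightarrow> ?g x * indicator (box a b) x"
      using lim by (intro AE_I2 tendsto_mult_left)
    show "AE x in lebesgue. norm (?g x * \<phi> k x) \<le> \<bar>?g x\<bar>" for k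
      using \<phi>1[of k] by (intro AE_I2) (auto simp: abs_mult intro: mult_left_le)
  qed
  then have "(LINT x|lebesgue. ?g x * indicator (box a b) x) = 0"
    unfolding int0 by (simp add: LIMSEQ_const_iff)
  moreover have "?g x * indicator (box a b) x = indicator (box a b) x * g x" for x
    using bc by (auto simp: indicator_def)
  ultimately show ?thesis by simp
qed simp

text \<open>The positive and the negative part of \<open>g\<close> are densities of measures that agree on the
  boxes, hence everywhere.\<close>
lemma AE_eq_0_on_box:
  fixes g :: "real ^ 'n \<Rightarrow> real"
  assumes int: "integrable lebesgue (\<lambda>x. indicator (box a b) x * g x)"
    and zero: "\<And>c d. box c d \<subseteq> box a b \<Longrightarrow> (LINT x|lebesgue. indicator (box c d) x * g x) = 0"
  shows "AE x in lebesgue. x \<in> box a b \<longrightarrow> g x = 0"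
proof -
  let ?g = "\<lambda>x. indicator (box a b) x * g x"
  obtain h where h: "h \<in> borel_measurable lborel" and ae: "AE x in lborel. ?g x = h x"
    using completion_ex_borel_measurable_real[OF borel_measurable_integrable[OF int]] by blast
  have ae': "AE x in lebesgue. ?g x = h x" using ae by (rule AE_completion)
  have hm: "h \<in> borel_measurable lebesgue" using h by (rule measurable_completion)
  have ih: "integrable lebesgue h"
    using int ae' hm by (rule_tac integrable_cong_AE_imp[OF int]) auto
  then have ihb: "integrable lborel h" using h by (simp add: integrable_completion)
  have z: "(LINT x|lborel. indicator (box c d) x * h x) = 0" for c d
  proof -
    obtain c' d' where cd: "box c d \<inter> box a b = box c' d'" by (rule that[OF box_Int_box])
    have "(LINT x|lborel. indicator (box c d) x * h x) = (LINT x|lebesgue. indicator (box c d) x * h x)"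
      using h by (intro integral_completion[symmetric] borel_measurable_times) auto
    also have "\<dots> = (LINT x|lebesgue. indicator (box c d) x * ?g x)"
    proof (rule integral_cong_AE)
      have bm: "(\<lambda>x. indicator (box c d) x :: real) \<in> borel_measurable lebesgue"
        by (intro borel_measurable_indicator) simp
      show "(\<lambda>x. indicator (box c d) x * h x) \<in> borel_measurable lebesgue"
        by (rule borel_measurable_times[OF bm hm])
      show "(\<lambda>x. indicator (box c d) x * ?g x) \<in> borel_measurable lebesgue"
        by (rule borel_measurable_times[OF bm borel_measurable_integrable[OF int]])
    qed (use ae' in \<open>eventually_elim, auto\<close>)
    also have "(\<lambda>x. indicator (box c d) x * ?g x) = (\<lambda>x. indicator (box c' d') x * g x)"
      using cd by (auto simp: indicator_def fun_eq_iff)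
    also have "(LINT x|lebesgue. indicator (box c' d') x * g x) = 0"
      using cd by (intro zero) auto
    finally show ?thesis .
  qed
  define P N where "P = density lborel (\<lambda>x. ennreal (max 0 (h x)))"
    and "N = density lborel (\<lambda>x. ennreal (max 0 (- h x)))"
  have ip: "integrable lborel (\<lambda>x. indicator A x * max 0 (h x))"
    and "in": "integrable lborel (\<lambda>x. indicator A x * max 0 (- h x))" if "A \<in> sets borel" for A
    using that h by (auto intro!: Bochner_Integration.integrable_bound[OF ihb] AE_I2 simp: indicator_def)
  have eP: "emeasure P A = ennreal (LINT x|lborel. indicator A x * max 0 (h x))"
    and eN: "emeasure N A = ennreal (LINT x|lborel. indicator A x * max 0 (- h x))" if "A \<in> sets borel" for A
  proof -
    have "emeasure P A = (\<integral>\<^sup>+x. ennreal (indicator A x * max 0 (h x)) \<partial>lborel)"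
      unfolding P_def using h that
      by (subst emeasure_density) (auto intro!: nn_integral_cong simp: indicator_def)
    also have "\<dots> = ennreal (LINT x|lborel. indicator A x * max 0 (h x))"
      using ip[OF that] by (intro nn_integral_eq_integral) auto
    finally show "emeasure P A = ennreal (LINT x|lborel. indicator A x * max 0 (h x))" .
    have "emeasure N A = (\<integral>\<^sup>+x. ennreal (indicator A x * max 0 (- h x)) \<partial>lborel)"
      unfolding N_def using h that
      by (subst emeasure_density) (auto intro!: nn_integral_cong simp: indicator_def)
    also have "\<dots> = ennreal (LINT x|lborel. indicator A x * max 0 (- h x))"
      using "in"[OF that] by (intro nn_integral_eq_integral) auto
    finally show "emeasure N A = ennreal (LINT x|lborel. indicator A x * max 0 (- h x))" .
  qed
  have diff: "(LINT x|lborel. indicator A x * max 0 (h x)) - (LINT x|lborel. indicator A x * max 0 (- h x))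
      = (LINT x|lborel. indicator A x * h x)" if "A \<in> sets borel" for A
  proof -
    have "indicator A x * h x = indicator A x * max 0 (h x) - indicator A x * max 0 (- h x)" for x
      by (auto simp: indicator_def)
    then show ?thesis using ip[OF that] "in"[OF that] by simp
  qed
  have PN: "P = N"
  proof (rule measure_eqI_generator_eq[where E = "range (\<lambda>(a, b). box a b)" and \<Omega> = UNIV
        and A = "\<lambda>n. box (- (real n *\<^sub>R One)) (real n *\<^sub>R One)"])
    show "Int_stable (range (\<lambda>(a, b). box a b :: (real ^ 'n) set))"
      by (auto simp: Int_stable_def box_Int_box)
    show "sets P = sigma_sets UNIV (range (\<lambda>(a, b). box a b))" "sets N = sigma_sets UNIV (range (\<lambda>(a, b). box a b))"
      by (simp_all add: P_def N_def borel_eq_box)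
    show "emeasure P X = emeasure N X" if rX: "X \<in> range (\<lambda>(a, b). box a b)" for X
    proof -
      obtain c d where X: "X = box c d" using rX by auto
      then have "X \<in> sets borel" by simp
      then show ?thesis using z[of c d] diff[of X] eP[of X] eN[of X] X by simp
    qed
    show "(\<Union>n. box (- (real n *\<^sub>R One)) (real n *\<^sub>R One)) = (UNIV :: (real ^ 'n) set)"
      by (rule UN_box_eq_UNIV)
    show "emeasure P (box (- (real n *\<^sub>R One)) (real n *\<^sub>R One)) \<noteq> \<infinity>" for n by (simp add: eP)
  qed auto
  have "AE x in lborel. h x = 0"
  proof (rule density_unique_real[OF ihb])
    show "(LINT x:A|lborel. h x) = (LINT x:A|lborel. 0)" if "A \<in> sets lborel" for A
    proof -
      have A: "A \<in> sets borel" using that by simp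
      have "emeasure P A = emeasure N A" using PN by simp
      then have "(LINT x|lborel. indicator A x * max 0 (h x)) = (LINT x|lborel. indicator A x * max 0 (- h x))"
        unfolding eP[OF A] eN[OF A] by (subst (asm) ennreal_inj) (auto intro!: integral_nonneg_AE)
      then show ?thesis using diff[OF A] by (simp add: set_lebesgue_integral_def)
    qed
  qed simp
  then have "AE x in lborel. x \<in> box a b \<longrightarrow> g x = 0"
    using ae by eventually_elim auto
  then show ?thesis by (rule AE_completion)
qed

lemma integrable_times_compact_support:
  fixes f :: "real ^ 'n \<Rightarrow> real"
  assumes op: "open \<Omega>" and loc: "\<And>K. compact K \<Longrightarrow> K \<subseteq> \<Omega> \<Longrightarrow> integrable lebesgue (\<lambda>x. indicator K x * f x)"
    and K: "compact K" "K \<subseteq> \<Omega>" "\<And>x. x \<notin> K \<Longrightarrow> \<phi> x = 0" and c: "continuous_on UNIV \<phi>"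
  shows "integrable (lebesgue_on \<Omega>) (\<lambda>x. f x * \<phi> x)"
proof -
  have "bounded (\<phi> ` K)"
    by (intro compact_imp_bounded compact_continuous_image K continuous_on_subset[OF c]) auto
  then obtain B where B: "\<And>x. x \<in> K \<Longrightarrow> \<bar>\<phi> x\<bar> \<le> B" unfolding bounded_iff by (metis imageI real_norm_def)
  have "\<phi> \<in> borel_measurable lborel" using c borel_measurable_continuous_onI by simp
  then have pm: "\<phi> \<in> borel_measurable lebesgue" by (rule measurable_completion)
  have "integrable lebesgue (\<lambda>x. (indicator K x * f x) * \<phi> x)"
  proof (rule Bochner_Integration.integrable_bound)
    show "integrable lebesgue (\<lambda>x. B * (indicator K x * f x))" by (intro integrable_mult_right loc K)
    show "(\<lambda>x. (indicator K x * f x) * \<phi> x) \<in> borel_measurable lebesgue"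
      by (intro borel_measurable_times borel_measurable_integrable[OF loc[OF K(1,2)]] pm)
    have "norm (indicator K x * f x * \<phi> x) \<le> norm (B * (indicator K x * f x))" for x
    proof (cases "x \<in> K")
      case True
      have "\<bar>f x\<bar> * \<bar>\<phi> x\<bar> \<le> \<bar>f x\<bar> * \<bar>B\<bar>" using B[OF True] by (intro mult_left_mono) auto
      then show ?thesis using True by (simp add: abs_mult mult.commute)
    qed simp
    then show "AE x in lebesgue. norm (indicator K x * f x * \<phi> x) \<le> norm (B * (indicator K x * f x))" by simp
  qed
  moreover have "(\<lambda>x. indicator K x * f x * \<phi> x) = (\<lambda>x. indicator \<Omega> x * (f x * \<phi> x))"
    using K by (auto simp: indicator_def fun_eq_iff)
  ultimately show ?thesis unfolding integral_lebesgue_on(2)[OF op] by simp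
qed

lemma weak_gradient_locally_integrable:
  assumes "has_weak_gradient \<Omega> F G" "compact K" "K \<subseteq> \<Omega>"
  shows "integrable lebesgue (\<lambda>x. indicator K x * F x)" "integrable lebesgue (\<lambda>x. indicator K x * G x $ i)"
proof -
  have "integrable lebesgue (\<lambda>x. indicator K x *\<^sub>R F x)" "integrable lebesgue (\<lambda>x. indicator K x *\<^sub>R G x)"
    using assms unfolding has_weak_gradient_def set_integrable_def by blast+
  then show "integrable lebesgue (\<lambda>x. indicator K x * F x)" "integrable lebesgue (\<lambda>x. indicator K x * G x $ i)"
    using integrable_bounded_linear[OF bounded_linear_vec_nth[of i], of lebesgue "\<lambda>x. indicator K x *\<^sub>R G x"]
    by simp_all
qed

lemma weak_gradient_integrable_test:
  assumes op: "open \<Omega>" and wg: "has_weak_gradient \<Omega> F G" and \<phi>: "test_function \<Omega> \<phi>"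
  shows "integrable (lebesgue_on \<Omega>) (\<lambda>x. F x * \<phi> x)"
    and "integrable (lebesgue_on \<Omega>) (\<lambda>x. G x $ i * \<phi> x)"
proof -
  obtain K where K: "compact K" "K \<subseteq> \<Omega>" "\<And>x. x \<notin> K \<Longrightarrow> \<phi> x = 0" and c: "continuous_on UNIV \<phi>"
    by (rule test_function_props[OF \<phi>]) (blast intro: that)
  show "integrable (lebesgue_on \<Omega>) (\<lambda>x. F x * \<phi> x)"
    by (rule integrable_times_compact_support[OF op _ K c]) (rule weak_gradient_locally_integrable(1)[OF wg])
  show "integrable (lebesgue_on \<Omega>) (\<lambda>x. G x $ i * \<phi> x)"
    by (rule integrable_times_compact_support[OF op _ K c]) (rule weak_gradient_locally_integrable(2)[OF wg])
qed

lemma weak_gradient_parts: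
  "has_weak_gradient \<Omega> F G \<Longrightarrow> test_function \<Omega> \<phi> \<Longrightarrow>
    (LINT x|lebesgue_on \<Omega>. F x * partial_deriv i \<phi> x) = - (LINT x|lebesgue_on \<Omega>. G x $ i * \<phi> x)"
  unfolding has_weak_gradient_def by simp

text \<open>This makes the \<open>L\<^sub>p\<close> norm of \<open>weak_gradient \<Omega> F\<close> independent of the choice in its definition. The
  difference of two weak gradients vanishes almost everywhere on each of countably many boxes that
  cover \<open>\<Omega>\<close>.\<close>
lemma weak_gradient_unique:
  fixes G G' :: "real ^ 'n \<Rightarrow> real ^ 'n"
  assumes op: "open \<Omega>" and G: "has_weak_gradient \<Omega> F G" and G': "has_weak_gradient \<Omega> F G'"
  shows "AE x in lebesgue_on \<Omega>. G x = G' x"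
proof -
  have comp: "AE x in lebesgue. x \<in> \<Omega> \<longrightarrow> G x $ i - G' x $ i = 0" for i
  proof -
    let ?g = "\<lambda>x. G x $ i - G' x $ i"
    have loc: "integrable lebesgue (\<lambda>x. indicator K x * ?g x)" if "compact K" "K \<subseteq> \<Omega>" for K
      using weak_gradient_locally_integrable(2)[OF G that, of i] weak_gradient_locally_integrable(2)[OF G' that, of i]
      by (simp add: right_diff_distrib)
    have zero: "(LINT x|lebesgue_on \<Omega>. ?g x * \<phi> x) = 0" if \<phi>: "test_function \<Omega> \<phi>" for \<phi>
    proof -
      note weak_gradient_integrable_test(2)[OF op G \<phi>, of i] weak_gradient_integrable_test(2)[OF op G' \<phi>, of i]
      moreover have "(LINT x|lebesgue_on \<Omega>. G x $ i * \<phi> x) = (LINT x|lebesgue_on \<Omega>. G' x $ i * \<phi> x)"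
        using weak_gradient_parts[OF G \<phi>, of i] weak_gradient_parts[OF G' \<phi>, of i] by simp
      ultimately show ?thesis by (simp add: left_diff_distrib)
    qed
    obtain \<D> where D: "countable \<D>" "\<D> \<subseteq> Pow \<Omega>" "\<And>X. X \<in> \<D> \<Longrightarrow> \<exists>a b. X = cbox a b" "\<Union>\<D> = \<Omega>"
      by (rule open_countable_Union_open_cbox[OF op]) (blast intro: that)
    have "AE x in lebesgue. x \<in> X \<longrightarrow> ?g x = 0" if X: "X \<in> \<D>" for X
    proof -
      obtain a b where ab: "X = cbox a b" using D(3) X by blast
      have sub: "cbox a b \<subseteq> \<Omega>" using D(2) X ab by auto
      have "AE x in lebesgue. x \<in> box a b \<longrightarrow> ?g x = 0"
      proof (rule AE_eq_0_on_box)
        have "integrable lebesgue (\<lambda>x. indicator (box a b) x * (indicator (cbox a b) x * ?g x))"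
          using integrable_mult_indicator[of "box a b" lebesgue, OF _ loc[OF compact_cbox sub]] by simp
        moreover have "indicator (box a b) x * (indicator (cbox a b) x * ?g x) = indicator (box a b) x * ?g x" for x
          using box_subset_cbox[of a b] by (auto simp: indicator_def)
        ultimately show "integrable lebesgue (\<lambda>x. indicator (box a b) x * ?g x)" by simp
        fix c d assume cd: "box c d \<subseteq> box a b"
        show "(LINT x|lebesgue. indicator (box c d) x * ?g x) = 0"
        proof (cases "box c d = {}")
          case False
          then have "cbox c d = closure (box c d)" by simp
          also have "\<dots> \<subseteq> closure (box a b)" by (rule closure_mono[OF cd])
          also have "\<dots> \<subseteq> cbox a b" by (rule closure_minimal[OF box_subset_cbox closed_cbox])
          finally have "cbox c d \<subseteq> \<Omega>" using sub by blast
          then show ?thesis by (intro integral_box_eq_0[OF op] loc compact_cbox zero)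
        qed simp
      qed
      moreover have "AE x in lebesgue. x \<notin> cbox a b - box a b"
        using negligible_frontier_interval[of a b] by (intro AE_not_in) (simp add: negligible_iff_null_sets)
      ultimately show ?thesis unfolding ab by eventually_elim auto
    qed
    then have "AE x in lebesgue. \<forall>X\<in>\<D>. x \<in> X \<longrightarrow> ?g x = 0"
      unfolding AE_ball_countable[OF D(1)] by blast
    then show ?thesis by eventually_elim (use D(4) in blast)
  qed
  have "AE x in lebesgue. \<forall>i. x \<in> \<Omega> \<longrightarrow> G x $ i - G' x $ i = 0"
    using AE_ball_countable[of "UNIV :: 'n set" "\<lambda>x i. x \<in> \<Omega> \<longrightarrow> G x $ i - G' x $ i = 0" lebesgue] comp
    by (simp add: countable_finite)
  then have "AE x in lebesgue. x \<in> \<Omega> \<longrightarrow> G x = G' x"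
    by eventually_elim (auto simp: vec_eq_iff)
  then show ?thesis using op by (subst AE_restrict_space_iff) auto
qed

section \<open>The Morrey inequality\<close>

lemma telescoping_geometric_bound:
  fixes a :: "nat \<Rightarrow> real"
  assumes step: "\<And>k. \<bar>a (Suc k) - a k\<bar> \<le> K * \<theta> ^ k" and \<theta>: "0 < \<theta>" "\<theta> < 1" and lim: "a \<longlonglongrightarrow> L"
  shows "\<bar>L - a 0\<bar> \<le> K / (1 - \<theta>)"
proof -
  have K: "0 \<le> K" using step[of 0] by simp
  have "\<bar>a k - a 0\<bar> \<le> K / (1 - \<theta>)" for k
  proof -
    have "\<bar>a k - a 0\<bar> = \<bar>\<Sum>i<k. a (Suc i) - a i\<bar>" by (simp add: sum_lessThan_telescope)
    also have "\<dots> \<le> (\<Sum>i<k. K * \<theta> ^ i)" by (rule order_trans[OF sum_abs]) (intro sum_mono step)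
    also have "\<dots> = K * ((1 - \<theta> ^ k) / (1 - \<theta>))"
      using \<theta> by (simp add: sum_distrib_left[symmetric] sum_gp_strict)
    also have "\<dots> \<le> K * (1 / (1 - \<theta>))"
      using K \<theta> by (intro mult_left_mono divide_right_mono) auto
    finally show ?thesis by simp
  qed
  moreover have "(\<lambda>k. \<bar>a k - a 0\<bar>) \<longlonglongrightarrow> \<bar>L - a 0\<bar>" by (intro tendsto_intros lim)
  ultimately show ?thesis by (intro LIMSEQ_le_const2) auto
qed

text \<open>The factor \<open>1 / t\<close> makes the integral independent of \<open>c\<close> and \<open>t\<close>.\<close>
definition mollifier :: "real ^ 'n \<Rightarrow> real \<Rightarrow> 'n \<Rightarrow> real \<Rightarrow> real" where
  "mollifier c t j s = bump ((s - c $ j) / t) / t"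

lemma smooth1_mollifier: "smooth1 (mollifier c t j)"
  using smooth1_mult[OF smooth1_const[of "1 / t"] smooth1_scale[OF step_bump(2), of "c $ j" t]]
  by (simp add: mollifier_def[abs_def])

lemma step_scaled_derivative:
  assumes "0 < t"
  shows "((\<lambda>s. step ((s - c $ j) / t)) has_real_derivative mollifier c t j s) (at s)"
  unfolding mollifier_def using assms
  by (intro DERIV_cong[OF DERIV_chain2[OF step_bump(3), where g = "\<lambda>s. (s - c $ j) / t" and Db = "1 / t"]])
     (auto intro!: derivative_eq_intros)

lemma mollifier_eq_0:
  assumes "0 < t" "s \<notin> {c $ j - t<..<c $ j + t}"
  shows "mollifier c t j s = 0"
proof -
  have "1 \<le> \<bar>(s - c $ j) / t\<bar>" using assms by (auto simp: abs_divide le_divide_eq)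
  then show ?thesis by (simp add: mollifier_def step_bump(6))
qed

lemma cube_component: "y \<in> cube c r \<Longrightarrow> \<bar>y $ j - c $ j\<bar> < r"
  by (auto simp: mem_cube infnorm_less_iff)

definition bump_sup :: real where
  "bump_sup = (SOME B. 1 \<le> B \<and> (\<forall>x. \<bar>bump x\<bar> \<le> B))"

lemma bump_sup: "1 \<le> bump_sup" "\<bar>bump x\<bar> \<le> bump_sup"
proof -
  obtain B where "1 \<le> B" "\<And>x. \<bar>bump x\<bar> \<le> B"
    using smooth1_bounded[OF step_bump(2), of thesis] step_bump(6) by blast
  then have "\<exists>B. 1 \<le> B \<and> (\<forall>x. \<bar>bump x\<bar> \<le> B)" by blast
  from someI_ex[OF this] show "1 \<le> bump_sup" "\<bar>bump x\<bar> \<le> bump_sup"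
    unfolding bump_sup_def by blast+
qed

text \<open>Exchanging one factor of a tensor product at a time: the difference of two mollifiers of one
  variable is the derivative of a compactly supported function bounded by 1.\<close>
lemma mollified_difference_step:
  fixes F :: "real ^ 'n \<Rightarrow> real"
  assumes op: "open \<Omega>" and wg: "has_weak_gradient \<Omega> F G" and Q: "cbox a b \<subseteq> Q" "Q \<subseteq> \<Omega>" "Q \<in> sets borel"
    and int: "integrable (lebesgue_on \<Omega>) (\<lambda>x. indicator Q x * infnorm (G x))"
    and t: "0 < t" "t \<le> t0" "t \<le> t1"
    and sub: "\<And>j. a $ j \<le> c0 $ j - t0" "\<And>j. c0 $ j + t0 \<le> b $ j" "\<And>j. a $ j \<le> c1 $ j - t1" "\<And>j. c1 $ j + t1 \<le> b $ j"
    and i: "i \<notin> S"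
  defines "f \<equiv> \<lambda>S j. if j \<in> S then mollifier c1 t1 j else mollifier c0 t0 j"
  shows "\<bar>(LINT x|lebesgue_on \<Omega>. F x * tensor (f (insert i S)) x) - (LINT x|lebesgue_on \<Omega>. F x * tensor (f S) x)\<bar>
    \<le> (bump_sup / t) ^ (CARD('n) - 1) * (LINT x|lebesgue_on \<Omega>. indicator Q x * infnorm (G x))"
proof -
  have t01: "0 < t0" "0 < t1" using t by auto
  define u where "u s = step ((s - c1 $ i) / t1) - step ((s - c0 $ i) / t0)" for s
  define \<Phi> where "\<Phi> = tensor ((f S)(i := u))"
  have sf: "smooth1 (f T j)" for T j by (simp add: f_def smooth1_mollifier)
  have su: "smooth1 u" unfolding u_def[abs_def] by (intro smooth1_diff smooth1_scale step_bump)
  have f0: "f T j s = 0" if "s \<notin> {a $ j..b $ j}" for T j s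
    unfolding f_def using that sub[of j] t01 by (auto intro!: mollifier_eq_0)
  have u0: "u s = 0" if s: "s \<notin> {a $ i..b $ i}" for s
  proof -
    consider "s < a $ i" | "b $ i < s" using s by force
    then show ?thesis
    proof cases
      case 1
      then have "(s - c1 $ i) / t1 \<le> -1" "(s - c0 $ i) / t0 \<le> -1"
        using sub[of i] t01 by (auto simp: divide_le_eq)
      then show ?thesis by (simp add: u_def step_bump(4))
    next
      case 2
      then have "1 \<le> (s - c1 $ i) / t1" "1 \<le> (s - c0 $ i) / t0"
        using sub[of i] t01 by (auto simp: le_divide_eq)
      then show ?thesis by (simp add: u_def step_bump(5))
    qed
  qed
  have absQ: "cbox a b \<subseteq> \<Omega>" using Q by blast
  have t\<Phi>: "test_function \<Omega> \<Phi>"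
    unfolding \<Phi>_def by (rule test_function_tensor[OF _ _ absQ]) (use sf su f0 u0 in \<open>auto split: if_splits\<close>)
  have tT: "test_function \<Omega> (tensor (f T))" for T
    by (rule test_function_tensor[OF sf f0 absQ])
  have "\<exists>f'. \<forall>j. (\<forall>x. (f S j has_real_derivative f' j x) (at x))"
    by (rule choice) (meson sf smooth1_has_derivative)
  then obtain f' where f': "\<And>j x. (f S j has_real_derivative f' j x) (at x)" by blast
  define w where "w s = mollifier c1 t1 i s - mollifier c0 t0 i s" for s
  have du: "(u has_real_derivative w s) (at s)" for s
    unfolding u_def[abs_def] w_def by (intro DERIV_diff step_scaled_derivative t01)
  have "partial_deriv i \<Phi> x = tensor ((f S)(i := w)) x" for x
  proof -
    have "(((f S)(i := u)) j has_real_derivative (f'(i := w)) j x) (at x)" for j x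
      using f' du by auto
    from partial_deriv_tensor[of "(f S)(i := u)" "f'(i := w)" i x, OF this] show ?thesis by (simp add: \<Phi>_def)
  qed
  moreover have "tensor ((f S)(i := w)) x = tensor (f (insert i S)) x - tensor (f S) x" for x
  proof -
    have "f (insert i S) = (f S)(i := mollifier c1 t1 i)" "f S = (f S)(i := mollifier c0 t0 i)"
      using i by (auto simp: f_def fun_eq_iff)
    then have "tensor (f (insert i S)) x = mollifier c1 t1 i (x $ i) * (\<Prod>j\<in>UNIV - {i}. f S j (x $ j))"
      "tensor (f S) x = mollifier c0 t0 i (x $ i) * (\<Prod>j\<in>UNIV - {i}. f S j (x $ j))"
      by (metis tensor_fun_upd)+
    then show ?thesis by (simp add: tensor_fun_upd w_def left_diff_distrib)
  qed
  ultimately have pd: "partial_deriv i \<Phi> x = tensor (f (insert i S)) x - tensor (f S) x" for x by simp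
  note iF = weak_gradient_integrable_test(1)[OF op wg] and iG = weak_gradient_integrable_test(2)[OF op wg t\<Phi>, of i]
  have "(LINT x|lebesgue_on \<Omega>. F x * tensor (f (insert i S)) x) - (LINT x|lebesgue_on \<Omega>. F x * tensor (f S) x)
      = (LINT x|lebesgue_on \<Omega>. F x * partial_deriv i \<Phi> x)"
    unfolding pd using iF[OF tT] by (simp add: right_diff_distrib)
  also have "\<dots> = - (LINT x|lebesgue_on \<Omega>. G x $ i * \<Phi> x)"
    by (rule weak_gradient_parts[OF wg t\<Phi>])
  finally have "\<bar>(LINT x|lebesgue_on \<Omega>. F x * tensor (f (insert i S)) x) - (LINT x|lebesgue_on \<Omega>. F x * tensor (f S) x)\<bar>
      \<le> (LINT x|lebesgue_on \<Omega>. \<bar>G x $ i * \<Phi> x\<bar>)" by simp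
  also have "\<dots> \<le> (LINT x|lebesgue_on \<Omega>. (bump_sup / t) ^ (CARD('n) - 1) * (indicator Q x * infnorm (G x)))"
  proof (rule integral_mono)
    fix x
    show "\<bar>G x $ i * \<Phi> x\<bar> \<le> (bump_sup / t) ^ (CARD('n) - 1) * (indicator Q x * infnorm (G x))"
    proof (cases "x \<in> Q")
      case False
      then have "x \<notin> cbox a b" using Q by auto
      then have "\<exists>j. x $ j \<notin> {a $ j..b $ j}" by (simp add: mem_box_cart)
      then have "\<exists>j. ((f S)(i := u)) j (x $ j) = 0" using f0 u0 by (metis fun_upd_apply)
      then have "\<Phi> x = 0" unfolding \<Phi>_def tensor_def by (simp add: prod_zero)
      then show ?thesis using False by simp
    next
      case True
      have m: "\<bar>f S j s\<bar> \<le> bump_sup / t" for j s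
      proof -
        have "\<bar>mollifier c T j s\<bar> \<le> bump_sup / t" if "t \<le> T" for c :: "real ^ 'n" and T
        proof -
          have "\<bar>bump ((s - c $ j) / T)\<bar> / T \<le> bump_sup / t"
            using bump_sup that t by (intro frac_le) auto
          then show ?thesis using that t by (simp add: mollifier_def abs_divide)
        qed
        then show ?thesis using t by (auto simp: f_def)
      qed
      have u1: "\<bar>u s\<bar> \<le> 1" for s unfolding u_def by (smt (verit) step_bounds)
      have "\<bar>\<Phi> x\<bar> = \<bar>u (x $ i)\<bar> * (\<Prod>j\<in>UNIV - {i}. \<bar>f S j (x $ j)\<bar>)"
        unfolding \<Phi>_def using tensor_fun_upd[where f = "f S" and i = i and u = u and x = x] by (simp add: abs_mult abs_prod)
      also have "\<dots> \<le> 1 * (\<Prod>j\<in>UNIV - {i}. bump_sup / t)"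
        using m u1 by (intro mult_mono prod_mono prod_nonneg) auto
      also have "\<dots> = (bump_sup / t) ^ (CARD('n) - 1)" by (simp add: card_Diff_singleton)
      finally have "\<bar>\<Phi> x\<bar> \<le> (bump_sup / t) ^ (CARD('n) - 1)" .
      then have "\<bar>G x $ i\<bar> * \<bar>\<Phi> x\<bar> \<le> infnorm (G x) * (bump_sup / t) ^ (CARD('n) - 1)"
        by (intro mult_mono component_le_infnorm_cart) (auto simp: infnorm_pos_le)
      then show ?thesis using True by (simp add: abs_mult mult.commute)
    qed
  qed (use iG int in auto)
  finally show ?thesis by simp
qed

definition mollified :: "(real ^ 'n) set \<Rightarrow> (real ^ 'n \<Rightarrow> real) \<Rightarrow> real ^ 'n \<Rightarrow> real \<Rightarrow> real" where
  "mollified \<Omega> F c t = (LINT x|lebesgue_on \<Omega>. F x * tensor (mollifier c t) x)"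

text \<open>Centre and width of a mollifier are changed at once by exchanging its \<open>CARD('n)\<close> factors one
  after the other. This controls means of \<open>F\<close> by the gradient without differentiating under the
  integral.\<close>
lemma mollified_difference:
  fixes F :: "real ^ 'n \<Rightarrow> real"
  assumes op: "open \<Omega>" and wg: "has_weak_gradient \<Omega> F G" and Q: "cube c R \<subseteq> \<Omega>"
    and int: "integrable (lebesgue_on \<Omega>) (\<lambda>x. indicator (cube c R) x * infnorm (G x))"
    and t: "0 < t" "t \<le> t0" "t \<le> t1"
    and sub: "infnorm (c0 - c) + t0 < R" "infnorm (c1 - c) + t1 < R"
  shows "\<bar>mollified \<Omega> F c1 t1 - mollified \<Omega> F c0 t0\<bar>
    \<le> real CARD('n) * ((bump_sup / t) ^ (CARD('n) - 1) * (LINT x|lebesgue_on \<Omega>. indicator (cube c R) x * infnorm (G x)))"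
    (is "_ \<le> _ * ?X")
proof -
  define f where "f S j = (if j \<in> S then mollifier c1 t1 j else mollifier c0 t0 j)" for S j
  \<comment> \<open>both supports lie in the closed cube of radius \<open>R'\<close> about \<open>c\<close>\<close>
  define R' where "R' = max (infnorm (c0 - c) + t0) (infnorm (c1 - c) + t1)"
  define a b where "a = c - vec R'" and "b = c + vec R'"
  have comp: "\<bar>c0 $ j - c $ j\<bar> \<le> infnorm (c0 - c)" "\<bar>c1 $ j - c $ j\<bar> \<le> infnorm (c1 - c)" for j
    using component_le_infnorm_cart[of "c0 - c" j] component_le_infnorm_cart[of "c1 - c" j] by auto
  have ab: "a $ j \<le> c0 $ j - t0" "c0 $ j + t0 \<le> b $ j" "a $ j \<le> c1 $ j - t1" "c1 $ j + t1 \<le> b $ j" for j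
    using comp[of j] unfolding a_def b_def R'_def by (auto simp: abs_le_iff max_def)
  have sQ: "cbox a b \<subseteq> cube c R"
  proof
    fix y assume y: "y \<in> cbox a b"
    have "R' < R" using sub by (simp add: R'_def)
    moreover have "\<bar>y $ j - c $ j\<bar> \<le> R'" for j
      using y by (auto simp: mem_box_cart a_def b_def abs_le_iff algebra_simps)
    ultimately have "\<bar>(y - c) $ j\<bar> < R" for j by (metis le_less_trans vector_minus_component)
    then show "y \<in> cube c R" by (auto simp: mem_cube infnorm_less_iff)
  qed
  have bor: "cube c R \<in> sets borel" by (simp add: open_cube)
  have "\<bar>(LINT x|lebesgue_on \<Omega>. F x * tensor (f S) x) - (LINT x|lebesgue_on \<Omega>. F x * tensor (f {}) x)\<bar> \<le> real (card S) * ?X"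
    if "finite S" for S
    using that
  proof (induction S rule: finite_induct)
    case (insert i S)
    have "\<bar>(LINT x|lebesgue_on \<Omega>. F x * tensor (f (insert i S)) x) - (LINT x|lebesgue_on \<Omega>. F x * tensor (f S) x)\<bar> \<le> ?X"
      using mollified_difference_step[OF op wg sQ Q bor int t ab insert.hyps(2)] unfolding f_def .
    then show ?case using insert by (simp add: algebra_simps)
  qed simp
  from this[of UNIV] have "\<bar>(LINT x|lebesgue_on \<Omega>. F x * tensor (f UNIV) x) - (LINT x|lebesgue_on \<Omega>. F x * tensor (f {}) x)\<bar>
      \<le> real CARD('n) * ?X" by simp
  moreover have "f UNIV = mollifier c1 t1" "f {} = mollifier c0 t0" by (auto simp: f_def fun_eq_iff)
  ultimately show ?thesis unfolding mollified_def by simp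
qed

lemma bump_lower_bound:
  obtains \<beta> where "0 < \<beta>" "\<And>x. \<bar>x\<bar> \<le> 1 / 2 \<Longrightarrow> \<beta> \<le> bump x"
proof -
  have "continuous_on {-1/2..1/2} bump"
    using smooth1_continuous[OF step_bump(2)] by (rule continuous_on_subset) auto
  then obtain z :: real where "z \<in> {-1/2..1/2}" "\<And>x. x \<in> {-1/2..1/2} \<Longrightarrow> bump z \<le> bump x"
    using continuous_attains_inf[of "{-1/2..1/2 :: real}" bump] by auto
  note z = this
  show ?thesis
  proof (rule that[of "bump z"])
    show "0 < bump z" using z(1) by (intro step_bump(7)) (auto simp: abs_less_iff)
    show "bump z \<le> bump x" if "\<bar>x\<bar> \<le> 1 / 2" for x
      using that by (intro z(2)) (auto simp: abs_le_iff)
  qed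
qed

lemma tensor_mollifier_eq_0: "0 < t \<Longrightarrow> y \<notin> cube c t \<Longrightarrow> tensor (mollifier c t) y = 0"
proof -
  assume t: "0 < t" and "y \<notin> cube c t"
  then obtain j where "\<not> \<bar>(y - c) $ j\<bar> < t" by (auto simp: mem_cube infnorm_less_iff)
  then have "mollifier c t j (y $ j) = 0" by (intro mollifier_eq_0[OF t]) (auto simp: abs_less_iff)
  then show ?thesis unfolding tensor_def by (intro prod_zero) auto
qed

lemma tensor_mollifier_nonneg: "0 < t \<Longrightarrow> 0 \<le> tensor (mollifier c t) y"
  unfolding tensor_def by (intro prod_nonneg) (auto simp: mollifier_def bump_nonneg)

lemma test_function_mollifier:
  assumes "0 < t" "t < R" "cube c R \<subseteq> \<Omega>"
  shows "test_function \<Omega> (tensor (mollifier c t))"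
proof (rule test_function_tensor[OF smooth1_mollifier])
  show "mollifier c t j s = 0" if "s \<notin> {(c - vec t) $ j..(c + vec t) $ j}" for j s
    by (rule mollifier_eq_0[OF assms(1)]) (use that in auto)
  have "y \<in> cube c R" if "y \<in> cbox (c - vec t) (c + vec t)" for y
  proof -
    have "\<bar>(y - c) $ j\<bar> < R" for j
      using that assms(2) by (auto simp: mem_box_cart abs_less_iff algebra_simps dest!: spec[of _ j])
    then show ?thesis by (auto simp: mem_cube infnorm_less_iff)
  qed
  then show "cbox (c - vec t) (c + vec t) \<subseteq> \<Omega>" using assms(3) by blast
qed

definition bump_mass :: "'n::finite itself \<Rightarrow> real" where
  "bump_mass _ = mollified UNIV (\<lambda>_. 1) (0 :: real ^ 'n) 1"

text \<open>Constant functions have gradient 0, so the mass of a mollifier does not depend on its centre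
  and its width.\<close>
lemma mollified_const:
  fixes c :: "real ^ 'n"
  assumes "0 < t" "t < R" "cube c R \<subseteq> \<Omega>" "open \<Omega>"
  shows "mollified \<Omega> (\<lambda>_. k) c t = k * bump_mass TYPE('n)"
proof -
  have wg: "has_weak_gradient (UNIV :: (real ^ 'n) set) (\<lambda>_. 1) (\<lambda>_. 0)"
    by (rule has_weak_gradient_C1) auto
  define R' where "R' = infnorm c + t + 2"
  have i0: "infnorm (0 :: real ^ 'n) = 0" by (rule infnorm_0)
  have "\<bar>mollified UNIV (\<lambda>_. 1) c t - mollified UNIV (\<lambda>_. 1) (0 :: real ^ 'n) 1\<bar>
      \<le> real CARD('n) * ((bump_sup / min t 1) ^ (CARD('n) - 1) *
          (LINT x|lebesgue_on UNIV. indicator (cube (0 :: real ^ 'n) R') x * infnorm (0 :: real ^ 'n)))"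
    by (rule mollified_difference[OF open_UNIV wg])
       (use assms infnorm_pos_le[of c] in \<open>auto simp: R'_def i0\<close>)
  then have 1: "mollified UNIV (\<lambda>_. 1) c t = bump_mass TYPE('n)" by (simp add: i0 bump_mass_def)
  have "mollified \<Omega> (\<lambda>_. k) c t = (LINT x|lebesgue. indicator \<Omega> x * (k * tensor (mollifier c t) x))"
    unfolding mollified_def integral_lebesgue_on[OF assms(4)] ..
  also have "(\<lambda>x. indicator \<Omega> x * (k * tensor (mollifier c t) x)) = (\<lambda>x. k * tensor (mollifier c t) x)"
  proof
    fix x
    have "cube c t \<subseteq> \<Omega>" using assms cube_mono[of c c t R] by (auto simp: i0)
    then show "indicator \<Omega> x * (k * tensor (mollifier c t) x) = k * tensor (mollifier c t) x"
      using tensor_mollifier_eq_0[OF assms(1), of x c] by (cases "x \<in> cube c t") auto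
  qed
  also have "(LINT x|lebesgue. k * tensor (mollifier c t) x) = k * mollified UNIV (\<lambda>_. 1) c t"
    unfolding mollified_def integral_lebesgue_on[OF open_UNIV] by simp
  finally show ?thesis using 1 by simp
qed

text \<open>The bump is bounded below by a positive constant on the cube of side 1 about the origin.\<close>
lemma bump_mass_pos: "0 < bump_mass TYPE('n::finite)"
proof -
  obtain \<beta> where b: "0 < \<beta>" "\<And>x. \<bar>x\<bar> \<le> 1 / 2 \<Longrightarrow> \<beta> \<le> bump x" by (rule bump_lower_bound) (rule that)
  let ?Q = "cube (0 :: real ^ 'n) (1 / 2)" and ?T = "tensor (mollifier (0 :: real ^ 'n) 1)"
  have wg: "has_weak_gradient (UNIV :: (real ^ 'n) set) (\<lambda>_. 1) (\<lambda>_. 0)"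
    by (rule has_weak_gradient_C1) auto
  have Qb: "?Q \<in> sets borel" by (simp add: open_cube)
  have eQ: "emeasure lebesgue ?Q = 1"
    using emeasure_cube[of "1/2" "0 :: real ^ 'n"] Qb by (simp add: emeasure_completion)
  have mQ: "measure lebesgue ?Q = 1" using eQ by (simp add: measure_def)
  have "test_function UNIV ?T" by (rule test_function_mollifier[of 1 2]) auto
  then have int: "integrable (lebesgue_on UNIV) (\<lambda>x. 1 * ?T x)"
    by (rule weak_gradient_integrable_test(1)[OF open_UNIV wg])
  have "\<beta> ^ CARD('n) * 1 = (LINT x|lebesgue. \<beta> ^ CARD('n) * indicator ?Q x)" using mQ by simp
  also have "\<dots> \<le> (LINT x|lebesgue. 1 * ?T x)"
  proof (rule integral_mono)
    have "integrable lebesgue (indicator ?Q :: real ^ 'n \<Rightarrow> real)"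
      using eQ Qb by (intro integrable_real_indicator) auto
    then show "integrable lebesgue (\<lambda>x. \<beta> ^ CARD('n) * indicator ?Q x)" by (rule integrable_mult_right)
    fix x :: "real ^ 'n"
    show "\<beta> ^ CARD('n) * indicator ?Q x \<le> 1 * ?T x"
    proof (cases "x \<in> ?Q")
      case True
      have "(\<Prod>j\<in>(UNIV :: 'n set). \<beta>) \<le> (\<Prod>j\<in>UNIV. mollifier 0 1 j (x $ j))"
        using cube_component[OF True] b by (intro prod_mono) (auto simp: mollifier_def less_imp_le)
      then show ?thesis using True by (simp add: tensor_def)
    qed (simp add: tensor_mollifier_nonneg)
  qed (use int in \<open>simp add: integral_lebesgue_on(2)[OF open_UNIV]\<close>)
  finally have "\<beta> ^ CARD('n) \<le> bump_mass TYPE('n)"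
    unfolding bump_mass_def mollified_def integral_lebesgue_on[OF open_UNIV] by simp
  then show ?thesis using b(1) by (meson less_le_trans zero_less_power)
qed

text \<open>The measure with density \<open>|G|\<^sup>p\<close>. From the Morrey inequality on, the gradient of a Sobolev
  function enters only through this finite measure.\<close>
definition energy :: "real \<Rightarrow> (real ^ 'n) set \<Rightarrow> (real ^ 'n \<Rightarrow> real ^ 'n) \<Rightarrow> (real ^ 'n) measure" where
  "energy p \<Omega> G = density (lebesgue_on \<Omega>) (\<lambda>x. ennreal (infnorm (G x) powr p))"

locale sobolev_function =
  fixes p :: real and \<Omega> :: "(real ^ 'n) set" and F :: "real ^ 'n \<Rightarrow> real" and G :: "real ^ 'n \<Rightarrow> real ^ 'n"
  assumes dom: "is_domain \<Omega>" and p: "real CARD('n) < p" and cont: "continuous_on \<Omega> F"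
    and wg: "has_weak_gradient \<Omega> F G" and Lp: "in_Lp p \<Omega> (\<lambda>x. infnorm (G x))"
begin

abbreviation "\<mu> \<equiv> energy p \<Omega> G"

lemma op: "open \<Omega>" using dom by (simp add: is_domain_def)

lemma p1: "1 < p"
  using p by (metis One_nat_def Suc_leI le_less_trans of_nat_1 of_nat_le_iff zero_less_card_finite)

lemma gradient_integrability: "(\<lambda>x. infnorm (G x)) \<in> borel_measurable (lebesgue_on \<Omega>)"
    "integrable (lebesgue_on \<Omega>) (\<lambda>x. infnorm (G x) powr p)"
  using Lp by (auto simp: in_Lp_def real_abs_infnorm)

lemma emeasure_energy:
  assumes "A \<in> sets (lebesgue_on \<Omega>)"
  shows "emeasure \<mu> A = ennreal (LINT x|lebesgue_on \<Omega>. indicator A x * infnorm (G x) powr p)"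
proof -
  have [measurable]: "A \<in> sets (lebesgue_on \<Omega>)" "(\<lambda>x. infnorm (G x) powr p) \<in> borel_measurable (lebesgue_on \<Omega>)"
    using assms borel_measurable_integrable[OF gradient_integrability(2)] by auto
  have "emeasure \<mu> A = (\<integral>\<^sup>+x. ennreal (indicator A x * infnorm (G x) powr p) \<partial>lebesgue_on \<Omega>)"
    unfolding energy_def by (subst emeasure_density) (auto intro!: nn_integral_cong simp: indicator_def)
  also have "\<dots> = ennreal (LINT x|lebesgue_on \<Omega>. indicator A x * infnorm (G x) powr p)"
    using integrable_mult_indicator[OF assms gradient_integrability(2)] by (intro nn_integral_eq_integral) auto
  finally show ?thesis .
qed

lemma space_energy: "space \<mu> = \<Omega>" "sets \<mu> = sets (lebesgue_on \<Omega>)"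
  by (auto simp: energy_def)

lemma measure_energy:
  assumes "A \<in> sets (lebesgue_on \<Omega>)"
  shows "measure \<mu> A = (LINT x|lebesgue_on \<Omega>. indicator A x * infnorm (G x) powr p)"
  unfolding measure_def emeasure_energy[OF assms] by (intro enn2real_ennreal integral_nonneg_AE) auto

lemma energy_space: "measure \<mu> \<Omega> = (LINT x|lebesgue_on \<Omega>. infnorm (G x) powr p)"
proof -
  have "\<Omega> \<in> sets (lebesgue_on \<Omega>)" using sets.top[of "lebesgue_on \<Omega>"] by simp
  from measure_energy[OF this] show ?thesis by (auto intro!: Bochner_Integration.integral_cong)
qed

lemma finite_energy: "finite_measure \<mu>"
proof
  have "\<Omega> \<in> sets (lebesgue_on \<Omega>)" using sets.top[of "lebesgue_on \<Omega>"] by simp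
  from emeasure_energy[OF this] show "emeasure \<mu> (space \<mu>) \<noteq> \<infinity>" by (simp add: space_energy)
qed

lemma cube_sets: "cube c r \<subseteq> \<Omega> \<Longrightarrow> cube c r \<in> sets (lebesgue_on \<Omega>)"
  using op by (subst sets_restrict_space_iff) (auto simp: open_cube)

text \<open>Hoelder's inequality on a cube. It follows from \<open>g \<le> l + l\<^sup>1\<^sup>-\<^sup>p g\<^sup>p\<close> by integration and the choice
  of \<open>l\<close> for which both terms are equal.\<close>
lemma integral_gradient_le:
  assumes Q: "cube c R \<subseteq> \<Omega>" and R: "0 < R"
  shows "integrable (lebesgue_on \<Omega>) (\<lambda>x. indicator (cube c R) x * infnorm (G x))"
    and "(LINT x|lebesgue_on \<Omega>. indicator (cube c R) x * infnorm (G x))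
      \<le> 2 * (2 * R) powr (real CARD('n) * (1 - 1 / p)) * measure \<mu> (cube c R) powr (1 / p)"
proof -
  let ?Q = "cube c R" and ?g = "\<lambda>x. infnorm (G x)" and ?M = "lebesgue_on \<Omega>"
  define V where "V = (2 * R) ^ CARD('n)"
  have V: "0 < V" using R by (simp add: V_def)
  have Qs: "?Q \<in> sets ?M" by (rule cube_sets[OF Q])
  have "emeasure ?M ?Q = emeasure lebesgue ?Q"
    using op Q by (intro emeasure_restrict_space) auto
  then have eQ: "emeasure ?M ?Q = ennreal V"
    using emeasure_cube[of R c] R by (simp add: V_def open_cube)
  have mQ: "measure ?M ?Q = V" using eQ V by (simp add: measure_def)
  have iQ: "integrable ?M (indicator ?Q :: real ^ 'n \<Rightarrow> real)"
    using eQ Qs by (intro integrable_real_indicator) auto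
  have igp: "integrable ?M (\<lambda>x. indicator ?Q x * ?g x powr p)"
    using integrable_mult_indicator[OF Qs gradient_integrability(2)] by simp
  have pw: "indicator ?Q x * ?g x \<le> l * indicator ?Q x + l powr (1 - p) * (indicator ?Q x * ?g x powr p)"
    if l: "0 < l" for l x
  proof -
    have "?g x \<le> l + l powr (1 - p) * ?g x powr p"
    proof (cases "?g x \<le> l")
      case False
      then have g0: "0 < ?g x" using l by linarith
      have "?g x = ?g x powr (1 - p) * ?g x powr p" using g0 by (simp add: powr_add[symmetric])
      also have "\<dots> \<le> l powr (1 - p) * ?g x powr p"
        using False l p1 by (intro mult_right_mono powr_mono2') auto
      finally show ?thesis using l by linarith
    qed (simp add: add_increasing2)
    then show ?thesis by (auto simp: indicator_def)
  qed
  show int: "integrable ?M (\<lambda>x. indicator ?Q x * ?g x)"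
  proof (rule Bochner_Integration.integrable_bound)
    show "integrable ?M (\<lambda>x. 1 * indicator ?Q x + 1 powr (1 - p) * (indicator ?Q x * ?g x powr p))"
      by (intro Bochner_Integration.integrable_add integrable_mult_right iQ igp)
    show "(\<lambda>x. indicator ?Q x * ?g x) \<in> borel_measurable ?M"
      using Qs gradient_integrability(1) by (intro borel_measurable_times borel_measurable_indicator) auto
    show "AE x in ?M. norm (indicator ?Q x * ?g x) \<le> norm (1 * indicator ?Q x + 1 powr (1 - p) * (indicator ?Q x * ?g x powr p))"
      using pw[of 1] by (intro AE_I2) (auto simp: infnorm_pos_le abs_mult)
  qed
  define \<nu> where "\<nu> = measure \<mu> ?Q"
  have \<nu>: "\<nu> = (LINT x|?M. indicator ?Q x * ?g x powr p)" "0 \<le> \<nu>"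
    unfolding \<nu>_def using measure_energy[OF Qs] by auto
  have bound: "(LINT x|?M. indicator ?Q x * ?g x) \<le> l * V + l powr (1 - p) * \<nu>" if "0 < l" for l
  proof -
    have "(LINT x|?M. indicator ?Q x * ?g x) \<le> (LINT x|?M. l * indicator ?Q x + l powr (1 - p) * (indicator ?Q x * ?g x powr p))"
      using pw[OF that] by (intro integral_mono int Bochner_Integration.integrable_add integrable_mult_right iQ igp)
    also have "\<dots> = l * V + l powr (1 - p) * \<nu>" using iQ igp mQ Qs \<nu> Int_absorb2[OF Q] by simp
    finally show ?thesis .
  qed
  have V1: "V powr (1 - 1 / p) = (2 * R) powr (real CARD('n) * (1 - 1 / p))"
    using R unfolding V_def powr_powr[symmetric] by (subst powr_realpow) auto
  have "(LINT x|?M. indicator ?Q x * ?g x) \<le> 2 * V powr (1 - 1 / p) * \<nu> powr (1 / p)"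
  proof (cases "\<nu> = 0")
    case True
    have "(LINT x|?M. indicator ?Q x * ?g x) \<le> 0 + e" if "0 < e" for e
      using bound[of "e / V"] that V True by simp
    then have "(LINT x|?M. indicator ?Q x * ?g x) \<le> 0" by (rule field_le_epsilon)
    then show ?thesis using True by simp
  next
    case False
    then have n0: "0 < \<nu>" using \<nu>(2) by simp
    define l where "l = (\<nu> / V) powr (1 / p)"
    have l: "0 < l" using n0 V by (simp add: l_def)
    have "l * V = V powr (1 - 1 / p) * \<nu> powr (1 / p)"
      using n0 V by (simp add: l_def powr_divide powr_diff)
    moreover have "l powr (1 - p) * \<nu> = V powr (1 - 1 / p) * \<nu> powr (1 / p)"
    proof -
      have "l powr (1 - p) = (\<nu> / V) powr (1 / p - 1)" using p1 by (simp add: l_def powr_powr diff_divide_distrib)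
      also have "\<dots> = \<nu> powr (1 / p) / \<nu> * V / V powr (1 / p)"
        using n0 V by (simp add: powr_divide powr_diff)
      finally show ?thesis using n0 V by (simp add: powr_diff)
    qed
    ultimately show ?thesis using bound[OF l] by linarith
  qed
  then show "(LINT x|?M. indicator ?Q x * ?g x)
      \<le> 2 * (2 * R) powr (real CARD('n) * (1 - 1 / p)) * measure \<mu> ?Q powr (1 / p)"
    unfolding V1 \<nu>_def .
qed

definition "mollifier_const = real CARD('n) * bump_sup ^ (CARD('n) - 1) * 2 * 16 powr (real CARD('n) * (1 - 1 / p))"

lemma mollifier_const: "0 \<le> mollifier_const"
  unfolding mollifier_const_def using bump_sup(1) by (intro mult_nonneg_nonneg) auto

text \<open>Up to constants, the difference of the mollified values is at most \<open>t\<^sup>1\<^sup>-\<^sup>n\<close> times the integral of \<open>|G|\<close> over the cube,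
  and Hoelder's inequality contributes the \<open>(1 - 1 / p)\<close>-th power of its volume, which is at most
  \<open>(16 t)\<^sup>n\<close>. The exponents add up to \<open>1 - n / p\<close>.\<close>
lemma mollified_difference_le:
  assumes Q: "cube c R \<subseteq> \<Omega>" and t: "0 < t" "t \<le> t0" "t \<le> t1" "R \<le> 8 * t"
    and sub: "infnorm (c0 - c) + t0 < R" "infnorm (c1 - c) + t1 < R"
  shows "\<bar>mollified \<Omega> F c1 t1 - mollified \<Omega> F c0 t0\<bar>
    \<le> mollifier_const * t powr (1 - real CARD('n) / p) * measure \<mu> (cube c R) powr (1 / p)"
proof -
  let ?n = "real CARD('n)" and ?N = "measure \<mu> (cube c R) powr (1 / p)"
  have R: "0 < R" using sub t infnorm_pos_le[of "c0 - c"] by linarith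
  have e: "0 \<le> ?n * (1 - 1 / p)" using p1 by simp
  have n1: "1 \<le> CARD('n)" by (simp add: Suc_leI)
  have B0: "0 < bump_sup" using bump_sup(1) by linarith
  have "\<bar>mollified \<Omega> F c1 t1 - mollified \<Omega> F c0 t0\<bar>
      \<le> ?n * ((bump_sup / t) ^ (CARD('n) - 1) * (LINT x|lebesgue_on \<Omega>. indicator (cube c R) x * infnorm (G x)))"
    by (rule mollified_difference[OF op wg Q integral_gradient_le(1)[OF Q R] t(1-3) sub])
  also have "\<dots> \<le> ?n * ((bump_sup / t) ^ (CARD('n) - 1) * (2 * (16 * t) powr (?n * (1 - 1 / p)) * ?N))"
  proof -
    have "(2 * R) powr (?n * (1 - 1 / p)) \<le> (16 * t) powr (?n * (1 - 1 / p))"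
      using R t e by (intro powr_mono2) auto
    then have "2 * (2 * R) powr (?n * (1 - 1 / p)) * ?N \<le> 2 * (16 * t) powr (?n * (1 - 1 / p)) * ?N"
      by (intro mult_right_mono mult_left_mono) auto
    then have "(LINT x|lebesgue_on \<Omega>. indicator (cube c R) x * infnorm (G x)) \<le> 2 * (16 * t) powr (?n * (1 - 1 / p)) * ?N"
      using integral_gradient_le(2)[OF Q R] by linarith
    then show ?thesis using B0 t by (intro mult_left_mono) auto
  qed
  also have "\<dots> = mollifier_const * (t powr (1 - ?n) * t powr (?n * (1 - 1 / p))) * ?N"
  proof -
    have "(bump_sup / t) ^ (CARD('n) - 1) = bump_sup ^ (CARD('n) - 1) * t powr (1 - ?n)"
    proof -
      have "1 - ?n = - real (CARD('n) - 1)" using n1 by (simp add: of_nat_diff)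
      then have "t powr (1 - ?n) = inverse (t powr real (CARD('n) - 1))" by (simp only: powr_minus)
      also have "\<dots> = inverse (t ^ (CARD('n) - 1))" by (simp only: powr_realpow[OF t(1)])
      finally have "t powr (1 - ?n) = inverse (t ^ (CARD('n) - 1))" .
      then show ?thesis by (simp only: power_divide divide_inverse[of "bump_sup ^ (CARD('n) - 1)"])
    qed
    moreover have "(16 * t) powr (?n * (1 - 1 / p)) = 16 powr (?n * (1 - 1 / p)) * t powr (?n * (1 - 1 / p))"
      using t by (simp add: powr_mult)
    ultimately show ?thesis by (simp add: mollifier_const_def)
  qed
  also have "t powr (1 - ?n) * t powr (?n * (1 - 1 / p)) = t powr (1 - ?n / p)"
    by (simp add: powr_add[symmetric] right_diff_distrib)
  finally show ?thesis .
qed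

lemma exponent: "0 < 1 - real CARD('n) / p"
  using p p1 by simp

lemma half_powr: "(1 / 2 :: real) powr (1 - real CARD('n) / p) < 1"
  using powr_less_mono2[of "1 - real CARD('n) / p" "1 / 2" 1] exponent by simp

lemma mollified_tendsto:
  assumes x: "cube x R \<subseteq> \<Omega>" "0 < R" and \<tau>: "\<tau> \<longlonglongrightarrow> 0" "\<And>k. 0 < \<tau> k" "\<And>k. \<tau> k < R"
  shows "(\<lambda>k. mollified \<Omega> F x (\<tau> k)) \<longlonglongrightarrow> bump_mass TYPE('n) * F x"
proof (rule LIMSEQ_I)
  fix e :: real assume e: "0 < e"
  let ?m = "bump_mass TYPE('n)"
  have m: "0 < ?m" by (rule bump_mass_pos)
  have "x \<in> \<Omega>" using x by (auto simp: mem_cube infnorm_0)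
  then obtain d where d: "0 < d" "\<And>y. y \<in> \<Omega> \<Longrightarrow> dist y x < d \<Longrightarrow> dist (F y) (F x) < e / (2 * ?m)"
    using cont e m unfolding continuous_on_iff by (metis divide_pos_pos mult_pos_pos zero_less_numeral)
  define d' where "d' = d / sqrt (real CARD('n))"
  have n0: "0 < sqrt (real CARD('n))" by simp
  have d': "0 < d'" using d(1) n0 by (simp add: d'_def)
  have near: "dist y x < d" if "infnorm (y - x) < d'" for y
  proof -
    have "norm (y - x) \<le> sqrt (real CARD('n)) * infnorm (y - x)" using norm_le_infnorm[of "y - x"] by simp
    also have "\<dots> < sqrt (real CARD('n)) * d'" using that n0 by (intro mult_strict_left_mono)
    also have "\<dots> = d" using n0 unfolding d'_def by simp
    finally show ?thesis by (simp add: dist_norm)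
  qed
  obtain N where N: "\<And>k. k \<ge> N \<Longrightarrow> \<tau> k < d'"
    using LIMSEQ_D[OF \<tau>(1) d'] by (metis abs_less_iff diff_zero real_norm_def)
  have "norm (mollified \<Omega> F x (\<tau> k) - ?m * F x) < e" if k: "N \<le> k" for k
  proof -
    let ?T = "tensor (mollifier x (\<tau> k))" and ?M = "lebesgue_on \<Omega>"
    have tT: "test_function \<Omega> ?T" by (rule test_function_mollifier[OF \<tau>(2,3) x(1)])
    have iF: "integrable ?M (\<lambda>y. F y * ?T y)" by (rule weak_gradient_integrable_test(1)[OF op wg tT])
    have i1: "integrable ?M (\<lambda>y. c * ?T y)" for c
    proof -
      have "has_weak_gradient \<Omega> (\<lambda>_. c) (\<lambda>_. 0)" by (rule has_weak_gradient_C1[OF op]) auto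
      then show ?thesis by (rule weak_gradient_integrable_test(1)[OF op _ tT])
    qed
    have mc: "(LINT y|?M. c * ?T y) = c * ?m" for c
      using mollified_const[OF \<tau>(2,3) x(1) op, where k = c] by (simp add: mollified_def)
    have "\<bar>mollified \<Omega> F x (\<tau> k) - ?m * F x\<bar> = \<bar>LINT y|?M. F y * ?T y - F x * ?T y\<bar>"
      using Bochner_Integration.integral_diff[OF iF i1[of "F x"]] mc[of "F x"] by (simp only: mollified_def mult.commute)
    also have "\<dots> \<le> (LINT y|?M. \<bar>F y * ?T y - F x * ?T y\<bar>)" by (rule integral_abs_bound)
    also have "\<dots> \<le> (LINT y|?M. e / (2 * ?m) * ?T y)"
    proof (rule integral_mono)
      fix y assume "y \<in> space ?M"
      then have y: "y \<in> \<Omega>" by simp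
      show "\<bar>F y * ?T y - F x * ?T y\<bar> \<le> e / (2 * ?m) * ?T y"
      proof (cases "y \<in> cube x (\<tau> k)")
        case True
        then have "dist (F y) (F x) < e / (2 * ?m)"
          using N[OF k] by (intro d(2) y near) (auto simp: mem_cube)
        then have "\<bar>F y - F x\<bar> * ?T y \<le> e / (2 * ?m) * ?T y"
          using tensor_mollifier_nonneg[OF \<tau>(2)] by (intro mult_right_mono) (auto simp: dist_real_def)
        moreover have "F y * ?T y - F x * ?T y = (F y - F x) * ?T y" by (simp add: algebra_simps)
        ultimately show ?thesis
          using tensor_mollifier_nonneg[OF \<tau>(2)[of k], where c = x and y = y] by (simp only: abs_mult abs_of_nonneg)
      next
        case False
        then show ?thesis by (simp add: tensor_mollifier_eq_0[OF \<tau>(2)])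
      qed
    qed (use iF i1 in auto)
    also have "\<dots> = e / 2" unfolding mc using m by simp
    finally show ?thesis using e by simp
  qed
  then show "\<exists>N. \<forall>k\<ge>N. norm (mollified \<Omega> F x (\<tau> k) - ?m * F x) < e" by blast
qed

definition "morrey_root_const = mollifier_const / (1 - (1 / 2) powr (1 - real CARD('n) / p)) + mollifier_const"

text \<open>Mollified values at \<open>x\<close> with the widths \<open>2\<^sup>-\<^sup>k r / 4\<close> converge to a multiple of \<open>F x\<close> by continuity. Their
  increments decay geometrically as \<open>1 - n / p > 0\<close>; a last step moves the centre from \<open>x\<close> to \<open>c\<close>.\<close>
lemma mollified_center_bound:
  assumes Q: "cube c r \<subseteq> \<Omega>" and r: "0 < r" and x: "infnorm (x - c) \<le> r / 2"
  shows "\<bar>bump_mass TYPE('n) * F x - mollified \<Omega> F c (r / 4)\<bar>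
    \<le> morrey_root_const * (r powr (1 - real CARD('n) / p) * measure \<mu> (cube c r) powr (1 / p))"
proof -
  let ?s = "1 - real CARD('n) / p" and ?N = "measure \<mu> (cube c r) powr (1 / p)"
  define \<tau> where "\<tau> k = r / 4 * (1 / 2) ^ k" for k :: nat
  define \<theta> where "\<theta> = (1 / 2 :: real) powr ?s"
  interpret finite_measure \<mu> by (rule finite_energy)
  have \<theta>: "0 < \<theta>" "\<theta> < 1" unfolding \<theta>_def using half_powr by auto
  have \<tau>: "0 < \<tau> k" "\<tau> k \<le> r / 4" "\<tau> (Suc k) = \<tau> k / 2" for k
    using r by (auto simp: \<tau>_def mult_left_le power_le_one)
  have sub: "cube x (r / 2) \<subseteq> cube c r" using x by (intro cube_mono) simp
  have xO: "cube x (r / 2) \<subseteq> \<Omega>" using sub Q by blast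
  have i0: "infnorm (x - x) = 0" by (simp add: infnorm_0)
  have small: "mollifier_const * t powr ?s * measure \<mu> A powr (1 / p) \<le> mollifier_const * t powr ?s * ?N" if "A \<subseteq> cube c r" for A t
    using that mollifier_const p1 cube_sets[OF Q] by (intro mult_left_mono powr_mono2 finite_measure_mono) (auto simp: space_energy)
  have "\<bar>mollified \<Omega> F x (\<tau> (Suc k)) - mollified \<Omega> F x (\<tau> k)\<bar> \<le> (mollifier_const * r powr ?s * ?N) * \<theta> ^ k" for k
  proof -
    let ?R = "2 * \<tau> k"
    have sR: "cube x ?R \<subseteq> cube c r"
      using \<tau>(2)[of k] x by (intro cube_mono) simp
    have "\<bar>mollified \<Omega> F x (\<tau> (Suc k)) - mollified \<Omega> F x (\<tau> k)\<bar>
        \<le> mollifier_const * \<tau> (Suc k) powr ?s * measure \<mu> (cube x ?R) powr (1 / p)"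
      by (rule mollified_difference_le) (use sR Q \<tau>[of k] i0 in auto)
    also have "\<dots> \<le> mollifier_const * \<tau> (Suc k) powr ?s * ?N" by (rule small[OF sR])
    also have "\<dots> \<le> mollifier_const * (r * (1 / 2) ^ k) powr ?s * ?N"
      using r exponent mollifier_const by (intro mult_right_mono mult_left_mono powr_mono2) (auto simp: \<tau>_def)
    also have "(r * (1 / 2) ^ k) powr ?s = r powr ?s * \<theta> ^ k"
    proof -
      have "((1 / 2 :: real) ^ k) powr ?s = \<theta> ^ k"
        unfolding \<theta>_def by (subst (1 2) powr_realpow[symmetric]) (auto simp: powr_powr mult.commute)
      then show ?thesis using r by (simp add: powr_mult)
    qed
    finally show ?thesis by (simp add: algebra_simps)
  qed
  moreover have "(\<lambda>k. mollified \<Omega> F x (\<tau> k)) \<longlonglongrightarrow> bump_mass TYPE('n) * F x"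
  proof (rule mollified_tendsto[OF xO])
    have "(\<lambda>k. r / 4 * (1 / 2) ^ k) \<longlonglongrightarrow> r / 4 * 0" by (intro tendsto_mult_left LIMSEQ_power_zero) simp
    then show "\<tau> \<longlonglongrightarrow> 0" by (simp add: \<tau>_def[abs_def])
    show "\<tau> k < r / 2" for k using \<tau>(2)[of k] r by linarith
  qed (use r \<tau> in auto)
  ultimately have "\<bar>bump_mass TYPE('n) * F x - mollified \<Omega> F x (\<tau> 0)\<bar> \<le> (mollifier_const * r powr ?s * ?N) / (1 - \<theta>)"
    using \<theta> by (intro telescoping_geometric_bound)
  moreover have "\<bar>mollified \<Omega> F x (r / 4) - mollified \<Omega> F c (r / 4)\<bar> \<le> mollifier_const * r powr ?s * ?N"
  proof -
    have "\<bar>mollified \<Omega> F x (r / 4) - mollified \<Omega> F c (r / 4)\<bar> \<le> mollifier_const * (r / 4) powr ?s * ?N"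
      by (rule mollified_difference_le) (use Q r x infnorm_0[where 'a = "real ^ 'n"] in auto)
    also have "\<dots> \<le> mollifier_const * r powr ?s * ?N"
      using r exponent mollifier_const by (intro mult_right_mono mult_left_mono powr_mono2) auto
    finally show ?thesis .
  qed
  ultimately have "\<bar>bump_mass TYPE('n) * F x - mollified \<Omega> F c (r / 4)\<bar>
      \<le> (mollifier_const * r powr ?s * ?N) / (1 - \<theta>) + mollifier_const * r powr ?s * ?N"
    by (simp add: \<tau>_def)
  also have "\<dots> = morrey_root_const * (r powr ?s * ?N)" by (simp add: morrey_root_const_def \<theta>_def algebra_simps)
  finally show ?thesis .
qed

text \<open>The summand 1 makes the constant positive.\<close>
definition "morrey_C = (2 * morrey_root_const / bump_mass TYPE('n)) powr p + 1"

lemma morrey: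
  assumes Q: "cube c r \<subseteq> \<Omega>" and r: "0 < r" and x: "infnorm (x - c) \<le> r / 2" and y: "infnorm (y - c) \<le> r / 2"
  shows "\<bar>F x - F y\<bar> powr p \<le> morrey_C * r powr (p - real CARD('n)) * measure \<mu> (cube c r)"
proof -
  let ?s = "1 - real CARD('n) / p" and ?N = "measure \<mu> (cube c r) powr (1 / p)" and ?m = "bump_mass TYPE('n)"
  have m: "0 < ?m" by (rule bump_mass_pos)
  have morrey_root_const: "0 \<le> morrey_root_const"
    unfolding morrey_root_const_def using mollifier_const half_powr by (intro add_nonneg_nonneg divide_nonneg_nonneg) (auto simp: less_imp_le)
  have "?m * \<bar>F x - F y\<bar> = \<bar>?m * F x - ?m * F y\<bar>" using m by (simp add: abs_mult right_diff_distrib[symmetric])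
  also have "\<dots> \<le> 2 * (morrey_root_const * (r powr ?s * ?N))"
    using mollified_center_bound[OF Q r x] mollified_center_bound[OF Q r y] by linarith
  finally have "\<bar>F x - F y\<bar> \<le> 2 * morrey_root_const / ?m * (r powr ?s * ?N)"
    using m by (simp add: field_simps)
  then have "\<bar>F x - F y\<bar> powr p \<le> (2 * morrey_root_const / ?m * (r powr ?s * ?N)) powr p"
    using p1 by (intro powr_mono2) auto
  also have "\<dots> = (2 * morrey_root_const / ?m) powr p * ((r powr ?s) powr p * ?N powr p)"
    using morrey_root_const m by (simp only: powr_mult)
  also have "(r powr ?s) powr p = r powr (p - real CARD('n))"
    using p1 by (simp add: powr_powr left_diff_distrib)
  also have "?N powr p = measure \<mu> (cube c r)" using p1 by (simp add: powr_powr)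
  also have "(2 * morrey_root_const / ?m) powr p * (r powr (p - real CARD('n)) * measure \<mu> (cube c r))
      \<le> morrey_C * (r powr (p - real CARD('n)) * measure \<mu> (cube c r))"
    by (intro mult_right_mono) (auto simp: morrey_C_def)
  finally show ?thesis by (simp add: mult.assoc)
qed

end

section \<open>Arc length\<close>

text \<open>The sums and the partitions in \<^const>\<open>inscribed_lengths\<close> are treated apart, for partitions of
  arbitrary intervals, so that they can be concatenated.\<close>
definition chords :: "(real \<Rightarrow> real ^ 'n) \<Rightarrow> nat \<Rightarrow> (nat \<Rightarrow> real) \<Rightarrow> real" where
  "chords \<gamma> k t = (\<Sum>i<k. infnorm (\<gamma> (t (Suc i)) - \<gamma> (t i)))"

definition subdivision :: "real \<Rightarrow> real \<Rightarrow> nat \<Rightarrow> (nat \<Rightarrow> real) \<Rightarrow> bool" where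
  "subdivision u v k t \<longleftrightarrow> (\<forall>i\<le>k. t i \<in> {u..v}) \<and> (\<forall>i<k. t i \<le> t (Suc i))"

lemma inscribed_lengths_eq: "inscribed_lengths \<gamma> u = {chords \<gamma> k t | k t. subdivision 0 u k t}"
  by (simp add: inscribed_lengths_def chords_def subdivision_def)

lemma zero_inscribed: "0 \<le> u \<Longrightarrow> 0 \<in> inscribed_lengths \<gamma> u"
  unfolding inscribed_lengths_eq by (auto simp: chords_def subdivision_def intro!: exI[of _ 0] exI[of _ "\<lambda>_. 0"])

locale rectifiable =
  fixes \<gamma> :: "real \<Rightarrow> real ^ 'n"
  assumes rect: "rectifiable_path \<gamma>"
begin

abbreviation "len \<equiv> arc_length \<gamma>"

lemma bdd: "u \<le> 1 \<Longrightarrow> bdd_above (inscribed_lengths \<gamma> u)"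
proof -
  assume "u \<le> 1"
  then have "subdivision 0 1 k t" if "subdivision 0 u k t" for k t
    using that by (auto simp: subdivision_def intro: order_trans)
  then have "inscribed_lengths \<gamma> u \<subseteq> inscribed_lengths \<gamma> 1"
    unfolding inscribed_lengths_eq by blast
  moreover have "bdd_above (inscribed_lengths \<gamma> 1)" using rect by (simp add: rectifiable_path_def)
  ultimately show ?thesis by (rule bdd_above_mono[rotated])
qed

lemma chords_le: "u \<le> 1 \<Longrightarrow> subdivision 0 u k t \<Longrightarrow> chords \<gamma> k t \<le> len u"
  unfolding arc_length_def by (intro cSup_upper bdd) (auto simp: inscribed_lengths_eq)

lemma len_nonneg: "0 \<le> u \<Longrightarrow> u \<le> 1 \<Longrightarrow> 0 \<le> len u"
  unfolding arc_length_def by (intro cSup_upper bdd zero_inscribed)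

text \<open>A subdivision of \<open>[0, u]\<close> followed by one of \<open>[u, v]\<close> subdivides \<open>[0, v]\<close>.\<close>
lemma len_superadditive:
  assumes uv: "0 \<le> u" "u \<le> v" "v \<le> 1" and \<tau>: "subdivision u v m \<tau>"
  shows "len u + chords \<gamma> m \<tau> \<le> len v"
proof -
  have "len u \<le> len v - chords \<gamma> m \<tau>"
    unfolding arc_length_def[of _ u]
  proof (rule cSup_least)
    show "inscribed_lengths \<gamma> u \<noteq> {}" using zero_inscribed[OF uv(1)] by blast
    fix s assume "s \<in> inscribed_lengths \<gamma> u"
    then obtain k t where s: "s = chords \<gamma> k t" and t: "subdivision 0 u k t"
      unfolding inscribed_lengths_eq by blast
    define w where "w i = (if i \<le> k then t i else \<tau> (i - Suc k))" for i
    have "subdivision 0 v (k + 1 + m) w"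
      unfolding subdivision_def
    proof (intro conjI allI impI)
      fix i assume i: "i \<le> k + 1 + m"
      show "w i \<in> {0..v}"
      proof (cases "i \<le> k")
        case True
        then have "t i \<in> {0..u}" using t by (simp add: subdivision_def)
        then show ?thesis using True uv by (auto simp: w_def)
      next
        case False
        then have "\<tau> (i - Suc k) \<in> {u..v}" using \<tau> i by (simp add: subdivision_def)
        then show ?thesis using False uv by (auto simp: w_def)
      qed
    next
      fix i assume i: "i < k + 1 + m"
      consider "i < k" | "i = k" | "k < i" by linarith
      then show "w i \<le> w (Suc i)"
      proof cases
        case 1 then show ?thesis using t by (simp add: w_def subdivision_def)
      next
        case 2
        have "t k \<in> {0..u}" "\<tau> 0 \<in> {u..v}" using t \<tau> by (auto simp: subdivision_def)
        then show ?thesis using 2 by (simp add: w_def)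
      next
        case 3
        then have "Suc i - Suc k = Suc (i - Suc k)" "i - Suc k < m" using i by auto
        then show ?thesis using 3 \<tau> by (simp add: w_def subdivision_def)
      qed
    qed
    then have "chords \<gamma> (k + 1 + m) w \<le> len v" using uv by (intro chords_le)
    moreover have "chords \<gamma> k t + chords \<gamma> m \<tau> \<le> chords \<gamma> (k + 1 + m) w"
    proof -
      have split: "{..<k + 1 + m} = {..<k} \<union> {k} \<union> ((\<lambda>i. i + Suc k) ` {..<m})"
      proof (intro set_eqI iffI)
        fix i assume i: "i \<in> {..<k + 1 + m}"
        show "i \<in> {..<k} \<union> {k} \<union> ((\<lambda>i. i + Suc k) ` {..<m})"
        proof (cases "i \<le> k")
          case False
          then have "i = (i - Suc k) + Suc k" "i - Suc k \<in> {..<m}" using i by auto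
          then show ?thesis by blast
        qed auto
      qed auto
      have "chords \<gamma> (k + 1 + m) w = (\<Sum>i<k. infnorm (\<gamma> (w (Suc i)) - \<gamma> (w i))) + infnorm (\<gamma> (w (Suc k)) - \<gamma> (w k))
          + (\<Sum>i\<in>(\<lambda>i. i + Suc k) ` {..<m}. infnorm (\<gamma> (w (Suc i)) - \<gamma> (w i)))"
        unfolding chords_def split
        by (subst sum.union_disjoint) (auto simp: sum.union_disjoint)
      also have "(\<Sum>i<k. infnorm (\<gamma> (w (Suc i)) - \<gamma> (w i))) = chords \<gamma> k t"
        by (simp add: chords_def w_def)
      also have "(\<Sum>i\<in>(\<lambda>i. i + Suc k) ` {..<m}. infnorm (\<gamma> (w (Suc i)) - \<gamma> (w i))) = chords \<gamma> m \<tau>"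
        by (subst sum.reindex) (auto simp: inj_on_def chords_def w_def)
      finally show ?thesis using infnorm_pos_le[of "\<gamma> (w (Suc k)) - \<gamma> (w k)"] by linarith
    qed
    ultimately show "s \<le> len v - chords \<gamma> m \<tau>" using s by linarith
  qed
  then show ?thesis by simp
qed

lemma chord_le_len_diff:
  assumes "0 \<le> u" "u \<le> v" "v \<le> 1"
  shows "infnorm (\<gamma> v - \<gamma> u) \<le> len v - len u"
proof -
  have "subdivision u v 1 (\<lambda>i. if i = 0 then u else v)" using assms by (auto simp: subdivision_def)
  from len_superadditive[OF assms this] show ?thesis by (simp add: chords_def)
qed

lemma len_0: "len 0 = 0"
proof -
  have "chords \<gamma> k t = 0" if t: "subdivision 0 0 k t" for k t
  proof -
    have "t i = 0" if "i \<le> k" for i using t that by (simp add: subdivision_def)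
    then show ?thesis by (simp add: chords_def infnorm_0)
  qed
  then have "inscribed_lengths \<gamma> 0 \<subseteq> {0}" unfolding inscribed_lengths_eq by blast
  then have "inscribed_lengths \<gamma> 0 = {0}" using zero_inscribed[of 0 \<gamma>] by auto
  then show ?thesis by (simp add: arc_length_def)
qed

lemma path_cont: "continuous_on {0..1} \<gamma>"
  using rect by (simp add: rectifiable_path_def path_def)

text \<open>The length of an inscribed polygon, cut off at \<open>u\<close>, depends continuously on \<open>u\<close>. Its difference
  to the arc length increases in \<open>u\<close>, so it is a uniform approximation of the arc length as soon as
  it is a good approximation at the end point.\<close>
lemma continuous_len: "continuous_on {0..1} len"
proof -
  define S where "S k t u = chords \<gamma> k (\<lambda>i. min (t i) u)" for k t u
  have contS: "continuous_on {0..1} (S k t)" if t: "subdivision 0 1 k t" for k t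
  proof -
    have c: "continuous_on {0..1} (\<lambda>u. \<gamma> (min (t i) u))" if "i \<le> k" for i
    proof (rule continuous_on_compose2[OF path_cont])
      show "(\<lambda>u. min (t i) u) ` {0..1} \<subseteq> {0..1}" using t that by (auto simp: subdivision_def min_def)
    qed (intro continuous_intros)
    show ?thesis
      unfolding S_def chords_def
      by (intro continuous_on_sum continuous_on_infnorm continuous_on_diff c) auto
  qed
  have mono: "S k t v - S k t u \<le> len v - len u"
    if t: "subdivision 0 1 k t" and uv: "0 \<le> u" "u \<le> v" "v \<le> 1" for k t u v
  proof -
    define \<tau> where "\<tau> i = max u (min (t i) v)" for i
    have "subdivision u v k \<tau>"
      using t uv by (auto simp: subdivision_def \<tau>_def) 
    then have "chords \<gamma> k \<tau> \<le> len v - len u" using len_superadditive[OF uv] by fastforce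
    moreover have "S k t v - S k t u \<le> chords \<gamma> k \<tau>"
    proof -
      have "infnorm (\<gamma> (min b v) - \<gamma> (min a v)) - infnorm (\<gamma> (min b u) - \<gamma> (min a u))
          \<le> infnorm (\<gamma> (max u (min b v)) - \<gamma> (max u (min a v)))" if "a \<le> b" for a b
      proof -
        consider "b \<le> u" | "a \<le> u" "u < b" | "u < a" using that by linarith
        then show ?thesis
        proof cases
          case 1 then show ?thesis using that uv by (simp add: infnorm_0 infnorm_pos_le min_def max_def)
        next
          case 2
          then show ?thesis using uv infnorm_diff_triangle[of "\<gamma> (min b v)" "\<gamma> a" "\<gamma> u"]
            by (auto simp: min_def max_def)
        next
          case 3 then show ?thesis using that uv by (auto simp: infnorm_0 min_def max_def)
        qed
      qed
      then have "(\<Sum>i<k. infnorm (\<gamma> (min (t (Suc i)) v) - \<gamma> (min (t i) v)) - infnorm (\<gamma> (min (t (Suc i)) u) - \<gamma> (min (t i) u)))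
          \<le> chords \<gamma> k \<tau>"
        unfolding chords_def \<tau>_def using t by (intro sum_mono) (auto simp: subdivision_def)
      then show ?thesis by (simp add: S_def chords_def sum_subtractf)
    qed
    ultimately show ?thesis by linarith
  qed
  show ?thesis
    unfolding continuous_on_iff
  proof (intro ballI allI impI)
    fix u e :: real assume u: "u \<in> {0..1}" and e: "0 < e"
    have "len 1 - e / 3 < len 1" using e by simp
    then obtain s where s: "s \<in> inscribed_lengths \<gamma> 1" "len 1 - e / 3 < s"
      unfolding arc_length_def[of \<gamma> 1] using less_cSupE zero_inscribed[of 1 \<gamma>] by (metis empty_iff zero_le_one)
    then obtain k t where t: "subdivision 0 1 k t" and sk: "s = chords \<gamma> k t"
      unfolding inscribed_lengths_eq by blast
    have "S k t 1 = chords \<gamma> k t"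
      using t unfolding S_def chords_def by (intro sum.cong) (auto simp: subdivision_def min_def)
    then have end1: "len 1 - e / 3 < S k t 1" using s sk by simp
    have "min (t i) 0 = 0" if "i \<le> k" for i using t that by (auto simp: subdivision_def)
    then have S0: "S k t 0 = 0"
      unfolding S_def chords_def by (intro sum.neutral) (auto simp: infnorm_0)
    have approx: "S k t v \<le> len v" "len v < S k t v + e / 3" if "v \<in> {0..1}" for v
      using mono[OF t, of 0 v] mono[OF t, of v 1] that len_0 S0 end1 by auto
    obtain d where d: "0 < d" "\<And>v. v \<in> {0..1} \<Longrightarrow> dist v u < d \<Longrightarrow> dist (S k t v) (S k t u) < e / 3"
      using contS[OF t] u e unfolding continuous_on_iff by (metis divide_pos_pos zero_less_numeral)
    have "dist (len v) (len u) < e" if "v \<in> {0..1}" "dist v u < d" for v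
      using approx[OF that(1)] approx[OF u] d(2)[OF that] unfolding dist_real_def by linarith
    then show "\<exists>d>0. \<forall>v\<in>{0..1}. dist v u < d \<longrightarrow> dist (len v) (len u) < e" using d(1) by blast
  qed
qed

lemma infnorm_le_len: "s \<in> {0..1} \<Longrightarrow> t \<in> {0..1} \<Longrightarrow> infnorm (\<gamma> s - \<gamma> t) \<le> \<bar>len s - len t\<bar>"
  using chord_le_len_diff[of s t] chord_le_len_diff[of t s] infnorm_sub[of "\<gamma> s" "\<gamma> t"]
  by (cases "s \<le> t") auto

abbreviation "\<sigma> \<equiv> arc_length_param \<gamma>"

lemma param_ex:
  assumes "u \<in> {0..len 1}"
  obtains t where "t \<in> {0..1}" "len t = u" "\<sigma> u = \<gamma> t"
proof -
  have "\<exists>t\<ge>0. t \<le> 1 \<and> len t = u"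
    using assms len_0 continuous_len by (intro IVT') auto
  then have "\<exists>t. t \<in> {0..1} \<and> len t = u" by auto
  from someI_ex[OF this] show ?thesis using that unfolding arc_length_param_def by blast
qed

lemma param_Lipschitz:
  assumes "u \<in> {0..len 1}" "v \<in> {0..len 1}"
  shows "infnorm (\<sigma> u - \<sigma> v) \<le> \<bar>u - v\<bar>"
proof -
  obtain s where s: "s \<in> {0..1}" "len s = u" "\<sigma> u = \<gamma> s" by (rule param_ex[OF assms(1)]) (rule that)
  obtain t where t: "t \<in> {0..1}" "len t = v" "\<sigma> v = \<gamma> t" by (rule param_ex[OF assms(2)]) (rule that)
  show ?thesis using infnorm_le_len[OF s(1) t(1)] s t by simp
qed

lemma param_at_len:
  assumes t: "t \<in> {0..1}"
  shows "\<sigma> (len t) = \<gamma> t"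
proof -
  have "len t \<le> len 1" using chord_le_len_diff[of t 1] infnorm_pos_le[of "\<gamma> 1 - \<gamma> t"] t by simp
  then have "len t \<in> {0..len 1}" using len_nonneg t by auto
  then obtain s where s: "s \<in> {0..1}" "len s = len t" "\<sigma> (len t) = \<gamma> s" by (rule param_ex) (rule that)
  then have "infnorm (\<gamma> s - \<gamma> t) \<le> 0" using infnorm_le_len[OF s(1) t] by simp
  then have "\<gamma> s = \<gamma> t" using infnorm_pos_lt[of "\<gamma> s - \<gamma> t"] by force
  then show ?thesis using s by simp
qed

lemma param_ends: "\<sigma> 0 = pathstart \<gamma>" "\<sigma> (len 1) = pathfinish \<gamma>"
  using param_at_len[of 0] param_at_len[of 1] len_0 by (auto simp: pathstart_def pathfinish_def)

lemma param_image: "u \<in> {0..len 1} \<Longrightarrow> \<sigma> u \<in> path_image \<gamma>"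
  by (erule param_ex) (auto simp: path_image_def)

lemma param_continuous: "continuous_on {0..len 1} \<sigma>"
  unfolding continuous_on_iff
proof (intro ballI allI impI)
  fix u e :: real assume u: "u \<in> {0..len 1}" and e: "0 < e"
  have n0: "0 < sqrt (real CARD('n))" by simp
  have "dist (\<sigma> v) (\<sigma> u) < e" if "v \<in> {0..len 1}" "dist v u < e / sqrt (real CARD('n))" for v
  proof -
    have "norm (\<sigma> v - \<sigma> u) \<le> sqrt (real CARD('n)) * infnorm (\<sigma> v - \<sigma> u)" using norm_le_infnorm[of "\<sigma> v - \<sigma> u"] by simp
    also have "\<dots> \<le> sqrt (real CARD('n)) * \<bar>v - u\<bar>" using param_Lipschitz[OF that(1) u] by (intro mult_left_mono) auto
    also have "\<dots> < sqrt (real CARD('n)) * (e / sqrt (real CARD('n)))"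
      using that(2) n0 by (intro mult_strict_left_mono) (auto simp: dist_real_def)
    finally show ?thesis using n0 by (simp add: dist_norm)
  qed
  then show "\<exists>d>0. \<forall>v\<in>{0..len 1}. dist v u < d \<longrightarrow> dist (\<sigma> v) (\<sigma> u) < e" using e n0 by (intro exI[of _ "e / sqrt (real CARD('n))"]) auto
qed

end

lemma rectifiable_if_Lipschitz:
  assumes "path \<gamma>" "\<And>s t. s \<in> {0..1} \<Longrightarrow> t \<in> {0..1} \<Longrightarrow> infnorm (\<gamma> t - \<gamma> s) \<le> B * \<bar>t - s\<bar>"
  shows "rectifiable_path \<gamma>"
proof -
  have B: "0 \<le> B" using assms(2)[of 0 1] infnorm_pos_le[of "\<gamma> 1 - \<gamma> 0"] by simp
  have "chords \<gamma> k t \<le> B" if t: "subdivision 0 1 k t" for k t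
  proof -
    have "chords \<gamma> k t \<le> (\<Sum>i<k. B * (t (Suc i) - t i))"
      unfolding chords_def
    proof (rule sum_mono)
      fix i assume i: "i \<in> {..<k}"
      then have "t i \<in> {0..1}" "t (Suc i) \<in> {0..1}" "t i \<le> t (Suc i)" using t by (auto simp: subdivision_def)
      then show "infnorm (\<gamma> (t (Suc i)) - \<gamma> (t i)) \<le> B * (t (Suc i) - t i)" using assms(2)[of "t i" "t (Suc i)"] by simp
    qed
    also have "\<dots> = B * (t k - t 0)" by (simp add: sum_distrib_left[symmetric] sum_lessThan_telescope)
    also have "\<dots> \<le> B * 1"
    proof (rule mult_left_mono[OF _ B])
      have "t k \<le> 1" "0 \<le> t 0" using t by (auto simp: subdivision_def)
      then show "t k - t 0 \<le> 1" by simp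
    qed
    finally show ?thesis by simp
  qed
  then show ?thesis using assms(1) unfolding rectifiable_path_def inscribed_lengths_eq by (auto intro!: bdd_aboveI)
qed

lemma linepath_length:
  fixes x y :: "real ^ 'n"
  shows "rectifiable_path (linepath x y)"
    and "u \<in> {0..1} \<Longrightarrow> arc_length (linepath x y) u = u * infnorm (y - x)"
proof -
  have diff: "linepath x y t - linepath x y s = (t - s) *\<^sub>R (y - x)" for s t
    by (simp add: linepath_def algebra_simps)
  show rect: "rectifiable_path (linepath x y)"
    by (rule rectifiable_if_Lipschitz[of _ "infnorm (y - x)"]) (auto simp: diff infnorm_mul)
  assume u: "u \<in> {0..1}"
  interpret rectifiable "linepath x y" by unfold_locales (rule rect)
  have ch: "chords (linepath x y) k t = (t k - t 0) * infnorm (y - x)" if "subdivision 0 u k t" for k t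
  proof -
    have "chords (linepath x y) k t = (\<Sum>i<k. (t (Suc i) - t i) * infnorm (y - x))"
      using that unfolding chords_def by (intro sum.cong) (auto simp: diff infnorm_mul subdivision_def)
    then show ?thesis by (simp add: sum_distrib_right[symmetric] sum_lessThan_telescope)
  qed
  show "arc_length (linepath x y) u = u * infnorm (y - x)"
  proof (rule antisym)
    show "arc_length (linepath x y) u \<le> u * infnorm (y - x)"
      unfolding arc_length_def
    proof (rule cSup_least)
      show "inscribed_lengths (linepath x y) u \<noteq> {}" using zero_inscribed u by fastforce
      fix s assume "s \<in> inscribed_lengths (linepath x y) u"
      then obtain k t where t: "subdivision 0 u k t" "s = chords (linepath x y) k t"
        unfolding inscribed_lengths_eq by blast
      then have "s = (t k - t 0) * infnorm (y - x)" using ch by simp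
      also have "\<dots> \<le> u * infnorm (y - x)"
      proof (rule mult_right_mono)
        have "t k \<le> u" "0 \<le> t 0" using t(1) by (auto simp: subdivision_def)
        then show "t k - t 0 \<le> u" by simp
      qed (rule infnorm_pos_le)
      finally show "s \<le> u * infnorm (y - x)" .
    qed
    show "u * infnorm (y - x) \<le> arc_length (linepath x y) u"
      using chord_le_len_diff[of 0 u] u len_0 unfolding diff by (simp add: infnorm_mul)
  qed
qed

lemma linepath_integral:
  fixes x y :: "real ^ 'n"
  assumes "x \<noteq> y"
  shows "arc_length_integral w (linepath x y)
    = integral {0..infnorm (y - x)} (\<lambda>u. w (x + (u / infnorm (y - x)) *\<^sub>R (y - x)))"
proof -
  have l: "0 < infnorm (y - x)" using assms by (simp add: infnorm_pos_lt)
  interpret rectifiable "linepath x y" by unfold_locales (rule linepath_length)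
  have "\<sigma> u = x + (u / infnorm (y - x)) *\<^sub>R (y - x)" if u: "u \<in> {0..infnorm (y - x)}" for u
  proof -
    have t: "u / infnorm (y - x) \<in> {0..1}" using u l by (auto simp: divide_le_eq)
    have "\<sigma> u = linepath x y (u / infnorm (y - x))"
      using param_at_len[OF t] linepath_length(2)[OF t, of x y] l by simp
    then show ?thesis by (simp add: linepath_def algebra_simps)
  qed
  moreover have "len 1 = infnorm (y - x)" using linepath_length(2)[of 1 x y] by simp
  ultimately show ?thesis
    unfolding arc_length_integral_def by (auto intro!: Henstock_Kurzweil_Integration.integral_cong)
qed

section \<open>The metric\<close>

definition curves :: "(real ^ 'n) set \<Rightarrow> real ^ 'n \<Rightarrow> real ^ 'n \<Rightarrow> (real \<Rightarrow> real ^ 'n) set" where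
  "curves \<Omega> x y = {\<gamma>. rectifiable_path \<gamma> \<and> path_image \<gamma> \<subseteq> \<Omega> \<and> pathstart \<gamma> = x \<and> pathfinish \<gamma> = y}"

lemma d_metric_eq:
  "d_metric \<alpha> \<Omega> x y = (INF \<gamma>\<in>curves \<Omega> x y. arc_length_integral (\<lambda>z. bd \<Omega> z powr (\<alpha> - 1)) \<gamma>)"
  by (simp add: d_metric_def curves_def)

lemma arc_length_integral_nonneg:
  assumes "\<And>z. 0 \<le> w z"
  shows "0 \<le> arc_length_integral w \<gamma>"
proof (cases "(\<lambda>u. w (arc_length_param \<gamma> u)) integrable_on {0..arc_length \<gamma> 1}")
  case True
  then show ?thesis unfolding arc_length_integral_def using assms
    by (intro Henstock_Kurzweil_Integration.integral_nonneg) auto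
next
  case False
  then show ?thesis unfolding arc_length_integral_def by (simp add: not_integrable_integral)
qed

text \<open>Without this the infimum defining \<^const>\<open>d_metric\<close> could be an unspecified number. Points of a
  connected open set are joined by polynomial curves, which are Lipschitz.\<close>
lemma curves_nonempty:
  assumes "is_domain \<Omega>" "x \<in> \<Omega>" "y \<in> \<Omega>"
  shows "curves \<Omega> x y \<noteq> {}"
proof -
  obtain g where g: "polynomial_function g" "path_image g \<subseteq> \<Omega>" "pathstart g = x" "pathfinish g = y"
    using connected_open_polynomial_connected[of \<Omega> x y] assms unfolding is_domain_def by blast
  obtain g' where g': "polynomial_function g'" "\<And>t. (g has_vector_derivative g' t) (at t)"
    using has_vector_derivative_polynomial_function[OF g(1)] by blast
  have "bounded (g' ` {0..1})"
    by (intro compact_imp_bounded compact_continuous_image continuous_on_polymonial_function g'(1)) auto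
  then obtain B where B: "\<And>t. t \<in> {0..1} \<Longrightarrow> norm (g' t) \<le> B" unfolding bounded_iff by blast
  have "infnorm (g t - g s) \<le> B * \<bar>t - s\<bar>" if "s \<in> {0..1}" "t \<in> {0..1}" for s t
  proof -
    have "norm (g t - g s) \<le> B * norm (t - s)"
    proof (rule differentiable_bound[of "{0..1::real}" g "\<lambda>t h. h *\<^sub>R g' t"])
      show "(g has_derivative (\<lambda>h. h *\<^sub>R g' t)) (at t within {0..1})" for t
        using g'(2)[of t] unfolding has_vector_derivative_def by (rule has_derivative_at_withinI)
      show "onorm (\<lambda>h. h *\<^sub>R g' t) \<le> B" if "t \<in> {0..1}" for t
        using B[OF that] by (intro onorm_le) (simp add: mult.commute[of B] mult_left_mono)
    qed (use that in auto)
    then show ?thesis using infnorm_le_norm[of "g t - g s"] by simp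
  qed
  moreover have "path g" using g(1) by (simp add: path_def continuous_on_polymonial_function)
  ultimately have "rectifiable_path g" by (intro rectifiable_if_Lipschitz)
  then show ?thesis using g unfolding curves_def by blast
qed

lemma d_metric_le:
  assumes "\<gamma> \<in> curves \<Omega> x y"
  shows "d_metric \<alpha> \<Omega> x y \<le> arc_length_integral (\<lambda>z. bd \<Omega> z powr (\<alpha> - 1)) \<gamma>"
  unfolding d_metric_eq
  by (rule cINF_lower[OF _ assms]) (auto intro!: bdd_belowI[of _ 0] arc_length_integral_nonneg)

lemma d_metric_nonneg:
  assumes "is_domain \<Omega>" "x \<in> \<Omega>" "y \<in> \<Omega>"
  shows "0 \<le> d_metric \<alpha> \<Omega> x y"
  unfolding d_metric_eq
  by (intro cINF_greatest curves_nonempty assms arc_length_integral_nonneg) auto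

lemma d_metric_less_obtain:
  assumes "is_domain \<Omega>" "x \<in> \<Omega>" "y \<in> \<Omega>" "d_metric \<alpha> \<Omega> x y < e"
  obtains \<gamma> where "\<gamma> \<in> curves \<Omega> x y" "arc_length_integral (\<lambda>z. bd \<Omega> z powr (\<alpha> - 1)) \<gamma> < e"
proof -
  have "\<exists>\<gamma>\<in>curves \<Omega> x y. arc_length_integral (\<lambda>z. bd \<Omega> z powr (\<alpha> - 1)) \<gamma> < e"
    using assms(4) unfolding d_metric_eq
    by (subst (asm) cINF_less_iff)
       (use curves_nonempty[OF assms(1-3)] in \<open>auto intro!: bdd_belowI[of _ 0] arc_length_integral_nonneg\<close>)
  then show ?thesis using that by blast
qed

lemma infnorm_le_rho:
  assumes "is_domain \<Omega>" "x \<in> \<Omega>" "y \<in> \<Omega>"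
  shows "infnorm (x - y) powr \<alpha> \<le> rho_metric \<alpha> \<Omega> x y"
  using d_metric_nonneg[OF assms] by (simp add: rho_metric_def)

lemma rho_metric_refl:
  assumes "is_domain \<Omega>" "x \<in> \<Omega>"
  shows "rho_metric \<alpha> \<Omega> x x = 0"
proof -
  have c: "linepath x x \<in> curves \<Omega> x x" using assms by (auto simp: curves_def linepath_length(1))
  have "arc_length_integral w (linepath x x) = 0" for w
    unfolding arc_length_integral_def using linepath_length(2)[of 1 x x] by (simp add: infnorm_0)
  then have "d_metric \<alpha> \<Omega> x x = 0" using d_metric_le[OF c, of \<alpha>] d_metric_nonneg[OF assms assms(2), of \<alpha>] by simp
  then show ?thesis by (simp add: rho_metric_def infnorm_0)
qed

section \<open>Points of the boundary of the completion\<close>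

lemma integral_le_const:
  fixes f :: "real \<Rightarrow> real"
  assumes "0 \<le> l" "\<And>u. u \<in> {0..l} \<Longrightarrow> f u \<le> c" "0 \<le> c"
  shows "integral {0..l} f \<le> c * l"
proof (cases "f integrable_on {0..l}")
  case True
  have "integral {0..l} f \<le> integral {0..l} (\<lambda>_. c)"
    by (rule integral_le[OF True]) (use assms in auto)
  then show ?thesis using assms(1) by (simp add: mult.commute)
next
  case False
  then show ?thesis using assms by (simp add: not_integrable_integral)
qed

lemma d_metric_interior_le:
  assumes dom: "is_domain \<Omega>" and \<alpha>: "\<alpha> \<le> 1" and x: "x \<in> \<Omega>"
    and y: "y \<in> cube x (bd \<Omega> x / 2)" "z \<in> cube x (bd \<Omega> x / 2)"
  shows "d_metric \<alpha> \<Omega> y z \<le> (bd \<Omega> x / 2) powr (\<alpha> - 1) * infnorm (z - y)"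
proof (cases "y = z")
  case True
  have b: "0 < bd \<Omega> x" by (rule bd_pos[OF dom x])
  have "y \<in> \<Omega>" using cube_bd_subset[OF dom x, of "bd \<Omega> x / 2"] y b by auto
  then show ?thesis using True rho_metric_refl[OF dom, of y \<alpha>] by (simp add: rho_metric_def infnorm_0)
next
  case False
  have b: "0 < bd \<Omega> x" by (rule bd_pos[OF dom x])
  let ?l = "infnorm (z - y)" and ?B = "bd \<Omega> x / 2"
  have l: "0 < ?l" using False by (simp add: infnorm_pos_lt)
  have seg: "y + s *\<^sub>R (z - y) \<in> cube x ?B" if "s \<in> {0..1}" for s
  proof -
    have "(1 - s) *\<^sub>R y + s *\<^sub>R z \<in> cube x ?B" using convexD_alt[OF convex_cube y] that by auto
    then show ?thesis by (simp add: algebra_simps)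
  qed
  have sub: "cube x ?B \<subseteq> \<Omega>" using b by (intro cube_bd_subset[OF dom x]) auto
  have "linepath y z \<in> curves \<Omega> y z"
  proof -
    have "linepath y z s = y + s *\<^sub>R (z - y)" for s by (simp add: linepath_def algebra_simps)
    then have "path_image (linepath y z) \<subseteq> \<Omega>" using seg sub by (auto simp: path_image_def simp del: path_image_linepath)
    then show ?thesis by (simp add: curves_def linepath_length(1) del: path_image_linepath)
  qed
  then have "d_metric \<alpha> \<Omega> y z \<le> integral {0..?l} (\<lambda>u. bd \<Omega> (y + (u / ?l) *\<^sub>R (z - y)) powr (\<alpha> - 1))"
    using d_metric_le[of "linepath y z" \<Omega> y z \<alpha>] linepath_integral[OF False] by simp
  also have "\<dots> \<le> ?B powr (\<alpha> - 1) * ?l"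
  proof (rule integral_le_const)
    fix u assume u: "u \<in> {0..?l}"
    then have "y + (u / ?l) *\<^sub>R (z - y) \<in> cube x ?B" using l by (intro seg) (auto simp: divide_le_eq)
    then have "?B \<le> bd \<Omega> (y + (u / ?l) *\<^sub>R (z - y))"
      using bd_Lipschitz[OF dom, of x "y + (u / ?l) *\<^sub>R (z - y)"] by (simp add: mem_cube infnorm_sub[of x])
    then show "bd \<Omega> (y + (u / ?l) *\<^sub>R (z - y)) powr (\<alpha> - 1) \<le> ?B powr (\<alpha> - 1)"
      using b \<alpha> by (intro powr_mono2') auto
  qed (use l in auto)
  finally show ?thesis .
qed

definition ray :: "real ^ 'n \<Rightarrow> real ^ 'n \<Rightarrow> real \<Rightarrow> real ^ 'n" where
  "ray a z s = a + s *\<^sub>R (z - a)"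

lemma ray_props:
  assumes dom: "is_domain \<Omega>" and z: "z \<in> \<Omega>" and a: "a \<in> frontier \<Omega>" "bd \<Omega> z = infnorm (z - a)"
    and s: "0 < s" "s \<le> 1"
  shows "ray a z s \<in> \<Omega>" "bd \<Omega> (ray a z s) = s * bd \<Omega> z" "infnorm (ray a z s - z) = (1 - s) * bd \<Omega> z"
proof -
  have "ray a z s - z = (1 - s) *\<^sub>R (a - z)" by (simp add: ray_def algebra_simps)
  then show 1: "infnorm (ray a z s - z) = (1 - s) * bd \<Omega> z"
    using s a(2) by (simp add: infnorm_mul infnorm_sub[of a])
  have "(1 - s) * bd \<Omega> z < bd \<Omega> z" using s bd_pos[OF dom z] by simp
  then have "ray a z s \<in> cube z (bd \<Omega> z)" using 1 by (simp add: mem_cube)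
  then show "ray a z s \<in> \<Omega>" using cube_bd_subset[OF dom z] by blast
  have "infnorm (ray a z s - a) = s * bd \<Omega> z" using s a(2) by (simp add: ray_def infnorm_mul)
  then have "bd \<Omega> (ray a z s) \<le> s * bd \<Omega> z" using bd_le[OF a(1), of "ray a z s"] by simp
  moreover have "bd \<Omega> z \<le> bd \<Omega> (ray a z s) + (1 - s) * bd \<Omega> z"
    using bd_Lipschitz[OF dom, of z "ray a z s"] 1 by (simp add: infnorm_sub[of z])
  ultimately show "bd \<Omega> (ray a z s) = s * bd \<Omega> z" by (simp add: algebra_simps)
qed

text \<open>Along the segment to a nearest boundary point the weight is a power of the distance to the
  end point; it is integrable as \<open>\<alpha> > 0\<close>.\<close>
lemma d_metric_ray_le:
  assumes dom: "is_domain \<Omega>" and \<alpha>: "0 < \<alpha>" "\<alpha> \<le> 1"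
    and z: "z \<in> \<Omega>" and a: "a \<in> frontier \<Omega>" "bd \<Omega> z = infnorm (z - a)"
    and s: "0 < s" "s \<le> 1" and t: "0 < t" "t \<le> 1"
  shows "d_metric \<alpha> \<Omega> (ray a z s) (ray a z t) \<le> (max s t * bd \<Omega> z) powr \<alpha> / \<alpha>"
proof (cases "s = t")
  case True
  then have "d_metric \<alpha> \<Omega> (ray a z s) (ray a z t) = 0"
    using rho_metric_refl[OF dom ray_props(1)[OF dom z a s], of \<alpha>] by (simp add: rho_metric_def infnorm_0)
  then show ?thesis using \<alpha> by simp
next
  case False
  define D where "D = bd \<Omega> z"
  have D: "0 < D" using bd_pos[OF dom z] by (simp add: D_def)
  define e where "e = sgn (t - s)"
  have e: "e * \<bar>t - s\<bar> = t - s" "\<bar>e\<bar> = 1" "e * e = 1" using False by (auto simp: e_def sgn_if)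
  define l where "l = \<bar>t - s\<bar> * D"
  have l: "0 < l" using False D by (simp add: l_def)
  have diff: "ray a z t - ray a z s = (t - s) *\<^sub>R (z - a)" by (simp add: ray_def algebra_simps)
  have il: "infnorm (ray a z t - ray a z s) = l" unfolding diff infnorm_mul l_def D_def a(2) by simp
  have ne: "ray a z s \<noteq> ray a z t" using il l infnorm_pos_lt[of "ray a z t - ray a z s"] by auto
  have pt: "ray a z s + (u / l) *\<^sub>R (ray a z t - ray a z s) = ray a z (s + (u / l) * (t - s))" for u
    unfolding diff by (simp add: ray_def scaleR_left_distrib)
  have rng: "min s t \<le> s + r * (t - s) \<and> s + r * (t - s) \<le> max s t" if "r \<in> {0..1}" for r
  proof -
    have r: "0 \<le> r" "r \<le> 1" using that by auto
    show ?thesis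
    proof (cases "s \<le> t")
      case True
      then have "0 \<le> r * (t - s)" "0 \<le> (1 - r) * (t - s)" using r by auto
      then show ?thesis using True by (auto simp: algebra_simps)
    next
      case False
      then have "0 \<le> r * (s - t)" "0 \<le> (1 - r) * (s - t)" using r by auto
      then show ?thesis using False by (auto simp: algebra_simps)
    qed
  qed
  have rr: "0 < s + r * (t - s)" "s + r * (t - s) \<le> 1" if "r \<in> {0..1}" for r
    using rng[OF that] s t by auto
  have in\<Omega>: "ray a z (s + r * (t - s)) \<in> \<Omega>" "bd \<Omega> (ray a z (s + r * (t - s))) = (s + r * (t - s)) * D" if "r \<in> {0..1}" for r
    using ray_props(1,2)[OF dom z a rr[OF that]] by (auto simp: D_def)
  have ul: "u / l \<in> {0..1}" if "u \<in> {0..l}" for u using that l by (auto simp: divide_le_eq)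
  have val: "(s + (u / l) * (t - s)) * D = s * D + e * u" for u
  proof -
    have "(t - s) * D = e * l" using e(1) by (simp add: l_def)
    then have "(u / l) * ((t - s) * D) = e * u" using l by simp
    then have "(s + (u / l) * (t - s)) * D = s * D + e * u" by (simp add: distrib_right mult.assoc)
    then show ?thesis .
  qed
  have "linepath (ray a z s) (ray a z t) \<in> curves \<Omega> (ray a z s) (ray a z t)"
  proof -
    have "linepath (ray a z s) (ray a z t) r = ray a z (s + r * (t - s))" for r
      by (simp add: linepath_def ray_def algebra_simps)
    then show ?thesis using in\<Omega>(1) by (auto simp: curves_def linepath_length(1) path_image_def)
  qed
  then have "d_metric \<alpha> \<Omega> (ray a z s) (ray a z t)
      \<le> integral {0..l} (\<lambda>u. bd \<Omega> (ray a z s + (u / l) *\<^sub>R (ray a z t - ray a z s)) powr (\<alpha> - 1))"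
    using d_metric_le[of "linepath (ray a z s) (ray a z t)" \<Omega> _ _ \<alpha>] linepath_integral[OF ne] il by simp
  also have "\<dots> = integral {0..l} (\<lambda>u. (s * D + e * u) powr (\<alpha> - 1))"
    unfolding pt by (rule Henstock_Kurzweil_Integration.integral_cong) (simp only: in\<Omega>(2)[OF ul] val)
  also have "\<dots> = e * (s * D + e * l) powr \<alpha> / \<alpha> - e * (s * D + e * 0) powr \<alpha> / \<alpha>"
  proof (rule integral_unique, rule fundamental_theorem_of_calculus)
    fix u assume u: "u \<in> {0..l}"
    have pos: "0 < s * D + e * u"
      unfolding val[symmetric] using rr(1)[OF ul[OF u]] D by simp
    have "((\<lambda>u. e * (s * D + e * u) powr \<alpha> / \<alpha>) has_real_derivative e * (\<alpha> * (s * D + e * u) powr (\<alpha> - 1) * e) / \<alpha>) (at u within {0..l})"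
      using pos by (auto intro!: derivative_eq_intros)
    moreover have "e * (\<alpha> * (s * D + e * u) powr (\<alpha> - 1) * e) / \<alpha> = (s * D + e * u) powr (\<alpha> - 1)"
    proof -
      have "e * (\<alpha> * (s * D + e * u) powr (\<alpha> - 1) * e) / \<alpha> = (e * e) * (s * D + e * u) powr (\<alpha> - 1)"
        using \<alpha> by simp
      then show ?thesis using e by simp
    qed
    ultimately show "((\<lambda>u. e * (s * D + e * u) powr \<alpha> / \<alpha>) has_vector_derivative (s * D + e * u) powr (\<alpha> - 1)) (at u within {0..l})"
      by (simp add: has_real_derivative_iff_has_vector_derivative)
  qed (use l in simp)
  also have "\<dots> \<le> (max s t * D) powr \<alpha> / \<alpha>"
  proof -
    have "e * l = (t - s) * D" unfolding l_def mult.assoc[symmetric] e(1) ..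
    then have el: "s * D + e * l = t * D" by (simp add: left_diff_distrib)
    have n: "0 \<le> (s * D) powr \<alpha> / \<alpha>" "0 \<le> (t * D) powr \<alpha> / \<alpha>" using \<alpha> by auto
    show ?thesis
    proof (cases "s \<le> t")
      case True
      then have "e = 1" using False by (simp add: e_def)
      then show ?thesis using True el n by (simp add: max_def)
    next
      case F: False
      then have "e = -1" by (simp add: e_def)
      then show ?thesis using F el n by (simp add: max_def)
    qed
  qed
  finally show ?thesis unfolding D_def .
qed

lemma rho_metric_ray_le:
  assumes dom: "is_domain \<Omega>" and \<alpha>: "0 < \<alpha>" "\<alpha> \<le> 1"
    and z: "z \<in> \<Omega>" and a: "a \<in> frontier \<Omega>" "bd \<Omega> z = infnorm (z - a)"
    and s: "0 < s" "s \<le> 1" and t: "0 < t" "t \<le> 1"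
  shows "rho_metric \<alpha> \<Omega> (ray a z s) (ray a z t) \<le> (1 / \<alpha> + 1) * (max s t * bd \<Omega> z) powr \<alpha>"
proof -
  have "infnorm (ray a z s - ray a z t) = \<bar>s - t\<bar> * bd \<Omega> z"
  proof -
    have "ray a z s - ray a z t = (s - t) *\<^sub>R (z - a)" by (simp add: ray_def algebra_simps)
    then show ?thesis using a(2) by (simp add: infnorm_mul)
  qed
  also have "\<dots> \<le> max s t * bd \<Omega> z"
    using s t bd_nonneg[OF dom, of z] by (intro mult_right_mono) auto
  finally have "infnorm (ray a z s - ray a z t) powr \<alpha> \<le> (max s t * bd \<Omega> z) powr \<alpha>"
    using \<alpha> by (intro powr_mono2) (auto simp: infnorm_pos_le)
  then show ?thesis using d_metric_ray_le[OF assms] by (simp add: rho_metric_def algebra_simps)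
qed

definition ray_seq :: "real ^ 'n \<Rightarrow> real ^ 'n \<Rightarrow> nat \<Rightarrow> real ^ 'n" where
  "ray_seq a z k = ray a z ((3 / 4) ^ k)"

lemma ratio_power: "0 < (3 / 4 :: real) ^ k" "(3 / 4 :: real) ^ k \<le> 1"
  by (auto intro: power_le_one)

lemma ray_seq_tendsto: "ray_seq a z \<longlonglongrightarrow> a"
proof -
  have "(\<lambda>k. a + (3 / 4 :: real) ^ k *\<^sub>R (z - a)) \<longlonglongrightarrow> a + 0 *\<^sub>R (z - a)"
    by (intro tendsto_intros LIMSEQ_power_zero) auto
  then show ?thesis by (simp add: ray_seq_def[abs_def] ray_def)
qed

lemma ray_seq_Cauchy:
  assumes dom: "is_domain \<Omega>" and \<alpha>: "0 < \<alpha>" "\<alpha> \<le> 1"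
    and z: "z \<in> \<Omega>" and a: "a \<in> frontier \<Omega>" "bd \<Omega> z = infnorm (z - a)"
  shows "ray_seq a z \<in> rho_Cauchy \<alpha> \<Omega>"
proof -
  have "\<exists>N. \<forall>i\<ge>N. \<forall>j\<ge>N. rho_metric \<alpha> \<Omega> (ray_seq a z i) (ray_seq a z j) < e" if e: "0 < e" for e
  proof -
    have "(\<lambda>k. (1 / \<alpha> + 1) * ((3 / 4) ^ k * bd \<Omega> z) powr \<alpha>) \<longlonglongrightarrow> (1 / \<alpha> + 1) * (0 * bd \<Omega> z) powr \<alpha>"
      using \<alpha> bd_nonneg[OF dom, of z] by (intro tendsto_intros tendsto_powr' LIMSEQ_power_zero) auto
    then have "(\<lambda>k. (1 / \<alpha> + 1) * ((3 / 4) ^ k * bd \<Omega> z) powr \<alpha>) \<longlonglongrightarrow> 0" using \<alpha> by simp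
    then have "eventually (\<lambda>k. (1 / \<alpha> + 1) * ((3 / 4) ^ k * bd \<Omega> z) powr \<alpha> < e) sequentially"
      using e by (auto dest: order_tendstoD(2))
    then obtain N where N: "(1 / \<alpha> + 1) * ((3 / 4) ^ N * bd \<Omega> z) powr \<alpha> < e"
      by (auto simp: eventually_sequentially)
    have "rho_metric \<alpha> \<Omega> (ray_seq a z i) (ray_seq a z j) < e" if ij: "N \<le> i" "N \<le> j" for i j
    proof -
      have m: "max ((3 / 4 :: real) ^ i) ((3 / 4) ^ j) \<le> (3 / 4) ^ N"
        using ij by (auto intro: power_decreasing)
      have "rho_metric \<alpha> \<Omega> (ray_seq a z i) (ray_seq a z j)
          \<le> (1 / \<alpha> + 1) * (max ((3 / 4) ^ i) ((3 / 4) ^ j) * bd \<Omega> z) powr \<alpha>"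
        unfolding ray_seq_def by (rule rho_metric_ray_le[OF dom \<alpha> z a ratio_power ratio_power])
      also have "\<dots> \<le> (1 / \<alpha> + 1) * ((3 / 4) ^ N * bd \<Omega> z) powr \<alpha>"
        using \<alpha> m bd_nonneg[OF dom, of z] by (intro mult_left_mono powr_mono2 mult_right_mono) (auto simp: le_max_iff_disj)
      finally show ?thesis using N by simp
    qed
    then show ?thesis by blast
  qed
  then show ?thesis
    using ray_props(1)[OF dom z a ratio_power] unfolding rho_Cauchy_def by (auto simp: ray_seq_def)
qed

lemma infnorm_less_rho:
  assumes dom: "is_domain \<Omega>" and \<alpha>: "0 < \<alpha>" and xy: "x \<in> \<Omega>" "y \<in> \<Omega>"
    and e: "0 < e" "rho_metric \<alpha> \<Omega> x y < e powr \<alpha>"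
  shows "infnorm (x - y) < e"
proof (rule ccontr)
  assume "\<not> infnorm (x - y) < e"
  then have "e powr \<alpha> \<le> infnorm (x - y) powr \<alpha>" using e \<alpha> by (intro powr_mono2) auto
  then show False using infnorm_le_rho[OF dom xy, of \<alpha>] e by simp
qed

lemma infnorm_tendsto_0_iff: "((\<lambda>i. infnorm (f i)) \<longlongrightarrow> 0) A \<longleftrightarrow> ((f :: _ \<Rightarrow> real ^ 'n) \<longlongrightarrow> 0) A"
proof
  have le: "norm (f i) \<le> sqrt (real CARD('n)) * infnorm (f i)" for i
    using norm_le_infnorm[of "f i"] by simp
  assume "((\<lambda>i. infnorm (f i)) \<longlongrightarrow> 0) A"
  then have "((\<lambda>i. sqrt (real CARD('n)) * infnorm (f i)) \<longlongrightarrow> 0) A" by (rule tendsto_mult_right_zero)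
  then show "(f \<longlongrightarrow> 0) A"
    by (rule Lim_null_comparison[rotated]) (simp add: le)
next
  assume "(f \<longlongrightarrow> 0) A"
  then show "((\<lambda>i. infnorm (f i)) \<longlongrightarrow> 0) A" using tendsto_infnorm infnorm_0 by metis
qed

lemma rho_tendsto_imp:
  assumes dom: "is_domain \<Omega>" and \<alpha>: "0 < \<alpha>" and xy: "\<And>i. x i \<in> \<Omega>" "\<And>i. y i \<in> \<Omega>"
    and lim: "(\<lambda>i. rho_metric \<alpha> \<Omega> (x i) (y i)) \<longlonglongrightarrow> 0"
  shows "(\<lambda>i. x i - y i) \<longlonglongrightarrow> 0"
proof -
  have "eventually (\<lambda>i. infnorm (x i - y i) < e) sequentially" if e: "0 < e" for e
  proof -
    have "eventually (\<lambda>i. rho_metric \<alpha> \<Omega> (x i) (y i) < e powr \<alpha>) sequentially"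
      using lim e by (intro order_tendstoD(2)) auto
    then show ?thesis by eventually_elim (rule infnorm_less_rho[OF dom \<alpha> xy e])
  qed
  then have "(\<lambda>i. infnorm (x i - y i)) \<longlonglongrightarrow> 0"
    by (intro order_tendstoI) (auto intro!: always_eventually less_le_trans[OF _ infnorm_pos_le])
  then show ?thesis by (simp add: infnorm_tendsto_0_iff)
qed

lemma rho_Cauchy_convergent:
  assumes dom: "is_domain \<Omega>" and \<alpha>: "0 < \<alpha>" and x: "x \<in> rho_Cauchy \<alpha> \<Omega>"
  shows "convergent x"
proof -
  have x\<Omega>: "x i \<in> \<Omega>" for i using x by (auto simp: rho_Cauchy_def)
  have "Cauchy x"
  proof (rule metric_CauchyI)
    fix e :: real assume e: "0 < e"
    define e' where "e' = e / sqrt (real CARD('a))"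
    have n0: "0 < sqrt (real CARD('a))" by simp
    have e': "0 < e'" using e n0 by (simp add: e'_def)
    then have "0 < e' powr \<alpha>" by simp
    then obtain N where N: "\<forall>i\<ge>N. \<forall>j\<ge>N. rho_metric \<alpha> \<Omega> (x i) (x j) < e' powr \<alpha>"
      using x unfolding rho_Cauchy_def by blast
    have "dist (x i) (x j) < e" if "N \<le> i" "N \<le> j" for i j
    proof -
      have "infnorm (x i - x j) < e'" using N that e' by (intro infnorm_less_rho[OF dom \<alpha> x\<Omega> x\<Omega>]) auto
      then have "sqrt (real CARD('a)) * infnorm (x i - x j) < sqrt (real CARD('a)) * e'"
        using n0 by (rule mult_strict_left_mono)
      moreover have "sqrt (real CARD('a)) * e' = e" using n0 by (simp add: e'_def)
      ultimately show ?thesis using norm_le_infnorm[of "x i - x j"] by (simp add: dist_norm)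
    qed
    then show "\<exists>M. \<forall>m\<ge>M. \<forall>n\<ge>M. dist (x m) (x n) < e" by blast
  qed
  then show ?thesis by (rule Cauchy_convergent)
qed

text \<open>Near a point of \<open>\<Omega>\<close> the weight is bounded on segments, so the norm controls the metric.\<close>
lemma rho_tendsto_interior:
  assumes dom: "is_domain \<Omega>" and \<alpha>: "0 < \<alpha>" "\<alpha> \<le> 1" and x: "x \<in> \<Omega>"
    and y: "(y \<longlongrightarrow> x) A" and z: "(z \<longlongrightarrow> x) A"
  shows "((\<lambda>i. rho_metric \<alpha> \<Omega> (y i) (z i)) \<longlongrightarrow> 0) A"
proof -
  define B where "B = bd \<Omega> x / 2"
  have B: "0 < B" using bd_pos[OF dom x] by (simp add: B_def)
  have ev: "eventually (\<lambda>i. w i \<in> cube x B) A" if "(w \<longlongrightarrow> x) A" for w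
    using that by (rule topological_tendstoD) (use B in \<open>auto simp: open_cube mem_cube infnorm_0\<close>)
  have yz: "((\<lambda>i. z i - y i) \<longlongrightarrow> 0) A" using tendsto_diff[OF z y] by simp
  then have iz: "((\<lambda>i. infnorm (z i - y i)) \<longlongrightarrow> 0) A" by (simp add: infnorm_tendsto_0_iff)
  have "((\<lambda>i. B powr (\<alpha> - 1) * infnorm (z i - y i) + infnorm (z i - y i) powr \<alpha>) \<longlongrightarrow> B powr (\<alpha> - 1) * 0 + 0 powr \<alpha>) A"
    using \<alpha> by (intro tendsto_intros tendsto_powr' iz) (auto simp: infnorm_pos_le)
  then have "((\<lambda>i. B powr (\<alpha> - 1) * infnorm (z i - y i) + infnorm (z i - y i) powr \<alpha>) \<longlongrightarrow> 0) A" using \<alpha> by simp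
  moreover have "eventually (\<lambda>i. norm (rho_metric \<alpha> \<Omega> (y i) (z i)) \<le> B powr (\<alpha> - 1) * infnorm (z i - y i) + infnorm (z i - y i) powr \<alpha>) A"
    using ev[OF y] ev[OF z]
  proof eventually_elim
    case (elim i)
    have "cube x B \<subseteq> \<Omega>" using B by (intro cube_bd_subset[OF dom x]) (auto simp: B_def)
    then have "0 \<le> rho_metric \<alpha> \<Omega> (y i) (z i)"
      using infnorm_le_rho[OF dom, of "y i" "z i" \<alpha>] elim by (meson order_trans powr_ge_zero subsetD)
    then show ?case
      using d_metric_interior_le[OF dom \<alpha>(2) x, of "y i" "z i"] elim
      by (simp add: rho_metric_def B_def infnorm_sub[of "y i"])
  qed
  ultimately show ?thesis by (rule Lim_null_comparison[rotated])
qed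

lemma rho_equiv_iff:
  "y \<in> rho_equiv \<alpha> \<Omega> `` {x} \<longleftrightarrow> x \<in> rho_Cauchy \<alpha> \<Omega> \<and> y \<in> rho_Cauchy \<alpha> \<Omega> \<and>
    (\<lambda>i. rho_metric \<alpha> \<Omega> (x i) (y i)) \<longlonglongrightarrow> 0"
  by (auto simp: rho_equiv_def)

text \<open>The sequence converges to \<open>a\<close>, which is not in \<open>\<Omega>\<close>, while a sequence equivalent to a constant one
  converges to the constant.\<close>
lemma ray_class_boundary:
  assumes dom: "is_domain \<Omega>" and \<alpha>: "0 < \<alpha>" "\<alpha> \<le> 1"
    and z: "z \<in> \<Omega>" and a: "a \<in> frontier \<Omega>" "bd \<Omega> z = infnorm (z - a)"
  shows "rho_equiv \<alpha> \<Omega> `` {ray_seq a z} \<in> alpha_boundary \<alpha> \<Omega>" and "ray_seq a z \<in> rho_equiv \<alpha> \<Omega> `` {ray_seq a z}"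
proof -
  have C: "ray_seq a z \<in> rho_Cauchy \<alpha> \<Omega>" by (rule ray_seq_Cauchy[OF assms])
  then have r\<Omega>: "ray_seq a z i \<in> \<Omega>" for i by (auto simp: rho_Cauchy_def)
  show mem: "ray_seq a z \<in> rho_equiv \<alpha> \<Omega> `` {ray_seq a z}"
    unfolding rho_equiv_iff using C rho_metric_refl[OF dom r\<Omega>] by simp
  have "rho_equiv \<alpha> \<Omega> `` {ray_seq a z} \<noteq> rho_equiv \<alpha> \<Omega> `` {\<lambda>_. x}" if x: "x \<in> \<Omega>" for x
  proof
    assume "rho_equiv \<alpha> \<Omega> `` {ray_seq a z} = rho_equiv \<alpha> \<Omega> `` {\<lambda>_. x}"
    then have "ray_seq a z \<in> rho_equiv \<alpha> \<Omega> `` {\<lambda>_. x}" using mem by simp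
    then have "(\<lambda>i. rho_metric \<alpha> \<Omega> x (ray_seq a z i)) \<longlonglongrightarrow> 0" by (simp only: rho_equiv_iff)
    then have "(\<lambda>i. x - ray_seq a z i) \<longlonglongrightarrow> 0"
      by (intro rho_tendsto_imp[OF dom \<alpha>(1)] x r\<Omega>)
    moreover have "(\<lambda>i. x - ray_seq a z i) \<longlonglongrightarrow> x - a" by (intro tendsto_intros ray_seq_tendsto)
    ultimately have "x = a" using LIMSEQ_unique by fastforce
    then show False using frontier_notin[OF dom a(1)] x by simp
  qed
  then show "rho_equiv \<alpha> \<Omega> `` {ray_seq a z} \<in> alpha_boundary \<alpha> \<Omega>"
    unfolding alpha_boundary_def rho_completion_def using C by (auto intro: quotientI)
qed

lemma alpha_boundary_class:
  assumes "\<omega> \<in> alpha_boundary \<alpha> \<Omega>"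
  obtains x where "x \<in> rho_Cauchy \<alpha> \<Omega>" "\<omega> = rho_equiv \<alpha> \<Omega> `` {x}"
  using assms unfolding alpha_boundary_def rho_completion_def quotient_def by blast

text \<open>All representatives of \<open>\<omega>\<close> converge in norm to a common limit in the closure of \<open>\<Omega>\<close>. Were it a
  point of \<open>\<Omega>\<close>, then \<open>\<omega>\<close> would be the class of the corresponding constant sequence.\<close>
lemma alpha_boundary_bd_tendsto_0:
  assumes dom: "is_domain \<Omega>" and \<alpha>: "0 < \<alpha>" "\<alpha> \<le> 1"
    and \<omega>: "\<omega> \<in> alpha_boundary \<alpha> \<Omega>" and y: "y \<in> \<omega>"
  shows "(\<lambda>i. bd \<Omega> (y i)) \<longlonglongrightarrow> 0"
proof -
  obtain x where x: "x \<in> rho_Cauchy \<alpha> \<Omega>" and \<omega>x: "\<omega> = rho_equiv \<alpha> \<Omega> `` {x}"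
    by (rule alpha_boundary_class[OF \<omega>]) (rule that)
  have x\<Omega>: "x i \<in> \<Omega>" for i using x by (auto simp: rho_Cauchy_def)
  have seq\<Omega>: "w i \<in> \<Omega>" if "w \<in> \<omega>" for w i using that unfolding \<omega>x rho_equiv_iff by (auto simp: rho_Cauchy_def)
  obtain a where a: "x \<longlonglongrightarrow> a" using rho_Cauchy_convergent[OF dom \<alpha>(1) x] by (auto simp: convergent_def)
  have toa: "w \<longlonglongrightarrow> a" if w: "w \<in> \<omega>" for w
  proof -
    have "(\<lambda>i. x i - w i) \<longlonglongrightarrow> 0"
      using w unfolding \<omega>x rho_equiv_iff by (intro rho_tendsto_imp[OF dom \<alpha>(1) x\<Omega> seq\<Omega>[OF w]]) auto
    from tendsto_diff[OF a this] show ?thesis by simp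
  qed
  have "a \<notin> \<Omega>"
  proof
    assume a\<Omega>: "a \<in> \<Omega>"
    have cC: "(\<lambda>_. a) \<in> rho_Cauchy \<alpha> \<Omega>"
      using a\<Omega> rho_metric_refl[OF dom a\<Omega>] by (auto simp: rho_Cauchy_def)
    have "w \<in> \<omega> \<longleftrightarrow> w \<in> rho_equiv \<alpha> \<Omega> `` {\<lambda>_. a}" for w
    proof
      assume w: "w \<in> \<omega>"
      then have "w \<in> rho_Cauchy \<alpha> \<Omega>" unfolding \<omega>x rho_equiv_iff by blast
      then show "w \<in> rho_equiv \<alpha> \<Omega> `` {\<lambda>_. a}"
        unfolding rho_equiv_iff using cC rho_tendsto_interior[OF dom \<alpha> a\<Omega> tendsto_const toa[OF w]] by blast
    next
      assume w: "w \<in> rho_equiv \<alpha> \<Omega> `` {\<lambda>_. a}"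
      then have wC: "w \<in> rho_Cauchy \<alpha> \<Omega>" and wl: "(\<lambda>i. rho_metric \<alpha> \<Omega> a (w i)) \<longlonglongrightarrow> 0"
        unfolding rho_equiv_iff by blast+
      have w\<Omega>: "w i \<in> \<Omega>" for i using wC by (auto simp: rho_Cauchy_def)
      have "(\<lambda>i. a - w i) \<longlonglongrightarrow> 0" by (rule rho_tendsto_imp[OF dom \<alpha>(1) a\<Omega> w\<Omega> wl])
      from tendsto_diff[OF tendsto_const[of a] this] have "w \<longlonglongrightarrow> a" by simp
      then show "w \<in> \<omega>"
        unfolding \<omega>x rho_equiv_iff using x wC rho_tendsto_interior[OF dom \<alpha> a\<Omega> a] by blast
    qed
    then have "\<omega> = rho_equiv \<alpha> \<Omega> `` {\<lambda>_. a}" by blast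
    then show False using \<omega> a\<Omega> unfolding alpha_boundary_def by blast
  qed
  moreover have "a \<in> closure \<Omega>" using a x\<Omega> closure_sequential by blast
  ultimately have af: "a \<in> frontier \<Omega>"
    using dom by (simp add: frontier_def is_domain_def interior_open)
  have "(\<lambda>i. y i - a) \<longlonglongrightarrow> 0" using tendsto_diff[OF toa[OF y] tendsto_const[of a]] by simp
  then have "(\<lambda>i. infnorm (y i - a)) \<longlonglongrightarrow> 0" by (simp add: infnorm_tendsto_0_iff)
  then show ?thesis
    by (rule Lim_null_comparison[rotated])
       (use bd_le[OF af] bd_nonneg[OF dom] in \<open>auto intro!: always_eventually\<close>)
qed

section \<open>Uniform continuity with respect to the metric\<close>

text \<open>The left-hand side is the integral of the number of sets \<open>A i\<close> that contain a given point.\<close>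
lemma nn_integral_overlap_le:
  assumes I: "countable I" and A: "\<And>i. i \<in> I \<Longrightarrow> A i \<in> sets M"
    and N: "\<And>y. y \<in> space M \<Longrightarrow> finite {i \<in> I. y \<in> A i} \<and> real (card {i \<in> I. y \<in> A i}) \<le> N"
  shows "(\<integral>\<^sup>+i. emeasure M (A i) \<partial>count_space I) \<le> ennreal N * emeasure M (space M)"
proof -
  have "(\<integral>\<^sup>+i. emeasure M (A i) \<partial>count_space I) = (\<integral>\<^sup>+i. (\<integral>\<^sup>+y. indicator (A i) y \<partial>M) \<partial>count_space I)"
    using A by (intro nn_integral_cong) simp
  also have "\<dots> = (\<integral>\<^sup>+y. (\<integral>\<^sup>+i. indicator (A i) y \<partial>count_space I) \<partial>M)"
    using A by (intro nn_integral_count_space_nn_integral[symmetric] I) auto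
  also have "\<dots> \<le> (\<integral>\<^sup>+y. ennreal N \<partial>M)"
  proof (rule nn_integral_mono)
    fix y assume y: "y \<in> space M"
    have "(\<integral>\<^sup>+i. indicator (A i) y \<partial>count_space I) = (\<integral>\<^sup>+i. indicator {i \<in> I. y \<in> A i} i \<partial>count_space I)"
      by (intro nn_integral_cong) (auto simp: indicator_def)
    also have "\<dots> = emeasure (count_space I) {i \<in> I. y \<in> A i}" by (intro nn_integral_indicator) auto
    also have "\<dots> = ennreal (real (card {i \<in> I. y \<in> A i}))"
      using N[OF y] by (subst emeasure_count_space_finite) (auto simp: ennreal_of_nat_eq_real_of_nat)
    also have "\<dots> \<le> ennreal N" using N[OF y] by (intro ennreal_leI) auto
    finally show "(\<integral>\<^sup>+i. indicator (A i) y \<partial>count_space I) \<le> ennreal N" .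
  qed
  finally show ?thesis by simp
qed

lemma sum_overlap_le:
  assumes fin: "finite_measure M" and I: "finite I" and A: "\<And>i. i \<in> I \<Longrightarrow> A i \<in> sets M"
    and N: "\<And>y. y \<in> space M \<Longrightarrow> real (card {i \<in> I. y \<in> A i}) \<le> N" and N0: "0 \<le> N"
  shows "(\<Sum>i\<in>I. measure M (A i)) \<le> N * measure M (space M)"
proof -
  interpret finite_measure M by (rule fin)
  have "(\<integral>\<^sup>+i. emeasure M (A i) \<partial>count_space I) \<le> ennreal N * emeasure M (space M)"
    using I A N by (intro nn_integral_overlap_le) (auto simp: countable_finite)
  also have "(\<integral>\<^sup>+i. emeasure M (A i) \<partial>count_space I) = ennreal (\<Sum>i\<in>I. measure M (A i))"
    using I by (simp add: nn_integral_count_space_finite emeasure_eq_measure)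
  also have "ennreal N * emeasure M (space M) = ennreal (N * measure M (space M))"
    using N0 by (simp add: emeasure_eq_measure ennreal_mult)
  finally show ?thesis by (subst (asm) ennreal_le_iff) (use N0 in auto)
qed

text \<open>Each vertex is the last point of the curve at distance at most \<open>r\<close> from the preceding vertex.
  Hence all later vertices are at least at this distance, which bounds the overlap of
  neighbourhoods of the vertices even if the curve returns to the same place many times.\<close>
lemma greedy_chain:
  fixes \<sigma> :: "real \<Rightarrow> real ^ 'n" and r :: "real ^ 'n \<Rightarrow> real"
  assumes L: "0 \<le> L" and Lip: "\<And>u v. u \<in> {0..L} \<Longrightarrow> v \<in> {0..L} \<Longrightarrow> infnorm (\<sigma> u - \<sigma> v) \<le> \<bar>u - v\<bar>"
    and cont: "continuous_on {0..L} \<sigma>" and d0: "0 < d0" "\<And>u. u \<in> {0..L} \<Longrightarrow> d0 \<le> r (\<sigma> u)"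
  obtains N u where "u 0 = 0" "u N = L" "\<And>k. u k \<in> {0..L}" "\<And>k. u k \<le> u (Suc k)"
    "\<And>k. infnorm (\<sigma> (u (Suc k)) - \<sigma> (u k)) \<le> r (\<sigma> (u k))"
    "\<And>k. Suc k < N \<Longrightarrow> u k + r (\<sigma> (u k)) \<le> u (Suc k)"
    "\<And>j k. j < k \<Longrightarrow> k < N \<Longrightarrow> r (\<sigma> (u j)) \<le> infnorm (\<sigma> (u k) - \<sigma> (u j))"
proof -
  define T where "T u = {v \<in> {u..L}. infnorm (\<sigma> v - \<sigma> u) \<le> r (\<sigma> u)}" for u
  define nxt where "nxt u = Sup (T u)" for u
  have nxt: "nxt u \<in> T u" "\<And>v. v \<in> {u..L} \<Longrightarrow> nxt u < v \<Longrightarrow> r (\<sigma> u) < infnorm (\<sigma> v - \<sigma> u)"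
    if u: "u \<in> {0..L}" for u
  proof -
    have "continuous_on {u..L} (\<lambda>v. infnorm (\<sigma> v - \<sigma> u))"
      using u by (intro continuous_on_infnorm continuous_on_diff continuous_on_const continuous_on_subset[OF cont]) auto
    then have "closed ({u..L} \<inter> (\<lambda>v. infnorm (\<sigma> v - \<sigma> u)) -` {..r (\<sigma> u)})"
      by (intro continuous_closed_preimage) auto
    moreover have "T u = {u..L} \<inter> (\<lambda>v. infnorm (\<sigma> v - \<sigma> u)) -` {..r (\<sigma> u)}" by (auto simp: T_def)
    ultimately have cl: "closed (T u)" by simp
    have "0 \<le> r (\<sigma> u)" using d0(1) d0(2)[OF u] by linarith
    then have ne: "u \<in> T u" using u by (simp add: T_def infnorm_0)
    have bd: "bdd_above (T u)" by (rule bdd_aboveI[of _ L]) (auto simp: T_def)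
    show "nxt u \<in> T u" unfolding nxt_def using ne bd cl by (intro closed_contains_Sup) auto
    show "r (\<sigma> u) < infnorm (\<sigma> v - \<sigma> u)" if v: "v \<in> {u..L}" "nxt u < v" for v
    proof (rule ccontr)
      assume "\<not> r (\<sigma> u) < infnorm (\<sigma> v - \<sigma> u)"
      then have "v \<in> T u" using v by (simp add: T_def)
      then have "v \<le> nxt u" unfolding nxt_def using bd by (rule cSup_upper)
      then show False using v by simp
    qed
  qed
  have nxt_rng: "nxt u \<in> {u..L}" "infnorm (\<sigma> (nxt u) - \<sigma> u) \<le> r (\<sigma> u)" if "u \<in> {0..L}" for u
    using nxt(1)[OF that] by (auto simp: T_def)
  have adv: "u + r (\<sigma> u) \<le> nxt u" if u: "u \<in> {0..L}" and lt: "nxt u < L" for u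
  proof (rule ccontr)
    assume "\<not> u + r (\<sigma> u) \<le> nxt u"
    define v where "v = min L (u + r (\<sigma> u))"
    have v: "v \<in> {u..L}" "nxt u < v" using \<open>\<not> _\<close> lt u d0(1) d0(2)[OF u] by (auto simp: v_def)
    have "infnorm (\<sigma> v - \<sigma> u) \<le> \<bar>v - u\<bar>" using v u by (intro Lip) auto
    also have "\<dots> \<le> r (\<sigma> u)" using v by (auto simp: v_def)
    finally show False using nxt(2)[OF u v] by simp
  qed
  have exact: "r (\<sigma> u) \<le> infnorm (\<sigma> (nxt u) - \<sigma> u)" if u: "u \<in> {0..L}" and lt: "nxt u < L" for u
  proof (rule ccontr)
    assume *: "\<not> r (\<sigma> u) \<le> infnorm (\<sigma> (nxt u) - \<sigma> u)"
    define v where "v = min L (nxt u + (r (\<sigma> u) - infnorm (\<sigma> (nxt u) - \<sigma> u)))"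
    have v: "v \<in> {u..L}" "nxt u < v" using * lt nxt_rng(1)[OF u] by (auto simp: v_def)
    have "infnorm (\<sigma> v - \<sigma> u) \<le> infnorm (\<sigma> v - \<sigma> (nxt u)) + infnorm (\<sigma> (nxt u) - \<sigma> u)"
      by (rule infnorm_diff_triangle)
    also have "infnorm (\<sigma> v - \<sigma> (nxt u)) \<le> \<bar>v - nxt u\<bar>"
      using v u nxt_rng(1)[OF u] by (intro Lip) auto
    also have "\<bar>v - nxt u\<bar> + infnorm (\<sigma> (nxt u) - \<sigma> u) \<le> r (\<sigma> u)"
      using v(2) by (auto simp: v_def)
    finally show False using nxt(2)[OF u v] by simp
  qed
  define w where "w k = (nxt ^^ k) 0" for k
  have w: "w k \<in> {0..L}" for k
  proof (induction k)
    case 0 then show ?case using L by (simp add: w_def)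
  next
    case (Suc k)
    then have "nxt (w k) \<in> {w k..L}" by (rule nxt_rng(1))
    then show ?case using Suc by (simp add: w_def)
  qed
  have wS: "w (Suc k) = nxt (w k)" for k by (simp add: w_def)
  have mono: "w k \<le> w (Suc k)" for k using nxt_rng(1)[OF w[of k]] by (simp add: wS)
  have mono': "w j \<le> w k" if "j \<le> k" for j k using lift_Suc_mono_le[of w, OF mono that] .
  have grow: "real k * d0 \<le> w k \<or> w k = L" for k
  proof (induction k)
    case 0 then show ?case by (simp add: w_def)
  next
    case (Suc k)
    show ?case
    proof (cases "w (Suc k) = L")
      case False
      then have lt: "w (Suc k) < L" using w[of "Suc k"] by auto
      then have "w k \<noteq> L" using mono[of k] by auto
      then have "real k * d0 \<le> w k" using Suc by blast
      moreover have "w k + r (\<sigma> (w k)) \<le> w (Suc k)" using adv[OF w] lt by (simp add: wS)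
      ultimately show ?thesis using d0(2)[OF w[of k]] by (simp add: algebra_simps)
    qed simp
  qed
  have "\<exists>k. w k = L"
  proof -
    obtain k where "L < real k * d0" using ex_less_of_nat_mult[OF d0(1)] by blast
    then show ?thesis using grow[of k] w[of k] by auto
  qed
  define N where "N = (LEAST k. w k = L)"
  have wN: "w N = L" unfolding N_def using \<open>\<exists>k. w k = L\<close> by (rule LeastI_ex)
  have lt: "w k < L" if "k < N" for k
    using not_less_Least[of k "\<lambda>k. w k = L"] that w[of k] unfolding N_def by force
  show ?thesis
  proof (rule that[of w N])
    show "w 0 = 0" by (simp add: w_def)
    show "infnorm (\<sigma> (w (Suc k)) - \<sigma> (w k)) \<le> r (\<sigma> (w k))" for k using nxt_rng(2)[OF w] by (simp add: wS)
    show "w k + r (\<sigma> (w k)) \<le> w (Suc k)" if "Suc k < N" for k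
      using adv[OF w[of k]] lt[OF that] by (simp add: wS)
    show "r (\<sigma> (w j)) \<le> infnorm (\<sigma> (w k) - \<sigma> (w j))" if jk: "j < k" "k < N" for j k
    proof -
      have ltj: "nxt (w j) < L" using lt[of "Suc j"] jk by (simp add: wS)
      have le: "nxt (w j) \<le> w k" using mono'[of "Suc j" k] jk by (simp add: wS)
      show ?thesis
      proof (cases "nxt (w j) = w k")
        case True then show ?thesis using exact[OF w ltj] by simp
      next
        case False
        then have "nxt (w j) < w k" using le by simp
        moreover have "w k \<in> {w j..L}" using mono'[of j k] jk w[of k] by auto
        ultimately show ?thesis using nxt(2)[OF w] by (simp add: less_imp_le)
      qed
    qed
  qed (use wN w mono in auto)
qed

text \<open>The base is \<open>2 R / d + 2\<close> of the packing lemma for \<open>R = 2 D\<close> and \<open>d = D / 24\<close>.\<close>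
definition overlap_bound :: "'n::finite itself \<Rightarrow> real" where
  "overlap_bound _ = 98 ^ CARD('n)"

lemma overlap_bound_pos: "0 < overlap_bound TYPE('n::finite)" "1 \<le> overlap_bound TYPE('n)"
  by (auto simp: overlap_bound_def)

lemma card_separated_le:
  fixes P :: "(real ^ 'n) set"
  assumes D: "0 < D" and near: "\<And>z. z \<in> P \<Longrightarrow> infnorm (z - y) \<le> 2 * D"
    and sep: "\<And>z w. z \<in> P \<Longrightarrow> w \<in> P \<Longrightarrow> z \<noteq> w \<Longrightarrow> D / 24 \<le> infnorm (z - w)"
  shows "finite P" "real (card P) \<le> overlap_bound TYPE('n)"
proof -
  have d: "0 < D / 24" using D by simp
  show "finite P" by (rule packing(1)[OF d near sep])
  have "real (card P) \<le> (2 * (2 * D) / (D / 24) + 2) ^ CARD('n)"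
    by (rule packing(2)[OF d near sep]) (use D in auto)
  also have "2 * (2 * D) / (D / 24) + 2 = 98" using D by (simp add: field_simps)
  finally show "real (card P) \<le> overlap_bound TYPE('n)" by (simp add: overlap_bound_def)
qed

text \<open>From here on a Sobolev function enters only through the Morrey inequality with respect to some
  finite measure and, in the final estimate, through its \<open>L\<^sub>p\<close> norm.\<close>
locale morrey_function =
  fixes p :: real and \<Omega> :: "(real ^ 'n) set" and F :: "real ^ 'n \<Rightarrow> real" and \<mu> :: "(real ^ 'n) measure" and C :: real
  assumes dom: "is_domain \<Omega>" and p: "real CARD('n) < p" and fin: "finite_measure \<mu>" and space: "space \<mu> = \<Omega>"
    and cube_sets: "\<And>c r. cube c r \<subseteq> \<Omega> \<Longrightarrow> cube c r \<in> sets \<mu>" and C: "0 < C"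
    and morrey: "\<And>c r x y. cube c r \<subseteq> \<Omega> \<Longrightarrow> 0 < r \<Longrightarrow> infnorm (x - c) \<le> r / 2 \<Longrightarrow> infnorm (y - c) \<le> r / 2
      \<Longrightarrow> \<bar>F x - F y\<bar> powr p \<le> C * r powr (p - real CARD('n)) * measure \<mu> (cube c r)"
begin

definition "\<alpha> = (p - real CARD('n)) / (p - 1)"

lemma p1: "1 < p"
  using p by (metis One_nat_def Suc_leI le_less_trans of_nat_1 of_nat_le_iff zero_less_card_finite)

lemma \<alpha>: "0 < \<alpha>" "\<alpha> \<le> 1"
  unfolding \<alpha>_def using p p1 by (auto simp: Suc_leI)

lemma bdp: "z \<in> \<Omega> \<Longrightarrow> 0 < bd \<Omega> z"
  by (rule bd_pos[OF dom])

lemma cube_sub: "z \<in> \<Omega> \<Longrightarrow> r \<le> bd \<Omega> z \<Longrightarrow> cube z r \<subseteq> \<Omega>"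
  by (rule cube_bd_subset[OF dom])

lemma measure_le: "measure \<mu> A \<le> measure \<mu> \<Omega>"
proof -
  interpret finite_measure \<mu> by (rule fin)
  show ?thesis using bounded_measure[of A] space by simp
qed

abbreviation "half_cube z \<equiv> cube z (bd \<Omega> z / 2)"

lemma half_cube: "z \<in> \<Omega> \<Longrightarrow> half_cube z \<subseteq> \<Omega>" "z \<in> \<Omega> \<Longrightarrow> half_cube z \<in> sets \<mu>"
  using cube_sub[of z "bd \<Omega> z / 2"] bdp[of z] cube_sets by auto

lemma morrey_half:
  assumes z: "z \<in> \<Omega>" and x: "infnorm (x - z) \<le> bd \<Omega> z / 4"
  shows "\<bar>F x - F z\<bar> powr p \<le> C * bd \<Omega> z powr (p - real CARD('n)) * measure \<mu> (half_cube z)"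
proof -
  have "\<bar>F x - F z\<bar> powr p \<le> C * (bd \<Omega> z / 2) powr (p - real CARD('n)) * measure \<mu> (half_cube z)"
    using bdp[OF z] x by (intro morrey half_cube z) (auto simp: infnorm_0)
  also have "\<dots> \<le> C * bd \<Omega> z powr (p - real CARD('n)) * measure \<mu> (half_cube z)"
    using bdp[OF z] C p by (intro mult_right_mono mult_left_mono powr_mono2) auto
  finally show ?thesis .
qed

lemma bd_in_half_cube:
  assumes "y \<in> half_cube z"
  shows "bd \<Omega> z / 2 < bd \<Omega> y" "bd \<Omega> y < 3 / 2 * bd \<Omega> z"
  using assms bd_Lipschitz[OF dom, of z y] bd_Lipschitz[OF dom, of y z]
  by (auto simp: mem_cube infnorm_sub[of z])

text \<open>If the end points are close compared to their distance to the boundary, the Morrey inequality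
  applies directly. Otherwise it is summed along a greedy chain of vertices. At a vertex at distance
  \<open>\<delta>\<close> from the boundary it bounds the \<open>p\<close>-th power of the increment by a multiple of \<open>\<delta>\<^sup>p\<^sup>-\<^sup>n\<close> times the
  energy of a cube, while the piece of the curve up to the next vertex contributes at least a
  multiple of \<open>\<delta>\<^sup>\<alpha>\<close> to the weighted length. The cubes overlap boundedly, so their energies add up to a multiple of the total energy.\<close>
lemma curve_estimate:
  assumes x: "x \<in> \<Omega>" and y: "y \<in> \<Omega>" and \<gamma>: "\<gamma> \<in> curves \<Omega> x y"
  defines "I \<equiv> arc_length_integral (\<lambda>z. bd \<Omega> z powr (\<alpha> - 1)) \<gamma>"
  shows "\<bar>F x - F y\<bar> powr p \<le> C * measure \<mu> \<Omega> *
    (2 powr (p - real CARD('n)) * infnorm (x - y) powr (p - real CARD('n)) + overlap_bound TYPE('n) * (32 * I) powr (p - 1))"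
proof -
  interpret \<gamma>: rectifiable \<gamma> using \<gamma> by unfold_locales (simp add: curves_def)
  let ?N0 = "overlap_bound TYPE('n)" and ?V = "measure \<mu> \<Omega>"
  let ?\<sigma> = "arc_length_param \<gamma>"
  define L where "L = arc_length \<gamma> 1"
  have L: "0 \<le> L" unfolding L_def by (rule \<gamma>.len_nonneg) auto
  have \<sigma>\<Omega>: "?\<sigma> u \<in> \<Omega>" if "u \<in> {0..L}" for u
    using \<gamma>.param_image that \<gamma> unfolding L_def curves_def by auto
  have cont: "continuous_on {0..L} ?\<sigma>" unfolding L_def by (rule \<gamma>.param_continuous)
  have ends: "?\<sigma> 0 = x" "?\<sigma> L = y" using \<gamma>.param_ends \<gamma> unfolding L_def curves_def by auto
  have cbd: "continuous_on {0..L} (\<lambda>u. bd \<Omega> (?\<sigma> u))"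
    by (rule continuous_on_compose2[OF continuous_on_bd[OF dom, of UNIV] cont]) auto
  obtain d0 where d0: "0 < d0" "\<And>u. u \<in> {0..L} \<Longrightarrow> d0 \<le> bd \<Omega> (?\<sigma> u) / 16"
  proof -
    obtain u0 where u0: "u0 \<in> {0..L}" "\<And>u. u \<in> {0..L} \<Longrightarrow> bd \<Omega> (?\<sigma> u0) \<le> bd \<Omega> (?\<sigma> u)"
      using continuous_attains_inf[OF _ _ cbd] L by auto
    show ?thesis by (rule that[of "bd \<Omega> (?\<sigma> u0) / 16"]) (use u0 bdp[OF \<sigma>\<Omega>[OF u0(1)]] in auto)
  qed
  obtain N u where u0: "u 0 = 0" and uN: "u N = L" and ur: "\<And>k. u k \<in> {0..L}" and um: "\<And>k. u k \<le> u (Suc k)"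
    and us: "\<And>k. infnorm (?\<sigma> (u (Suc k)) - ?\<sigma> (u k)) \<le> bd \<Omega> (?\<sigma> (u k)) / 16"
    and ua: "\<And>k. Suc k < N \<Longrightarrow> u k + bd \<Omega> (?\<sigma> (u k)) / 16 \<le> u (Suc k)"
    and sep: "\<And>j k. j < k \<Longrightarrow> k < N \<Longrightarrow> bd \<Omega> (?\<sigma> (u j)) / 16 \<le> infnorm (?\<sigma> (u k) - ?\<sigma> (u j))"
    by (rule greedy_chain[where \<sigma> = ?\<sigma> and r = "\<lambda>z. bd \<Omega> z / 16", OF L \<gamma>.param_Lipschitz[folded L_def] cont d0]) (assumption | rule that)+
  have I0: "0 \<le> I" unfolding I_def by (intro arc_length_integral_nonneg) auto
  show ?thesis
  proof (cases "N \<le> 1")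
    case True
    then consider "N = 0" | "N = 1" by linarith
    then have close: "infnorm (y - x) \<le> bd \<Omega> x / 16"
    proof cases
      case 1
      then have "x = y" using u0 uN ends by simp
      then show ?thesis using bdp[OF x] by (simp add: infnorm_0)
    next
      case 2
      then show ?thesis using us[of 0] u0 uN ends by simp
    qed
    have "\<bar>F x - F y\<bar> powr p \<le> C * ?V * (2 powr (p - real CARD('n)) * infnorm (x - y) powr (p - real CARD('n)))"
    proof (cases "x = y")
      case False
      define r where "r = 2 * infnorm (x - y)"
      have r: "0 < r" using False by (simp add: r_def infnorm_pos_lt)
      have sub: "cube x r \<subseteq> \<Omega>" using close bdp[OF x] by (intro cube_sub x) (simp add: r_def infnorm_sub[of x])
      have "\<bar>F x - F y\<bar> powr p \<le> C * r powr (p - real CARD('n)) * measure \<mu> (cube x r)"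
        using r by (intro morrey sub) (auto simp: r_def infnorm_0 infnorm_sub[of y])
      also have "\<dots> \<le> C * r powr (p - real CARD('n)) * ?V"
        using C by (intro mult_left_mono measure_le) auto
      also have "r powr (p - real CARD('n)) = 2 powr (p - real CARD('n)) * infnorm (x - y) powr (p - real CARD('n))"
        by (simp add: r_def powr_mult)
      finally show ?thesis by (simp add: mult_ac)
    qed (use p1 C in auto)
    also have "\<dots> \<le> C * ?V * (2 powr (p - real CARD('n)) * infnorm (x - y) powr (p - real CARD('n)) + ?N0 * (32 * I) powr (p - 1))"
      using C overlap_bound_pos(1)[where 'n = 'n] by (intro mult_left_mono) (auto simp: less_imp_le)
    finally show ?thesis .
  next
    case False
    define M where "M = N - 1"
    have M: "1 \<le> M" "N = Suc M" using False by (auto simp: M_def)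
    define \<delta> where "\<delta> k = bd \<Omega> (?\<sigma> (u k))" for k
    have \<delta>: "0 < \<delta> k" for k unfolding \<delta>_def by (rule bdp[OF \<sigma>\<Omega>[OF ur]])
    define P where "P k = (if k < M then ?\<sigma> (u k) else y)" for k
    define \<nu> where "\<nu> k = measure \<mu> (half_cube (?\<sigma> (u k)))" for k
    have stepF: "\<bar>F (P (Suc k)) - F (P k)\<bar> powr p \<le> C * \<delta> k powr (p - real CARD('n)) * \<nu> k" if k: "k < M" for k
    proof -
      have "infnorm (P (Suc k) - ?\<sigma> (u k)) \<le> \<delta> k / 4"
      proof (cases "Suc k < M")
        case True
        then show ?thesis using us[of k] \<delta>[of k] by (simp add: P_def \<delta>_def)
      next
        case False
        then have kM: "Suc k = M" using k by simp
        then have Py: "P (Suc k) = ?\<sigma> (u (Suc (Suc k)))" using uN M ends by (simp add: P_def)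
        have "infnorm (?\<sigma> (u (Suc (Suc k))) - ?\<sigma> (u k)) \<le> \<delta> (Suc k) / 16 + \<delta> k / 16"
          using infnorm_diff_triangle[of "?\<sigma> (u (Suc (Suc k)))" "?\<sigma> (u k)" "?\<sigma> (u (Suc k))"] us[of k] us[of "Suc k"]
          by (simp add: \<delta>_def)
        moreover have "\<delta> (Suc k) \<le> \<delta> k + \<delta> k / 16"
          using bd_Lipschitz[OF dom, of "?\<sigma> (u (Suc k))" "?\<sigma> (u k)"] us[of k] by (simp add: \<delta>_def)
        ultimately show ?thesis unfolding Py using \<delta>[of k] by linarith
      qed
      then show ?thesis using morrey_half[OF \<sigma>\<Omega>[OF ur[of k]], of "P (Suc k)"] k
        by (simp add: P_def \<delta>_def \<nu>_def)
    qed
    have "F y - F x = (\<Sum>k<M. F (P (Suc k)) - F (P k))"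
      unfolding sum_lessThan_telescope[of "\<lambda>k. F (P k)"] using M u0 ends by (simp add: P_def)
    then have "\<bar>F x - F y\<bar> \<le> (\<Sum>k<M. \<bar>F (P (Suc k)) - F (P k)\<bar>)"
      using sum_abs[of "\<lambda>k. F (P (Suc k)) - F (P k)" "{..<M}"] by linarith
    also have "\<dots> = (\<Sum>k<M. \<delta> k powr \<alpha> * (\<bar>F (P (Suc k)) - F (P k)\<bar> / \<delta> k powr \<alpha>))"
      using \<delta> by (intro sum.cong) (auto simp: less_imp_neq[symmetric])
    finally have "\<bar>F x - F y\<bar> powr p \<le> (\<Sum>k<M. \<delta> k powr \<alpha> * (\<bar>F (P (Suc k)) - F (P k)\<bar> / \<delta> k powr \<alpha>)) powr p"
      using p1 by (intro powr_mono2) auto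
    also have "\<dots> \<le> (\<Sum>k<M. \<delta> k powr \<alpha>) powr (p - 1) * (\<Sum>k<M. \<delta> k powr \<alpha> * (\<bar>F (P (Suc k)) - F (P k)\<bar> / \<delta> k powr \<alpha>) powr p)"
      by (rule weighted_power_mean[OF p1]) auto
    also have "\<dots> \<le> (\<Sum>k<M. \<delta> k powr \<alpha>) powr (p - 1) * (\<Sum>k<M. C * \<nu> k)"
    proof (intro mult_left_mono sum_mono)
      fix k assume "k \<in> {..<M}"
      then have k: "k < M" by simp
      have "\<delta> k powr \<alpha> * (\<bar>F (P (Suc k)) - F (P k)\<bar> / \<delta> k powr \<alpha>) powr p
          = \<delta> k powr (\<alpha> - \<alpha> * p) * \<bar>F (P (Suc k)) - F (P k)\<bar> powr p"
        by (simp add: powr_divide powr_powr powr_diff)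
      also have "\<dots> \<le> \<delta> k powr (\<alpha> - \<alpha> * p) * (C * \<delta> k powr (p - real CARD('n)) * \<nu> k)"
        using stepF[OF k] by (intro mult_left_mono) auto
      also have "\<dots> = C * \<nu> k * (\<delta> k powr (\<alpha> - \<alpha> * p + (p - real CARD('n))))" by (simp add: powr_add)
      \<comment> \<open>the value of \<open>\<alpha>\<close> is the one for which the powers of \<open>\<delta>\<close> cancel\<close>
      also have "\<alpha> - \<alpha> * p + (p - real CARD('n)) = 0"
      proof -
        have "\<alpha> * (p - 1) = p - real CARD('n)" unfolding \<alpha>_def using p1 by simp
        then show ?thesis by (simp add: algebra_simps)
      qed
      finally show "\<delta> k powr \<alpha> * (\<bar>F (P (Suc k)) - F (P k)\<bar> / \<delta> k powr \<alpha>) powr p \<le> C * \<nu> k"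
        using \<delta>[of k] by simp
    qed auto
    also have "\<dots> \<le> (32 * I) powr (p - 1) * (C * (?N0 * ?V))"
    proof (rule mult_mono)
      have w: "continuous_on {0..L} (\<lambda>u. bd \<Omega> (?\<sigma> u) powr (\<alpha> - 1))"
        using bdp[OF \<sigma>\<Omega>] by (intro continuous_on_powr cbd continuous_on_const) (auto simp: less_imp_neq[symmetric])
      let ?w = "\<lambda>u. bd \<Omega> (?\<sigma> u) powr (\<alpha> - 1)"
      have wi: "?w integrable_on {a..b}" if "0 \<le> a" "b \<le> L" for a b
        using that by (intro integrable_continuous_real continuous_on_subset[OF w]) auto
      have piece: "\<delta> k powr \<alpha> / 32 \<le> integral {u k..u (Suc k)} ?w" if k: "k < M" for k
      proof -
        have adv: "u k + \<delta> k / 16 \<le> u (Suc k)" using ua[of k] k M by (simp add: \<delta>_def)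
        have rng: "0 \<le> u k" "u (Suc k) \<le> L" using ur[of k] ur[of "Suc k"] by auto
        have "\<delta> k powr \<alpha> / 32 \<le> (2 * \<delta> k) powr (\<alpha> - 1) * (\<delta> k / 16)"
        proof -
          have "(1 / 2 :: real) = 2 powr - 1" by (simp add: powr_minus)
          also have "\<dots> \<le> 2 powr (\<alpha> - 1)" using \<alpha> by (intro powr_mono) auto
          finally have "\<delta> k powr \<alpha> / 16 * (1 / 2) \<le> \<delta> k powr \<alpha> / 16 * 2 powr (\<alpha> - 1)"
            by (intro mult_left_mono) auto
          moreover have "(2 * \<delta> k) powr (\<alpha> - 1) * (\<delta> k / 16) = \<delta> k powr \<alpha> / 16 * 2 powr (\<alpha> - 1)"
            using \<delta>[of k] by (simp add: powr_mult powr_diff)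
          ultimately show ?thesis by simp
        qed
        also have "\<dots> = integral {u k..u k + \<delta> k / 16} (\<lambda>_. (2 * \<delta> k) powr (\<alpha> - 1))"
          using \<delta>[of k] by simp
        also have "\<dots> \<le> integral {u k..u k + \<delta> k / 16} ?w"
        proof (rule integral_le)
          fix v assume v: "v \<in> {u k..u k + \<delta> k / 16}"
          then have vL: "v \<in> {0..L}" using adv rng by auto
          have "infnorm (?\<sigma> v - ?\<sigma> (u k)) \<le> \<bar>v - u k\<bar>"
            using \<gamma>.param_Lipschitz vL ur unfolding L_def by blast
          then have "bd \<Omega> (?\<sigma> v) \<le> 2 * \<delta> k"
            using bd_Lipschitz[OF dom, of "?\<sigma> v" "?\<sigma> (u k)"] v \<delta>[of k] by (simp add: \<delta>_def)
          then show "(2 * \<delta> k) powr (\<alpha> - 1) \<le> ?w v"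
            using bdp[OF \<sigma>\<Omega>[OF vL]] \<alpha> by (intro powr_mono2') auto
        qed (use adv rng wi in auto)
        also have "\<dots> \<le> integral {u k..u (Suc k)} ?w"
          using adv rng wi by (intro integral_subset_le) auto
        finally show ?thesis .
      qed
      have part: "(\<Sum>j<k. \<delta> j powr \<alpha> / 32) \<le> integral {0..u k} ?w" if "k \<le> M" for k
        using that
      proof (induction k)
        case 0 then show ?case using u0 by simp
      next
        case (Suc k)
        have "integral {0..u k} ?w + integral {u k..u (Suc k)} ?w = integral {0..u (Suc k)} ?w"
          using ur[of k] ur[of "Suc k"] um[of k] wi by (intro Henstock_Kurzweil_Integration.integral_combine) auto
        then show ?case using Suc piece[of k] by simp
      qed
      have "(\<Sum>j<M. \<delta> j powr \<alpha>) / 32 \<le> integral {0..u M} ?w"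
        using part[of M] by (simp add: sum_divide_distrib)
      also have "\<dots> \<le> integral {0..L} ?w"
        using ur[of M] wi by (intro integral_subset_le) auto
      also have "\<dots> = I" by (simp add: I_def arc_length_integral_def L_def)
      finally have "(\<Sum>j<M. \<delta> j powr \<alpha>) \<le> 32 * I" by simp
      then show "(\<Sum>j<M. \<delta> j powr \<alpha>) powr (p - 1) \<le> (32 * I) powr (p - 1)"
        using p1 by (intro powr_mono2) (auto intro: sum_nonneg)
      have "(\<Sum>k<M. \<nu> k) \<le> ?N0 * measure \<mu> (space \<mu>)"
        unfolding \<nu>_def
      proof (rule sum_overlap_le[OF fin])
        show "half_cube (?\<sigma> (u k)) \<in> sets \<mu>" for k by (rule half_cube(2)[OF \<sigma>\<Omega>[OF ur]])
        show "real (card {k \<in> {..<M}. q \<in> half_cube (?\<sigma> (u k))}) \<le> ?N0" if "q \<in> space \<mu>" for q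
        proof -
          let ?J = "{k \<in> {..<M}. q \<in> half_cube (?\<sigma> (u k))}"
          have q: "0 < bd \<Omega> q" using that space by (intro bdp) auto
          have sz: "bd \<Omega> q / 24 \<le> \<delta> k / 16" "infnorm (?\<sigma> (u k) - q) \<le> 2 * bd \<Omega> q" if "k \<in> ?J" for k
          proof -
            have m: "q \<in> half_cube (?\<sigma> (u k))" using that by simp
            show "bd \<Omega> q / 24 \<le> \<delta> k / 16" "infnorm (?\<sigma> (u k) - q) \<le> 2 * bd \<Omega> q"
              using bd_in_half_cube[OF m] m by (auto simp: \<delta>_def mem_cube infnorm_sub[of q])
          qed
          have far: "bd \<Omega> q / 24 \<le> infnorm (?\<sigma> (u j) - ?\<sigma> (u k))" if "j \<in> ?J" "k \<in> ?J" "j \<noteq> k" for j k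
          proof (cases "j < k")
            case True
            have "k < N" using that M by auto
            from sep[OF True this] sz(1)[OF that(1)] show ?thesis by (simp add: \<delta>_def infnorm_sub[of "?\<sigma> (u j)"])
          next
            case F: False
            then have "k < j" "j < N" using that M by auto
            from sep[OF this] sz(1)[OF that(2)] show ?thesis by (simp add: \<delta>_def)
          qed
          have inj: "inj_on (\<lambda>k. ?\<sigma> (u k)) ?J"
          proof (rule inj_onI, rule ccontr)
            fix j k assume jk: "j \<in> ?J" "k \<in> ?J" "?\<sigma> (u j) = ?\<sigma> (u k)" "j \<noteq> k"
            from far[OF jk(1,2,4)] jk(3) q show False by (simp add: infnorm_0)
          qed
          have "real (card ((\<lambda>k. ?\<sigma> (u k)) ` ?J)) \<le> ?N0"
          proof (rule card_separated_le(2)[OF q])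
            show "infnorm (z - q) \<le> 2 * bd \<Omega> q" if "z \<in> (\<lambda>k. ?\<sigma> (u k)) ` ?J" for z
              using that sz(2) by blast
            fix z w assume "z \<in> (\<lambda>k. ?\<sigma> (u k)) ` ?J" "w \<in> (\<lambda>k. ?\<sigma> (u k)) ` ?J" "z \<noteq> w"
            then obtain j k where "j \<in> ?J" "z = ?\<sigma> (u j)" "k \<in> ?J" "w = ?\<sigma> (u k)" "j \<noteq> k" by blast
            then show "bd \<Omega> q / 24 \<le> infnorm (z - w)" using far by simp
          qed
          then show ?thesis using card_image[OF inj] by simp
        qed
      qed (use overlap_bound_pos(1)[where 'n = 'n] in auto)
      then show "(\<Sum>k<M. C * \<nu> k) \<le> C * (?N0 * ?V)"
        using C space by (simp add: sum_distrib_left[symmetric])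
      show "0 \<le> (\<Sum>k<M. C * \<nu> k)" using C by (intro sum_nonneg) (auto simp: \<nu>_def)
    qed auto
    also have "\<dots> = C * ?V * (?N0 * (32 * I) powr (p - 1))" by simp
    also have "\<dots> \<le> C * ?V * (2 powr (p - real CARD('n)) * infnorm (x - y) powr (p - real CARD('n)) + ?N0 * (32 * I) powr (p - 1))"
      using C by (intro mult_left_mono) auto
    finally show ?thesis .
  qed
qed

lemma rho_uniformly_continuous:
  assumes e: "0 < e"
  obtains d where "0 < d" "\<And>x y. x \<in> \<Omega> \<Longrightarrow> y \<in> \<Omega> \<Longrightarrow> rho_metric \<alpha> \<Omega> x y < d \<Longrightarrow> \<bar>F x - F y\<bar> < e"
proof -
  define \<phi> where "\<phi> s = C * measure \<mu> \<Omega> * (2 powr (p - real CARD('n)) * s powr (p - real CARD('n)) + overlap_bound TYPE('n) * (32 * s) powr (p - 1))" for s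
  have "(\<phi> \<longlongrightarrow> C * measure \<mu> \<Omega> * (2 powr (p - real CARD('n)) * 0 powr (p - real CARD('n)) + overlap_bound TYPE('n) * (32 * 0) powr (p - 1))) (at_right 0)"
    unfolding \<phi>_def[abs_def] using p p1
    by (intro tendsto_intros tendsto_powr') (auto simp: eventually_at_filter)
  then have "(\<phi> \<longlongrightarrow> 0) (at_right 0)" using p p1 by simp
  moreover have "0 < e powr p" using e by simp
  ultimately have "eventually (\<lambda>s. \<phi> s < e powr p) (at_right 0)" by (rule order_tendstoD(2))
  then obtain s where s: "0 < s" "\<phi> s < e powr p"
    by (metis eventually_at_right_field dense zero_less_one)
  show ?thesis
  proof (rule that[of "min s (s powr \<alpha>)"])
    show "0 < min s (s powr \<alpha>)" using s by simp
    fix x y assume x: "x \<in> \<Omega>" and y: "y \<in> \<Omega>" and r: "rho_metric \<alpha> \<Omega> x y < min s (s powr \<alpha>)"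
    have near: "infnorm (x - y) < s" using r by (intro infnorm_less_rho[OF dom \<alpha>(1) x y s(1)]) auto
    have "d_metric \<alpha> \<Omega> x y < s" using r by (simp add: rho_metric_def) (smt (verit) powr_ge_zero)
    then obtain \<gamma> where \<gamma>: "\<gamma> \<in> curves \<Omega> x y" "arc_length_integral (\<lambda>z. bd \<Omega> z powr (\<alpha> - 1)) \<gamma> < s"
      by (rule d_metric_less_obtain[OF dom x y]) (rule that)
    have I0: "0 \<le> arc_length_integral (\<lambda>z. bd \<Omega> z powr (\<alpha> - 1)) \<gamma>" by (intro arc_length_integral_nonneg) auto
    have "\<bar>F x - F y\<bar> powr p \<le> \<phi> s"
      unfolding \<phi>_def
      by (rule order_trans[OF curve_estimate[OF x y \<gamma>(1)]], intro mult_left_mono add_mono powr_mono2)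
         (use near \<gamma>(2) I0 p p1 C overlap_bound_pos(1)[where 'n = 'n] in \<open>auto simp: infnorm_pos_le less_imp_le\<close>)
    then have "\<bar>F x - F y\<bar> powr p < e powr p" using s by simp
    then show "\<bar>F x - F y\<bar> < e" using e p1 by (meson abs_ge_zero le_less_trans not_le powr_mono2 less_imp_le order_less_le_trans zero_less_one)
  qed
qed

end

section \<open>A Whitney partition of unity\<close>

text \<open>Points at mutual distance proportional to their distance to the boundary. A maximal such set
  takes the place of the centres of a Whitney decomposition.\<close>
definition separated :: "(real ^ 'n) set \<Rightarrow> (real ^ 'n) set \<Rightarrow> bool" where
  "separated \<Omega> Z \<longleftrightarrow> Z \<subseteq> \<Omega> \<and> (\<forall>z\<in>Z. \<forall>w\<in>Z. z \<noteq> w \<longrightarrow> bd \<Omega> z / 16 \<le> infnorm (z - w))"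

text \<open>A maximal separated set exists by Zorn's lemma. A point of \<open>\<Omega>\<close> far from all its elements could be
  added to it.\<close>
lemma separated_net_exists:
  assumes dom: "is_domain \<Omega>"
  shows "\<exists>Z. separated \<Omega> Z \<and> (\<forall>x\<in>\<Omega>. \<exists>z\<in>Z. infnorm (x - z) \<le> bd \<Omega> z / 8)"
proof -
  have "\<exists>Z\<in>{Z. separated \<Omega> Z}. \<forall>Y\<in>{Z. separated \<Omega> Z}. Z \<subseteq> Y \<longrightarrow> Y = Z"
  proof (rule subset_Zorn')
    fix \<C> assume \<C>: "subset.chain {Z. separated \<Omega> Z} \<C>"
    have sep: "separated \<Omega> Z" if "Z \<in> \<C>" for Z using \<C> that by (auto simp: subset.chain_def)
    have "bd \<Omega> z / 16 \<le> infnorm (z - w)" if zw: "z \<in> \<Union>\<C>" "w \<in> \<Union>\<C>" "z \<noteq> w" for z w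
    proof -
      obtain X Y where XY: "X \<in> \<C>" "z \<in> X" "Y \<in> \<C>" "w \<in> Y" using zw by blast
      then have "X \<subseteq> Y \<or> Y \<subseteq> X" using \<C> by (auto simp: subset_chain_def)
      then obtain W where "W \<in> \<C>" "z \<in> W" "w \<in> W" using XY by blast
      then show ?thesis using sep[of W] zw(3) by (simp add: separated_def)
    qed
    moreover have "\<Union>\<C> \<subseteq> \<Omega>" using sep by (auto simp: separated_def)
    ultimately show "\<Union>\<C> \<in> {Z. separated \<Omega> Z}" by (simp add: separated_def)
  qed
  then obtain Z where Z: "separated \<Omega> Z" and max: "\<And>Y. separated \<Omega> Y \<Longrightarrow> Z \<subseteq> Y \<Longrightarrow> Y = Z" by auto
  have "\<exists>z\<in>Z. infnorm (x - z) \<le> bd \<Omega> z / 8" if x: "x \<in> \<Omega>" for x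
  proof (cases "x \<in> Z")
    case True
    then show ?thesis using bd_nonneg[OF dom, of x] by (intro bexI[of _ x]) (auto simp: infnorm_0)
  next
    case False
    then have "\<not> separated \<Omega> (insert x Z)" using max[of "insert x Z"] by blast
    then obtain z where z: "z \<in> Z" "infnorm (x - z) < bd \<Omega> x / 16 \<or> infnorm (x - z) < bd \<Omega> z / 16"
      using Z x unfolding separated_def by (force simp: infnorm_sub[of _ x] not_le)
    have "infnorm (x - z) \<le> bd \<Omega> z / 8"
      using z(2) bd_Lipschitz[OF dom, of x z] bd_nonneg[OF dom, of z] by linarith
    then show ?thesis using z(1) by blast
  qed
  then show ?thesis using Z by blast
qed

definition net :: "(real ^ 'n) set \<Rightarrow> (real ^ 'n) set" where
  "net \<Omega> = (SOME Z. separated \<Omega> Z \<and> (\<forall>x\<in>\<Omega>. \<exists>z\<in>Z. infnorm (x - z) \<le> bd \<Omega> z / 8))"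

definition active :: "(real ^ 'n) set \<Rightarrow> real ^ 'n \<Rightarrow> (real ^ 'n) set" where
  "active \<Omega> x = {z \<in> net \<Omega>. x \<in> cube z (bd \<Omega> z / 4)}"

definition dbump :: "real \<Rightarrow> real" where "dbump = deriv bump"

lemma dbump: "(bump has_real_derivative dbump s) (at s)" "continuous_on UNIV dbump" "\<bar>s\<bar> \<ge> 1 \<Longrightarrow> dbump s = 0"
proof -
  obtain f' where f': "\<And>x. (bump has_real_derivative f' x) (at x)" "smooth1 f'"
    using smooth1_has_derivative[OF step_bump(2)] by blast
  have "f' = dbump" unfolding dbump_def using f'(1) by (metis DERIV_imp_deriv ext)
  then show d: "(bump has_real_derivative dbump s) (at s)" "continuous_on UNIV dbump" for s
    using f' smooth1_continuous by auto
  \<comment> \<open>\<open>s\<close> is a minimum of \<open>bump\<close>\<close>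
  assume "\<bar>s\<bar> \<ge> 1"
  then have "bump s = 0" by (rule step_bump(6))
  then have "bump s \<le> bump y" for y using bump_nonneg[of y] by simp
  then show "dbump s = 0" by (intro DERIV_local_min[OF d(1)[of s], of 1]) auto
qed

definition dbump_sup :: real where
  "dbump_sup = (SOME B. bump_sup \<le> B \<and> (\<forall>x. \<bar>dbump x\<bar> \<le> B))"

lemma dbump_sup: "1 \<le> dbump_sup" "\<bar>bump x\<bar> \<le> dbump_sup" "\<bar>dbump x\<bar> \<le> dbump_sup"
proof -
  have "bounded (dbump ` {-1..1})"
    by (intro compact_imp_bounded compact_continuous_image continuous_on_subset[OF dbump(2)]) auto
  then obtain B where B: "\<And>x. x \<in> {-1..1} \<Longrightarrow> \<bar>dbump x\<bar> \<le> B" unfolding bounded_iff by (metis imageI real_norm_def)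
  have "\<bar>dbump x\<bar> \<le> max bump_sup B" for x
  proof (cases "\<bar>x\<bar> \<ge> 1")
    case True then show ?thesis using dbump(3)[OF True] bump_sup(1) by simp
  next
    case False
    then have "x \<in> {-1..1}" by auto
    then show ?thesis using B[of x] by simp
  qed
  then have "\<exists>B. bump_sup \<le> B \<and> (\<forall>x. \<bar>dbump x\<bar> \<le> B)" by (intro exI[of _ "max bump_sup B"]) auto
  from someI_ex[OF this] have "bump_sup \<le> dbump_sup" "\<forall>x. \<bar>dbump x\<bar> \<le> dbump_sup" unfolding dbump_sup_def by blast+
  then show "1 \<le> dbump_sup" "\<bar>bump x\<bar> \<le> dbump_sup" "\<bar>dbump x\<bar> \<le> dbump_sup"
    using bump_sup(1) bump_sup(2)[of x] by auto
qed

definition bump_inf :: real where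
  "bump_inf = (SOME \<beta>. 0 < \<beta> \<and> (\<forall>x. \<bar>x\<bar> \<le> 1 / 2 \<longrightarrow> \<beta> \<le> bump x))"

lemma bump_inf: "0 < bump_inf" "\<bar>x\<bar> \<le> 1 / 2 \<Longrightarrow> bump_inf \<le> bump x"
proof -
  obtain \<beta> where "0 < \<beta>" "\<And>x. \<bar>x\<bar> \<le> 1 / 2 \<Longrightarrow> \<beta> \<le> bump x" by (rule bump_lower_bound) (rule that)
  then have "\<exists>\<beta>. 0 < \<beta> \<and> (\<forall>x. \<bar>x\<bar> \<le> 1 / 2 \<longrightarrow> \<beta> \<le> bump x)" by blast
  from someI_ex[OF this] show "0 < bump_inf" "\<bar>x\<bar> \<le> 1 / 2 \<Longrightarrow> bump_inf \<le> bump x"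
    unfolding bump_inf_def by blast+
qed

definition cube_bump :: "real ^ 'n \<Rightarrow> real \<Rightarrow> real ^ 'n \<Rightarrow> real" where
  "cube_bump z h = tensor (\<lambda>j s. bump ((s - z $ j) / h))"

text \<open>The \<open>i\<close>-th partial derivative of \<^const>\<open>cube_bump\<close>.\<close>
definition cube_dbump :: "real ^ 'n \<Rightarrow> real \<Rightarrow> 'n \<Rightarrow> real ^ 'n \<Rightarrow> real" where
  "cube_dbump z h i = tensor ((\<lambda>j s. bump ((s - z $ j) / h))(i := (\<lambda>s. dbump ((s - z $ i) / h) / h)))"

lemma has_derivative_cube_bump:
  assumes "0 < h"
  shows "(cube_bump z h has_derivative (\<lambda>v. \<Sum>i\<in>UNIV. v $ i * cube_dbump z h i x)) (at x)"
proof -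
  define g where "g j s = bump ((s - z $ j) / h)" for j s
  define g' where "g' j s = dbump ((s - z $ j) / h) / h" for j s
  have "(g j has_real_derivative g' j s) (at s)" for j s
    unfolding g_def[abs_def] g'_def
    by (intro DERIV_cong[OF DERIV_chain2[OF dbump(1), where g = "\<lambda>s. (s - z $ j) / h" and Db = "1 / h"]])
       (use assms in \<open>auto intro!: derivative_eq_intros\<close>)
  from has_derivative_tensor[of g g', OF this]
  show ?thesis unfolding cube_bump_def cube_dbump_def g_def[abs_def] g'_def[abs_def] .
qed

lemma cube_bump_outside:
  assumes h: "0 < h" and x: "x \<notin> cube z h"
  shows "cube_bump z h x = 0" "cube_dbump z h i x = 0"
proof -
  obtain j where "h \<le> \<bar>(x - z) $ j\<bar>" using x by (auto simp: mem_cube infnorm_less_iff not_less)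
  then have *: "1 \<le> \<bar>(x $ j - z $ j) / h\<bar>" using h by (simp add: abs_divide le_divide_eq)
  then show "cube_bump z h x = 0" unfolding cube_bump_def tensor_def
    by (intro prod_zero bexI[of _ j]) (auto simp: step_bump(6))
  show "cube_dbump z h i x = 0" unfolding cube_dbump_def tensor_def
    using * by (intro prod_zero bexI[of _ j]) (auto simp: step_bump(6) dbump(3))
qed

lemma cube_bump_nonneg: "0 \<le> cube_bump z h x"
  unfolding cube_bump_def tensor_def by (intro prod_nonneg) (simp add: bump_nonneg)

lemma cube_bump_ge:
  assumes h: "0 < h" and x: "infnorm (x - z) \<le> h / 2"
  shows "bump_inf ^ CARD('n) \<le> cube_bump (z :: real ^ 'n) h x"
proof -
  have "bump_inf \<le> bump ((x $ j - z $ j) / h)" for j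
  proof (rule bump_inf(2))
    have "\<bar>x $ j - z $ j\<bar> \<le> h / 2" using component_le_infnorm_cart[of "x - z" j] x by simp
    then show "\<bar>(x $ j - z $ j) / h\<bar> \<le> 1 / 2" using h by (simp add: abs_divide divide_le_eq)
  qed
  then have "(\<Prod>j\<in>(UNIV :: 'n set). bump_inf) \<le> cube_bump z h x"
    unfolding cube_bump_def tensor_def using bump_inf(1) by (intro prod_mono) (auto simp: less_imp_le)
  then show ?thesis by simp
qed

lemma cube_dbump_le:
  assumes h: "0 < h"
  shows "\<bar>cube_dbump (z :: real ^ 'n) h i x\<bar> \<le> dbump_sup ^ CARD('n) / h"
proof -
  have "\<bar>cube_dbump z h i x\<bar> = \<bar>dbump ((x $ i - z $ i) / h) / h\<bar> * (\<Prod>j\<in>UNIV - {i}. \<bar>bump ((x $ j - z $ j) / h)\<bar>)"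
    unfolding cube_dbump_def tensor_fun_upd by (simp add: abs_mult abs_prod)
  also have "\<dots> \<le> (dbump_sup / h) * (\<Prod>j\<in>UNIV - {i}. dbump_sup)"
    using h dbump_sup by (intro mult_mono prod_mono prod_nonneg) (auto simp: abs_divide divide_right_mono)
  also have "(\<Prod>j\<in>UNIV - {i}. dbump_sup) = dbump_sup ^ (CARD('n) - 1)" by (simp add: card_Diff_singleton)
  also have "(dbump_sup / h) * dbump_sup ^ (CARD('n) - 1) = dbump_sup ^ CARD('n) / h"
    by (metis One_nat_def power_minus_mult times_divide_eq_left times_divide_eq_right mult.commute zero_less_card_finite)
  finally show ?thesis .
qed

lemma continuous_cube_dbump:
  assumes h: "0 < h"
  shows "continuous_on UNIV (cube_dbump z h i)"
proof -
  have b: "continuous_on UNIV (\<lambda>x. bump ((x $ j - z $ j) / h))" for j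
    by (rule continuous_on_compose2[OF smooth1_continuous[OF step_bump(2)]]) (use h in \<open>auto intro!: continuous_intros\<close>)
  have d: "continuous_on UNIV (\<lambda>x. dbump ((x $ i - z $ i) / h) / h)"
    by (rule continuous_on_divide[OF continuous_on_compose2[OF dbump(2)]]) (use h in \<open>auto intro!: continuous_intros\<close>)
  have "continuous_on UNIV (\<lambda>x. dbump ((x $ i - z $ i) / h) / h * (\<Prod>j\<in>UNIV - {i}. bump ((x $ j - z $ j) / h)))"
    by (intro continuous_on_mult d continuous_on_prod b)
  moreover have "cube_dbump z h i = (\<lambda>x. dbump ((x $ i - z $ i) / h) / h * (\<Prod>j\<in>UNIV - {i}. bump ((x $ j - z $ j) / h)))"
    by (rule ext) (simp add: cube_dbump_def tensor_fun_upd)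
  ultimately show ?thesis by simp
qed

abbreviation whitney_bump :: "(real ^ 'n) set \<Rightarrow> real ^ 'n \<Rightarrow> real ^ 'n \<Rightarrow> real" where
  "whitney_bump \<Omega> z \<equiv> cube_bump z (bd \<Omega> z / 4)"

abbreviation whitney_dbump :: "(real ^ 'n) set \<Rightarrow> real ^ 'n \<Rightarrow> 'n \<Rightarrow> real ^ 'n \<Rightarrow> real" where
  "whitney_dbump \<Omega> z \<equiv> cube_dbump z (bd \<Omega> z / 4)"

definition whitney_sum :: "(real ^ 'n) set \<Rightarrow> real ^ 'n \<Rightarrow> real" where
  "whitney_sum \<Omega> x = (\<Sum>z\<in>active \<Omega> x. whitney_bump \<Omega> z x)"

text \<open>The mean of the coefficients of the active points, weighted by their bumps.\<close>
definition whitney_ext :: "(real ^ 'n) set \<Rightarrow> (real ^ 'n \<Rightarrow> real) \<Rightarrow> real ^ 'n \<Rightarrow> real" where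
  "whitney_ext \<Omega> c x = (\<Sum>z\<in>active \<Omega> x. whitney_bump \<Omega> z x * c z) / whitney_sum \<Omega> x"

text \<open>The quotient rule: the derivative of the denominator accounts for the subtraction of
  \<open>whitney_ext \<Omega> c x\<close>.\<close>
definition whitney_grad :: "(real ^ 'n) set \<Rightarrow> (real ^ 'n \<Rightarrow> real) \<Rightarrow> real ^ 'n \<Rightarrow> real ^ 'n" where
  "whitney_grad \<Omega> c x =
    (\<chi> i. (\<Sum>z\<in>active \<Omega> x. whitney_dbump \<Omega> z i x * (c z - whitney_ext \<Omega> c x)) / whitney_sum \<Omega> x)"

lemma whitney_ext_linear:
  "whitney_ext \<Omega> (\<lambda>z. a * c z + b * d z) x = a * whitney_ext \<Omega> c x + b * whitney_ext \<Omega> d x"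
  unfolding whitney_ext_def
  by (simp add: distrib_left sum.distrib sum_distrib_left add_divide_distrib mult.left_commute)

locale domain =
  fixes \<Omega> :: "(real ^ 'n) set"
  assumes dom: "is_domain \<Omega>"
begin

lemma net: "net \<Omega> \<subseteq> \<Omega>" "z \<in> net \<Omega> \<Longrightarrow> w \<in> net \<Omega> \<Longrightarrow> z \<noteq> w \<Longrightarrow> bd \<Omega> z / 16 \<le> infnorm (z - w)"
    "x \<in> \<Omega> \<Longrightarrow> \<exists>z\<in>net \<Omega>. infnorm (x - z) \<le> bd \<Omega> z / 8"
proof -
  have *: "separated \<Omega> (net \<Omega>) \<and> (\<forall>x\<in>\<Omega>. \<exists>z\<in>net \<Omega>. infnorm (x - z) \<le> bd \<Omega> z / 8)"
    unfolding net_def by (rule someI_ex[OF separated_net_exists[OF dom]])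
  then have sep: "separated \<Omega> (net \<Omega>)" by (rule conjunct1)
  show "net \<Omega> \<subseteq> \<Omega>" "z \<in> net \<Omega> \<Longrightarrow> w \<in> net \<Omega> \<Longrightarrow> z \<noteq> w \<Longrightarrow> bd \<Omega> z / 16 \<le> infnorm (z - w)"
    using sep by (simp_all add: separated_def)
  show "x \<in> \<Omega> \<Longrightarrow> \<exists>z\<in>net \<Omega>. infnorm (x - z) \<le> bd \<Omega> z / 8" using * by blast
qed

lemma bdp: "z \<in> \<Omega> \<Longrightarrow> 0 < bd \<Omega> z"
  by (rule bd_pos[OF dom])

lemma active_bd:
  assumes "z \<in> active \<Omega> x"
  shows "z \<in> net \<Omega>" "z \<in> \<Omega>" "0 < bd \<Omega> z" "infnorm (x - z) < bd \<Omega> z / 4" "3 / 4 * bd \<Omega> z < bd \<Omega> x" "bd \<Omega> x < 5 / 4 * bd \<Omega> z"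
proof -
  show 1: "z \<in> net \<Omega>" "infnorm (x - z) < bd \<Omega> z / 4" using assms by (auto simp: active_def mem_cube)
  then show "z \<in> \<Omega>" using net(1) by blast
  then show "0 < bd \<Omega> z" by (rule bdp)
  show "3 / 4 * bd \<Omega> z < bd \<Omega> x" "bd \<Omega> x < 5 / 4 * bd \<Omega> z"
    using bd_Lipschitz[OF dom, of x z] bd_Lipschitz[OF dom, of z x] 1(2) by (auto simp: infnorm_sub[of z])
qed

definition nearby :: "real ^ 'n \<Rightarrow> (real ^ 'n) set" where
  "nearby x0 = {z \<in> net \<Omega>. infnorm (x0 - z) < bd \<Omega> z / 4 + bd \<Omega> x0 / 16}"

text \<open>Nearby points have a distance to the boundary comparable to that of \<open>x0\<close>, so they are separated
  on that scale and the packing lemma applies.\<close>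
lemma nearby_finite:
  assumes x0: "x0 \<in> \<Omega>"
  shows "finite (nearby x0)" "real (card (nearby x0)) \<le> overlap_bound TYPE('n)"
proof -
  have b: "0 < bd \<Omega> x0" by (rule bdp[OF x0])
  have z: "infnorm (z - x0) \<le> 2 * bd \<Omega> x0" "2 / 3 * bd \<Omega> x0 \<le> bd \<Omega> z" "z \<in> net \<Omega>" if "z \<in> nearby x0" for z
  proof -
    have *: "infnorm (x0 - z) < bd \<Omega> z / 4 + bd \<Omega> x0 / 16" "z \<in> net \<Omega>" using that by (auto simp: nearby_def)
    then show "infnorm (z - x0) \<le> 2 * bd \<Omega> x0" "2 / 3 * bd \<Omega> x0 \<le> bd \<Omega> z" "z \<in> net \<Omega>"
      using bd_Lipschitz[OF dom, of x0 z] bd_Lipschitz[OF dom, of z x0] b infnorm_sub[of z x0] by auto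
  qed
  have s: "bd \<Omega> x0 / 24 \<le> infnorm (z - w)" if "z \<in> nearby x0" "w \<in> nearby x0" "z \<noteq> w" for z w
    using net(2)[OF z(3)[OF that(1)] z(3)[OF that(2)] that(3)] z(2)[OF that(1)] by linarith
  show "finite (nearby x0)" "real (card (nearby x0)) \<le> overlap_bound TYPE('n)"
    using card_separated_le[OF b z(1) s] by auto
qed

lemma active_nearby:
  assumes "x \<in> cube x0 (bd \<Omega> x0 / 16)"
  shows "active \<Omega> x \<subseteq> nearby x0"
proof
  fix z assume "z \<in> active \<Omega> x"
  then show "z \<in> nearby x0"
    using infnorm_diff_triangle[of x0 z x] infnorm_sub[of x0 x] assms
    by (simp add: active_def nearby_def mem_cube)
qed

lemma active_finite:
  assumes x: "x \<in> \<Omega>"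
  shows "finite (active \<Omega> x)" "real (card (active \<Omega> x)) \<le> overlap_bound TYPE('n)"
proof -
  have sub: "active \<Omega> x \<subseteq> nearby x"
    by (rule active_nearby) (use bdp[OF x] in \<open>simp add: mem_cube infnorm_0\<close>)
  show "finite (active \<Omega> x)" by (rule finite_subset[OF sub nearby_finite(1)[OF x]])
  have "card (active \<Omega> x) \<le> card (nearby x)" by (rule card_mono[OF nearby_finite(1)[OF x] sub])
  then show "real (card (active \<Omega> x)) \<le> overlap_bound TYPE('n)" using nearby_finite(2)[OF x] by linarith
qed

text \<open>Every point of the net is active at some point of a countable dense set, and at each point only
  finitely many are.\<close>
lemma countable_net: "countable (net \<Omega>)"
proof -
  obtain D :: "(real ^ 'n) set" where D: "countable D" "\<And>X. open X \<Longrightarrow> X \<noteq> {} \<Longrightarrow> \<exists>d\<in>D. d \<in> X"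
    by (rule countable_dense_setE) (blast intro: that)
  have "net \<Omega> \<subseteq> (\<Union>d\<in>D \<inter> \<Omega>. active \<Omega> d)"
  proof
    fix z assume z: "z \<in> net \<Omega>"
    then have z\<Omega>: "z \<in> \<Omega>" using net(1) by blast
    have "z \<in> cube z (bd \<Omega> z / 4)" using bdp[OF z\<Omega>] by (simp add: mem_cube infnorm_0)
    then obtain d where d: "d \<in> D" "d \<in> cube z (bd \<Omega> z / 4)" using D(2)[OF open_cube, of z "bd \<Omega> z / 4"] by blast
    have "d \<in> \<Omega>" using cube_bd_subset[OF dom z\<Omega>, of "bd \<Omega> z / 4"] bdp[OF z\<Omega>] d(2) by auto
    then show "z \<in> (\<Union>d\<in>D \<inter> \<Omega>. active \<Omega> d)" using d z by (auto simp: active_def)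
  qed
  moreover have "countable (\<Union>d\<in>D \<inter> \<Omega>. active \<Omega> d)"
    using D(1) active_finite(1) by (intro countable_UN) (auto intro: countable_finite)
  ultimately show ?thesis by (rule countable_subset)
qed

lemma whitney_sum_ge:
  assumes x: "x \<in> \<Omega>"
  shows "bump_inf ^ CARD('n) \<le> whitney_sum \<Omega> x" "0 < whitney_sum \<Omega> x"
proof -
  obtain z where z: "z \<in> net \<Omega>" "infnorm (x - z) \<le> bd \<Omega> z / 8" using net(3)[OF x] by blast
  have bz: "0 < bd \<Omega> z" using z(1) net(1) bdp by blast
  have za: "z \<in> active \<Omega> x" using z bz by (simp add: active_def mem_cube)
  have "bump_inf ^ CARD('n) \<le> whitney_bump \<Omega> z x" using z bz by (intro cube_bump_ge) auto
  also have "\<dots> \<le> whitney_sum \<Omega> x"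
    unfolding whitney_sum_def using za active_finite(1)[OF x] by (intro member_le_sum cube_bump_nonneg)
  finally show 1: "bump_inf ^ CARD('n) \<le> whitney_sum \<Omega> x" .
  have "0 < bump_inf ^ CARD('n)" using bump_inf(1) by simp
  then show "0 < whitney_sum \<Omega> x" using 1 by linarith
qed

text \<open>The set of active points varies with \<open>x\<close>. For differentiation it is replaced by a set that
  serves for all points of a neighbourhood.\<close>
lemma sum_active_nearby:
  assumes x0: "x0 \<in> \<Omega>" and x: "x \<in> cube x0 (bd \<Omega> x0 / 16)"
  shows "(\<Sum>z\<in>active \<Omega> x. whitney_bump \<Omega> z x * c z) = (\<Sum>z\<in>nearby x0. whitney_bump \<Omega> z x * c z)"
    and "whitney_sum \<Omega> x = (\<Sum>z\<in>nearby x0. whitney_bump \<Omega> z x)"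
    and "(\<Sum>z\<in>active \<Omega> x. whitney_dbump \<Omega> z i x * c z) = (\<Sum>z\<in>nearby x0. whitney_dbump \<Omega> z i x * c z)"
proof -
  have zero: "whitney_bump \<Omega> z x = 0" "whitney_dbump \<Omega> z i x = 0" if "z \<in> nearby x0 - active \<Omega> x" for z i
  proof -
    have z: "z \<in> net \<Omega>" "x \<notin> cube z (bd \<Omega> z / 4)" using that by (auto simp: nearby_def active_def)
    have "0 < bd \<Omega> z / 4" using z(1) net(1) bdp by auto
    then show "whitney_bump \<Omega> z x = 0" "whitney_dbump \<Omega> z i x = 0" using cube_bump_outside z(2) by blast+
  qed
  note * = sum.mono_neutral_left[OF nearby_finite(1)[OF x0] active_nearby[OF x]]
  show "(\<Sum>z\<in>active \<Omega> x. whitney_bump \<Omega> z x * c z) = (\<Sum>z\<in>nearby x0. whitney_bump \<Omega> z x * c z)"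
    "whitney_sum \<Omega> x = (\<Sum>z\<in>nearby x0. whitney_bump \<Omega> z x)"
    "(\<Sum>z\<in>active \<Omega> x. whitney_dbump \<Omega> z i x * c z) = (\<Sum>z\<in>nearby x0. whitney_dbump \<Omega> z i x * c z)"
    unfolding whitney_sum_def by (rule *, simp add: zero)+
qed

lemma nearby_bd: "z \<in> nearby x0 \<Longrightarrow> 0 < bd \<Omega> z / 4"
  using net(1) bdp by (auto simp: nearby_def)

lemma has_derivative_whitney_ext:
  assumes x: "x \<in> \<Omega>"
  shows "(whitney_ext \<Omega> c has_derivative (\<lambda>h. \<Sum>i\<in>UNIV. h $ i * whitney_grad \<Omega> c x $ i)) (at x)"
proof -
  let ?J = "nearby x" and ?U = "cube x (bd \<Omega> x / 16)"
  define S where "S y = (\<Sum>z\<in>?J. whitney_bump \<Omega> z y)" for y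
  define N where "N y = (\<Sum>z\<in>?J. whitney_bump \<Omega> z y * c z)" for y
  define S' where "S' h = (\<Sum>z\<in>?J. \<Sum>i\<in>UNIV. h $ i * whitney_dbump \<Omega> z i x)" for h
  define N' where "N' h = (\<Sum>z\<in>?J. (\<Sum>i\<in>UNIV. h $ i * whitney_dbump \<Omega> z i x) * c z)" for h
  have xU: "x \<in> ?U" using bdp[OF x] by (simp add: mem_cube infnorm_0)
  have dS: "(S has_derivative S') (at x)"
    unfolding S_def[abs_def] S'_def[abs_def]
    by (intro has_derivative_sum has_derivative_cube_bump nearby_bd)
  have dN: "(N has_derivative N') (at x)"
    unfolding N_def[abs_def] N'_def[abs_def]
    by (intro has_derivative_sum has_derivative_mult_left has_derivative_cube_bump nearby_bd)
  have SS: "S x = whitney_sum \<Omega> x" and NN: "N x = whitney_ext \<Omega> c x * S x"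
    using sum_active_nearby(1,2)[OF x xU] whitney_sum_ge(2)[OF x] by (auto simp: S_def N_def whitney_ext_def)
  have S0: "S x \<noteq> 0" using SS whitney_sum_ge(2)[OF x] by simp
  have "((\<lambda>y. N y / S y) has_derivative (\<lambda>h. (N' h * S x - N x * S' h) / (S x * S x))) (at x)"
    by (rule has_derivative_divide'[OF dN dS S0])
  moreover have "eventually (\<lambda>y. N y / S y = whitney_ext \<Omega> c y) (nhds x)"
  proof -
    have "eventually (\<lambda>y. y \<in> ?U) (nhds x)" by (rule eventually_nhds_in_open[OF open_cube xU])
    then show ?thesis
      by eventually_elim (simp add: whitney_ext_def S_def N_def sum_active_nearby[OF x])
  qed
  ultimately have "(whitney_ext \<Omega> c has_derivative (\<lambda>h. (N' h * S x - N x * S' h) / (S x * S x))) (at x)"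
    by (rule has_derivative_nhds_cong)
  moreover have "(N' h * S x - N x * S' h) / (S x * S x) = (\<Sum>i\<in>UNIV. h $ i * whitney_grad \<Omega> c x $ i)" for h
  proof -
    have "(N' h * S x - N x * S' h) / (S x * S x) = (N' h - whitney_ext \<Omega> c x * S' h) / S x"
      unfolding NN using S0 by (simp add: field_simps)
    also have "N' h - whitney_ext \<Omega> c x * S' h
        = (\<Sum>z\<in>?J. \<Sum>i\<in>UNIV. h $ i * (whitney_dbump \<Omega> z i x * (c z - whitney_ext \<Omega> c x)))"
      unfolding N'_def S'_def
      by (simp add: sum_distrib_left sum_distrib_right sum_subtractf[symmetric] algebra_simps)
    also have "\<dots> = (\<Sum>i\<in>UNIV. h $ i * (\<Sum>z\<in>?J. whitney_dbump \<Omega> z i x * (c z - whitney_ext \<Omega> c x)))"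
      by (subst sum.swap) (simp add: sum_distrib_left)
    also have "\<dots> / S x = (\<Sum>i\<in>UNIV. h $ i * whitney_grad \<Omega> c x $ i)"
      unfolding whitney_grad_def vec_lambda_beta sum_active_nearby(3)[OF x xU] SS
      by (subst sum_divide_distrib) simp
    finally show ?thesis .
  qed
  ultimately show ?thesis by simp
qed

lemma continuous_whitney_ext: "continuous_on \<Omega> (whitney_ext \<Omega> c)"
  using has_derivative_whitney_ext dom
  by (auto simp: continuous_on_eq_continuous_at is_domain_def dest: has_derivative_continuous)

lemma continuous_whitney_grad: "continuous_on \<Omega> (whitney_grad \<Omega> c)"
proof -
  have "isCont (whitney_grad \<Omega> c) x" if x: "x \<in> \<Omega>" for x
  proof -
    let ?J = "nearby x" and ?U = "cube x (bd \<Omega> x / 16)"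
    have U\<Omega>: "?U \<subseteq> \<Omega>" using bdp[OF x] by (intro cube_bd_subset[OF dom x]) auto
    have xU: "x \<in> ?U" using bdp[OF x] by (simp add: mem_cube infnorm_0)
    have cb: "continuous_on ?U (whitney_bump \<Omega> z)" if "z \<in> ?J" for z
      using has_derivative_cube_bump[OF nearby_bd[OF that]]
      by (intro continuous_at_imp_continuous_on ballI) (rule has_derivative_continuous)
    have cS: "continuous_on ?U (whitney_sum \<Omega>)"
      by (rule continuous_on_eq[where f = "\<lambda>y. \<Sum>z\<in>?J. whitney_bump \<Omega> z y"])
         (intro continuous_on_sum cb, assumption, simp add: sum_active_nearby(2)[OF x])
    have "continuous_on ?U (\<lambda>y. \<chi> i. (\<Sum>z\<in>?J. whitney_dbump \<Omega> z i y * (c z - whitney_ext \<Omega> c y)) / whitney_sum \<Omega> y)"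
    proof (intro continuous_on_vec_lambda continuous_on_divide continuous_on_sum continuous_on_mult cS)
      show "continuous_on ?U (whitney_dbump \<Omega> z i)" if "z \<in> ?J" for z i
        by (rule continuous_on_subset[OF continuous_cube_dbump[OF nearby_bd[OF that]]]) simp
      show "continuous_on ?U (\<lambda>y. c z - whitney_ext \<Omega> c y)" for z
        by (intro continuous_on_diff continuous_on_const continuous_on_subset[OF continuous_whitney_ext U\<Omega>])
      show "\<forall>y\<in>?U. whitney_sum \<Omega> y \<noteq> 0" using whitney_sum_ge(2) U\<Omega> by force
    qed
    then have "continuous_on ?U (whitney_grad \<Omega> c)"
      by (rule continuous_on_eq) (simp add: whitney_grad_def sum_active_nearby(3)[OF x])
    then show ?thesis using xU open_cube continuous_on_eq_continuous_at by blast
  qed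
  then show ?thesis by (intro continuous_at_imp_continuous_on) auto
qed

lemma whitney_ext_diff_le:
  assumes x: "x \<in> \<Omega>"
  shows "\<bar>whitney_ext \<Omega> c x - t\<bar> \<le> (\<Sum>z\<in>active \<Omega> x. \<bar>c z - t\<bar>)"
proof -
  let ?S = "whitney_sum \<Omega> x"
  have S: "0 < ?S" by (rule whitney_sum_ge(2)[OF x])
  have "whitney_ext \<Omega> c x - t = (\<Sum>z\<in>active \<Omega> x. whitney_bump \<Omega> z x / ?S * (c z - t))"
  proof -
    have "(\<Sum>z\<in>active \<Omega> x. whitney_bump \<Omega> z x / ?S * (c z - t))
        = ((\<Sum>z\<in>active \<Omega> x. whitney_bump \<Omega> z x * c z) - t * ?S) / ?S"
      by (simp add: whitney_sum_def sum_distrib_left sum_subtractf[symmetric] sum_divide_distrib algebra_simps)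
    then show ?thesis using S by (simp add: whitney_ext_def diff_divide_distrib)
  qed
  also have "\<bar>\<dots>\<bar> \<le> (\<Sum>z\<in>active \<Omega> x. \<bar>whitney_bump \<Omega> z x / ?S * (c z - t)\<bar>)" by (rule sum_abs)
  also have "\<dots> \<le> (\<Sum>z\<in>active \<Omega> x. \<bar>c z - t\<bar>)"
  proof (rule sum_mono)
    fix z assume z: "z \<in> active \<Omega> x"
    have "whitney_bump \<Omega> z x \<le> ?S"
      unfolding whitney_sum_def using z active_finite(1)[OF x] by (intro member_le_sum cube_bump_nonneg)
    then have "\<bar>whitney_bump \<Omega> z x / ?S\<bar> \<le> 1" using S cube_bump_nonneg[of z "bd \<Omega> z / 4" x] by (simp add: abs_divide)
    then show "\<bar>whitney_bump \<Omega> z x / ?S * (c z - t)\<bar> \<le> \<bar>c z - t\<bar>"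
      unfolding abs_mult by (intro mult_left_le_one_le) auto
  qed
  finally show ?thesis .
qed

end

definition grad_const :: "'n::finite itself \<Rightarrow> real" where
  "grad_const _ = 5 * dbump_sup ^ CARD('n) * (1 + overlap_bound TYPE('n)) / bump_inf ^ CARD('n)"

text \<open>A bump of scale \<open>bd \<Omega> x\<close> has a gradient of order \<open>1 / bd \<Omega> x\<close>. The reference value \<open>t\<close> will be the
  value at \<open>x\<close> of the function to be extended.\<close>
lemma (in domain) whitney_grad_le:
  assumes x: "x \<in> \<Omega>"
  shows "infnorm (whitney_grad \<Omega> c x) \<le> grad_const TYPE('n) * ((\<Sum>z\<in>active \<Omega> x. \<bar>c z - t\<bar>) / bd \<Omega> x)"
  unfolding infnorm_le_iff
proof
  fix i
  let ?A = "active \<Omega> x" and ?E = "whitney_ext \<Omega> c x" and ?B = "dbump_sup ^ CARD('n)" and ?N = "overlap_bound TYPE('n)"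
  define D where "D = (\<Sum>z\<in>?A. \<bar>c z - t\<bar>)"
  have bx: "0 < bd \<Omega> x" by (rule bdp[OF x])
  have B: "0 < ?B" using dbump_sup(1) by (intro zero_less_power) linarith
  have b0: "0 < bump_inf ^ CARD('n)" using bump_inf(1) by simp
  have D0: "0 \<le> D" unfolding D_def by (intro sum_nonneg) auto
  have num: "\<bar>\<Sum>z\<in>?A. whitney_dbump \<Omega> z i x * (c z - ?E)\<bar> \<le> 5 * ?B / bd \<Omega> x * ((1 + ?N) * D)"
  proof -
    have "\<bar>\<Sum>z\<in>?A. whitney_dbump \<Omega> z i x * (c z - ?E)\<bar> \<le> (\<Sum>z\<in>?A. \<bar>whitney_dbump \<Omega> z i x * (c z - ?E)\<bar>)" by (rule sum_abs)
    also have "\<dots> \<le> (\<Sum>z\<in>?A. 5 * ?B / bd \<Omega> x * (\<bar>c z - t\<bar> + D))"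
    proof (rule sum_mono)
      fix z assume z: "z \<in> ?A"
      note zb = active_bd[OF z]
      have "\<bar>whitney_dbump \<Omega> z i x\<bar> \<le> ?B / (bd \<Omega> z / 4)" using zb by (intro cube_dbump_le) auto
      also have "\<dots> \<le> ?B / (bd \<Omega> x / 5)" using zb bx B by (intro divide_left_mono) auto
      finally have 1: "\<bar>whitney_dbump \<Omega> z i x\<bar> \<le> 5 * ?B / bd \<Omega> x" by (simp add: mult.commute)
      have 2: "\<bar>c z - ?E\<bar> \<le> \<bar>c z - t\<bar> + D" using whitney_ext_diff_le[OF x, of c t] unfolding D_def by linarith
      show "\<bar>whitney_dbump \<Omega> z i x * (c z - ?E)\<bar> \<le> 5 * ?B / bd \<Omega> x * (\<bar>c z - t\<bar> + D)"
        unfolding abs_mult using 1 2 B bx by (intro mult_mono) auto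
    qed
    also have "\<dots> = 5 * ?B / bd \<Omega> x * ((1 + real (card ?A)) * D)"
      unfolding sum_distrib_left[symmetric] by (simp add: sum.distrib D_def[symmetric] algebra_simps)
    also have "\<dots> \<le> 5 * ?B / bd \<Omega> x * ((1 + ?N) * D)"
      using active_finite(2)[OF x] B bx D0 by (intro mult_left_mono mult_right_mono) auto
    finally show ?thesis .
  qed
  have "\<bar>whitney_grad \<Omega> c x $ i\<bar> = \<bar>\<Sum>z\<in>?A. whitney_dbump \<Omega> z i x * (c z - ?E)\<bar> / whitney_sum \<Omega> x"
    using whitney_sum_ge(2)[OF x] by (simp add: whitney_grad_def abs_divide)
  also have "\<dots> \<le> (5 * ?B / bd \<Omega> x * ((1 + ?N) * D)) / bump_inf ^ CARD('n)"
    using num whitney_sum_ge[OF x] b0 by (intro frac_le) auto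
  also have "\<dots> = grad_const TYPE('n) * (D / bd \<Omega> x)" by (simp add: grad_const_def mult_ac)
  finally show "\<bar>whitney_grad \<Omega> c x $ i\<bar> \<le> grad_const TYPE('n) * (D / bd \<Omega> x)" .
qed

section \<open>Traces and the extension operator\<close>

definition nearest :: "(real ^ 'n) set \<Rightarrow> real ^ 'n \<Rightarrow> real ^ 'n" where
  "nearest \<Omega> z = (SOME a. a \<in> frontier \<Omega> \<and> bd \<Omega> z = infnorm (z - a))"

definition approach :: "(real ^ 'n) set \<Rightarrow> real ^ 'n \<Rightarrow> nat \<Rightarrow> real ^ 'n" where
  "approach \<Omega> z = ray_seq (nearest \<Omega> z) z"

text \<open>The point of the boundary of the completion at which the segment from \<open>z\<close> to a nearest boundary
  point arrives.\<close>
definition foot :: "real \<Rightarrow> (real ^ 'n) set \<Rightarrow> real ^ 'n \<Rightarrow> (nat \<Rightarrow> real ^ 'n) set" where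
  "foot \<alpha> \<Omega> z = rho_equiv \<alpha> \<Omega> `` {approach \<Omega> z}"

text \<open>Points at distance more than 1 from the boundary get the coefficient 0. Otherwise the
  boundary function 1 of the complement of a ball, which is a trace, would be extended by the
  constant 1, which is not in \<open>L\<^sub>p\<close>.\<close>
definition coefficient :: "real \<Rightarrow> (real ^ 'n) set \<Rightarrow> ((nat \<Rightarrow> real ^ 'n) set \<Rightarrow> real) \<Rightarrow> real ^ 'n \<Rightarrow> real" where
  "coefficient \<alpha> \<Omega> f z = (if bd \<Omega> z \<le> 1 then f (foot \<alpha> \<Omega> z) else 0)"

definition extension :: "real \<Rightarrow> (real ^ 'n) set \<Rightarrow> ((nat \<Rightarrow> real ^ 'n) set \<Rightarrow> real) \<Rightarrow> real ^ 'n \<Rightarrow> real" where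
  "extension \<alpha> \<Omega> f = whitney_ext \<Omega> (coefficient \<alpha> \<Omega> f)"

lemma extension_linear:
  "extension \<alpha> \<Omega> (\<lambda>\<omega>. a * f \<omega> + b * g \<omega>) x = a * extension \<alpha> \<Omega> f x + b * extension \<alpha> \<Omega> g x"
proof -
  have "coefficient \<alpha> \<Omega> (\<lambda>\<omega>. a * f \<omega> + b * g \<omega>) = (\<lambda>z. a * coefficient \<alpha> \<Omega> f z + b * coefficient \<alpha> \<Omega> g z)"
    by (auto simp: coefficient_def fun_eq_iff)
  then show ?thesis by (simp add: extension_def whitney_ext_linear)
qed

lemma nearest:
  assumes "is_domain \<Omega>"
  shows "nearest \<Omega> z \<in> frontier \<Omega>" "bd \<Omega> z = infnorm (z - nearest \<Omega> z)"
proof -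
  obtain a where "a \<in> frontier \<Omega>" "bd \<Omega> z = infnorm (z - a)" by (rule bd_attained[OF assms]) (rule that)
  then have "\<exists>a. a \<in> frontier \<Omega> \<and> bd \<Omega> z = infnorm (z - a)" by blast
  from someI_ex[OF this] show "nearest \<Omega> z \<in> frontier \<Omega>" "bd \<Omega> z = infnorm (z - nearest \<Omega> z)"
    unfolding nearest_def by blast+
qed

lemma approach_props:
  assumes dom: "is_domain \<Omega>" and z: "z \<in> \<Omega>"
  shows "approach \<Omega> z 0 = z" "approach \<Omega> z k \<in> \<Omega>" "bd \<Omega> (approach \<Omega> z k) = (3 / 4) ^ k * bd \<Omega> z"
    "infnorm (approach \<Omega> z k - z) = (1 - (3 / 4) ^ k) * bd \<Omega> z"
    "infnorm (approach \<Omega> z (Suc k) - approach \<Omega> z k) = bd \<Omega> (approach \<Omega> z k) / 4"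
proof -
  note a = nearest[OF dom]
  note r = ray_props[OF dom z a ratio_power]
  show "approach \<Omega> z 0 = z" by (simp add: approach_def ray_seq_def ray_def)
  show "approach \<Omega> z k \<in> \<Omega>" "infnorm (approach \<Omega> z k - z) = (1 - (3 / 4) ^ k) * bd \<Omega> z"
    using r[of k] by (auto simp: approach_def ray_seq_def)
  show b: "bd \<Omega> (approach \<Omega> z k) = (3 / 4) ^ k * bd \<Omega> z" using r[of k] by (auto simp: approach_def ray_seq_def)
  have "approach \<Omega> z (Suc k) - approach \<Omega> z k = (- ((3 / 4) ^ k / 4)) *\<^sub>R (z - nearest \<Omega> z)"
    by (simp add: approach_def ray_seq_def ray_def scaleR_left_diff_distrib[symmetric])
  then show "infnorm (approach \<Omega> z (Suc k) - approach \<Omega> z k) = bd \<Omega> (approach \<Omega> z k) / 4"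
    unfolding b by (simp add: infnorm_neg infnorm_mul a(2)[of z, symmetric])
qed

lemma foot_boundary:
  assumes dom: "is_domain \<Omega>" and \<alpha>: "0 < \<alpha>" "\<alpha> \<le> 1" and z: "z \<in> \<Omega>"
  shows "foot \<alpha> \<Omega> z \<in> alpha_boundary \<alpha> \<Omega>" "approach \<Omega> z \<in> foot \<alpha> \<Omega> z"
  using ray_class_boundary[OF dom \<alpha> z nearest[OF dom]] by (auto simp: foot_def approach_def)

lemma alpha_trace_eqI:
  assumes dom: "is_domain \<Omega>" and \<omega>: "\<omega> \<in> alpha_boundary \<alpha> \<Omega>"
    and lim: "\<And>y. y \<in> \<omega> \<Longrightarrow> (\<lambda>i. F (y i)) \<longlonglongrightarrow> l"
  shows "alpha_trace \<alpha> \<Omega> F \<omega> = l"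
proof -
  obtain x where x: "x \<in> rho_Cauchy \<alpha> \<Omega>" "\<omega> = rho_equiv \<alpha> \<Omega> `` {x}" by (rule alpha_boundary_class[OF \<omega>]) (rule that)
  have "x i \<in> \<Omega>" for i using x(1) by (auto simp: rho_Cauchy_def)
  then have x\<omega>: "x \<in> \<omega>" unfolding x(2) rho_equiv_iff using x(1) rho_metric_refl[OF dom] by simp
  have "(THE l. \<forall>y\<in>\<omega>. (\<lambda>i. F (y i)) \<longlonglongrightarrow> l) = l"
  proof (rule the_equality)
    show "\<forall>y\<in>\<omega>. (\<lambda>i. F (y i)) \<longlonglongrightarrow> l" using lim by blast
    show "l' = l" if "\<forall>y\<in>\<omega>. (\<lambda>i. F (y i)) \<longlonglongrightarrow> l'" for l'
      using that x\<omega> lim[OF x\<omega>] LIMSEQ_unique by blast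
  qed
  then show ?thesis using \<omega> by (simp add: alpha_trace_def)
qed

context morrey_function
begin

sublocale domain \<Omega> by unfold_locales (rule dom)

sublocale fm: finite_measure \<mu> by (rule fin)

definition "\<tau> = (3 / 4 :: real) powr ((p - real CARD('n)) / p)"

abbreviation "tr \<equiv> alpha_trace \<alpha> \<Omega> F"

lemma \<tau>: "0 < \<tau>" "\<tau> < 1"
proof -
  have "0 < (p - real CARD('n)) / p" using p p1 by simp
  then show "0 < \<tau>" "\<tau> < 1"
    unfolding \<tau>_def using powr_less_mono2[of "(p - real CARD('n)) / p" "3 / 4" 1] by auto
qed

text \<open>By uniform continuity \<open>F\<close> maps Cauchy sequences to Cauchy sequences and equivalent sequences to
  sequences with the same limit.\<close>
lemma trace_tendsto:
  assumes \<omega>: "\<omega> \<in> alpha_boundary \<alpha> \<Omega>" and y: "y \<in> \<omega>"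
  shows "(\<lambda>i. F (y i)) \<longlonglongrightarrow> tr \<omega>"
proof -
  obtain x where x: "x \<in> rho_Cauchy \<alpha> \<Omega>" "\<omega> = rho_equiv \<alpha> \<Omega> `` {x}" by (rule alpha_boundary_class[OF \<omega>]) (rule that)
  have x\<Omega>: "x i \<in> \<Omega>" for i using x(1) by (auto simp: rho_Cauchy_def)
  have "Cauchy (\<lambda>i. F (x i))"
  proof (rule metric_CauchyI)
    fix e :: real assume "0 < e"
    then obtain d where d: "0 < d" "\<And>x y. x \<in> \<Omega> \<Longrightarrow> y \<in> \<Omega> \<Longrightarrow> rho_metric \<alpha> \<Omega> x y < d \<Longrightarrow> \<bar>F x - F y\<bar> < e"
      by (rule rho_uniformly_continuous) (rule that)
    obtain N where "\<forall>i\<ge>N. \<forall>j\<ge>N. rho_metric \<alpha> \<Omega> (x i) (x j) < d"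
      using x(1) d(1) unfolding rho_Cauchy_def by blast
    then have "\<forall>i\<ge>N. \<forall>j\<ge>N. dist (F (x i)) (F (x j)) < e" using d(2)[OF x\<Omega> x\<Omega>] by (simp add: dist_real_def)
    then show "\<exists>M. \<forall>m\<ge>M. \<forall>n\<ge>M. dist (F (x m)) (F (x n)) < e" by blast
  qed
  then obtain l where l: "(\<lambda>i. F (x i)) \<longlonglongrightarrow> l" using Cauchy_convergent convergent_def by blast
  have all: "(\<lambda>i. F (w i)) \<longlonglongrightarrow> l" if w: "w \<in> \<omega>" for w
  proof -
    have wC: "w \<in> rho_Cauchy \<alpha> \<Omega>" and wl: "(\<lambda>i. rho_metric \<alpha> \<Omega> (x i) (w i)) \<longlonglongrightarrow> 0"
      using w unfolding x(2) rho_equiv_iff by blast+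
    have w\<Omega>: "w i \<in> \<Omega>" for i using wC by (auto simp: rho_Cauchy_def)
    have "(\<lambda>i. F (x i) - F (w i)) \<longlonglongrightarrow> 0"
    proof (rule LIMSEQ_I)
      fix e :: real assume "0 < e"
      then obtain d where d: "0 < d" "\<And>x y. x \<in> \<Omega> \<Longrightarrow> y \<in> \<Omega> \<Longrightarrow> rho_metric \<alpha> \<Omega> x y < d \<Longrightarrow> \<bar>F x - F y\<bar> < e"
        by (rule rho_uniformly_continuous) (rule that)
      have "eventually (\<lambda>i. rho_metric \<alpha> \<Omega> (x i) (w i) < d) sequentially" by (rule order_tendstoD(2)[OF wl d(1)])
      then show "\<exists>no. \<forall>n\<ge>no. norm (F (x n) - F (w n) - 0) < e"
        using d(2)[OF x\<Omega> w\<Omega>] by (auto simp: eventually_sequentially)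
    qed
    from tendsto_diff[OF l this] show ?thesis by simp
  qed
  show ?thesis using alpha_trace_eqI[OF dom \<omega> all] all[OF y] by simp
qed

text \<open>The energy near the segment from \<open>z\<close> to its foot, discounted towards the boundary; \<open>\<tau>\<close> is the decay
  rate of the increments of \<open>F\<close> along the segment.\<close>
definition ray_energy :: "real ^ 'n \<Rightarrow> real" where
  "ray_energy z = (\<Sum>k. \<tau> ^ k * measure \<mu> (half_cube (approach \<Omega> z k)))"

lemma ray_energy_summable: "summable (\<lambda>k. \<tau> ^ k * measure \<mu> (half_cube (approach \<Omega> z k)))"
proof (rule summable_comparison_test)
  show "\<exists>N. \<forall>k\<ge>N. norm (\<tau> ^ k * measure \<mu> (half_cube (approach \<Omega> z k))) \<le> \<tau> ^ k * measure \<mu> \<Omega>"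
    using \<tau> by (auto intro!: exI[of _ 0] mult_left_mono measure_le)
  show "summable (\<lambda>k. \<tau> ^ k * measure \<mu> \<Omega>)" using \<tau> by (intro summable_mult2 summable_geometric) auto
qed

lemma ray_energy_partial:
  "(\<Sum>k<J. \<tau> ^ k * measure \<mu> (half_cube (approach \<Omega> z k))) \<le> ray_energy z"
  unfolding ray_energy_def using \<tau> by (intro sum_le_suminf ray_energy_summable) auto

lemma ray_energy_nonneg: "0 \<le> ray_energy z"
  using ray_energy_partial[where J = 0 and z = z] by simp

lemma ray_energy_ge: "z \<in> \<Omega> \<Longrightarrow> measure \<mu> (half_cube z) \<le> ray_energy z"
  using ray_energy_partial[where J = 1 and z = z] by (simp add: approach_props(1)[OF dom])

lemma ray_energy_le: "ray_energy z \<le> measure \<mu> \<Omega> / (1 - \<tau>)"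
proof -
  have "ray_energy z \<le> (\<Sum>k. \<tau> ^ k * measure \<mu> \<Omega>)"
    unfolding ray_energy_def
    using \<tau> by (intro suminf_le ray_energy_summable summable_mult2 summable_geometric mult_left_mono measure_le) auto
  also have "\<dots> = measure \<mu> \<Omega> / (1 - \<tau>)"
    using \<tau> by (subst suminf_mult2[symmetric]) (auto simp: suminf_geometric summable_geometric)
  finally show ?thesis .
qed

text \<open>Telescoping along the segment to the nearest boundary point; the increments decay
  geometrically as \<open>p > n\<close>.\<close>
lemma foot_estimate:
  assumes z: "z \<in> \<Omega>"
  shows "\<bar>tr (foot \<alpha> \<Omega> z) - F z\<bar> powr p \<le> C * (1 / (1 - \<tau>)) powr (p - 1) * bd \<Omega> z powr (p - real CARD('n)) * ray_energy z"
    (is "_ \<le> ?R")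
proof -
  let ?w = "approach \<Omega> z" and ?s = "p - real CARD('n)"
  note ap = approach_props[OF dom z]
  have bz: "0 < bd \<Omega> z" by (rule bdp[OF z])
  have partial: "\<bar>F (?w J) - F z\<bar> powr p \<le> ?R" for J
  proof -
    define b where "b k = \<bar>F (?w (Suc k)) - F (?w k)\<bar>" for k
    have inc: "(b k / \<tau> ^ k) powr p \<le> C * bd \<Omega> z powr ?s * measure \<mu> (half_cube (?w k))" for k
    proof -
      have "b k powr p \<le> C * bd \<Omega> (?w k) powr ?s * measure \<mu> (half_cube (?w k))"
        unfolding b_def by (rule morrey_half[OF ap(2)]) (simp add: ap(5))
      moreover have "bd \<Omega> (?w k) powr ?s = (\<tau> ^ k) powr p * bd \<Omega> z powr ?s"
      proof -
        have "(\<tau> ^ k) powr p = ((3 / 4) ^ k) powr ?s"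
          unfolding \<tau>_def using p1
          by (subst (1 2) powr_realpow[symmetric]) (auto simp: powr_powr mult_ac)
        then show ?thesis by (simp add: ap(3) powr_mult)
      qed
      ultimately have "b k powr p \<le> (\<tau> ^ k) powr p * (C * bd \<Omega> z powr ?s * measure \<mu> (half_cube (?w k)))"
        by (simp add: mult_ac)
      then show ?thesis using \<tau> by (simp add: powr_divide divide_le_eq mult.commute)
    qed
    have "F (?w J) - F z = (\<Sum>k<J. F (?w (Suc k)) - F (?w k))"
      unfolding sum_lessThan_telescope[of "\<lambda>k. F (?w k)"] by (simp add: ap(1))
    then have "\<bar>F (?w J) - F z\<bar> \<le> (\<Sum>k<J. b k)" unfolding b_def by (simp only: sum_abs)
    also have "\<dots> = (\<Sum>k<J. \<tau> ^ k * (b k / \<tau> ^ k))" using \<tau> by (intro sum.cong) auto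
    finally have "\<bar>F (?w J) - F z\<bar> powr p \<le> (\<Sum>k<J. \<tau> ^ k * (b k / \<tau> ^ k)) powr p"
      using p1 by (intro powr_mono2) auto
    also have "\<dots> \<le> (\<Sum>k<J. \<tau> ^ k) powr (p - 1) * (\<Sum>k<J. \<tau> ^ k * (b k / \<tau> ^ k) powr p)"
      by (rule weighted_power_mean[OF p1]) (use \<tau> in \<open>auto simp: b_def\<close>)
    also have "\<dots> \<le> (1 / (1 - \<tau>)) powr (p - 1) * (C * bd \<Omega> z powr ?s * ray_energy z)"
    proof (rule mult_mono)
      have "(\<Sum>k<J. \<tau> ^ k) \<le> (\<Sum>k. \<tau> ^ k)" using \<tau> by (intro sum_le_suminf summable_geometric) auto
      then have "(\<Sum>k<J. \<tau> ^ k) \<le> 1 / (1 - \<tau>)" using \<tau> by (simp add: suminf_geometric)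
      then show "(\<Sum>k<J. \<tau> ^ k) powr (p - 1) \<le> (1 / (1 - \<tau>)) powr (p - 1)"
        using \<tau> p1 by (intro powr_mono2 sum_nonneg) auto
      have "(\<Sum>k<J. \<tau> ^ k * (b k / \<tau> ^ k) powr p)
          \<le> (\<Sum>k<J. \<tau> ^ k * (C * bd \<Omega> z powr ?s * measure \<mu> (half_cube (?w k))))"
        using \<tau> inc by (intro sum_mono mult_left_mono) auto
      also have "\<dots> = C * bd \<Omega> z powr ?s * (\<Sum>k<J. \<tau> ^ k * measure \<mu> (half_cube (?w k)))"
        by (simp add: sum_distrib_left mult_ac)
      also have "\<dots> \<le> C * bd \<Omega> z powr ?s * ray_energy z"
        using C by (intro mult_left_mono ray_energy_partial) auto
      finally show "(\<Sum>k<J. \<tau> ^ k * (b k / \<tau> ^ k) powr p) \<le> C * bd \<Omega> z powr ?s * ray_energy z" .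
    qed (use \<tau> in \<open>auto intro!: sum_nonneg\<close>)
    finally show ?thesis by (simp add: mult_ac)
  qed
  have "(\<lambda>J. F (?w J)) \<longlonglongrightarrow> tr (foot \<alpha> \<Omega> z)"
    by (rule trace_tendsto[OF foot_boundary[OF dom \<alpha> z]])
  then have "(\<lambda>J. \<bar>F (?w J) - F z\<bar> powr p) \<longlonglongrightarrow> \<bar>tr (foot \<alpha> \<Omega> z) - F z\<bar> powr p"
    using p1 by (intro tendsto_powr' tendsto_intros) auto
  then show ?thesis by (rule LIMSEQ_le_const2) (use partial in auto)
qed

definition "coef_const = 2 powr (p - 1) * C * ((1 / (1 - \<tau>)) powr (p - 1) + 1)"

lemma coef_const: "0 \<le> coef_const"
  unfolding coef_const_def using C by (intro mult_nonneg_nonneg add_nonneg_nonneg) auto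

lemma coefficient_estimate:
  assumes x: "x \<in> \<Omega>" and z: "z \<in> active \<Omega> x"
  shows "\<bar>coefficient \<alpha> \<Omega> tr z - F x\<bar> powr p
    \<le> (if bd \<Omega> z \<le> 1 then coef_const * bd \<Omega> z powr (p - real CARD('n)) * ray_energy z else \<bar>F x\<bar> powr p)"
proof (cases "bd \<Omega> z \<le> 1")
  case True
  let ?s = "p - real CARD('n)"
  note zb = active_bd[OF z]
  have "\<bar>coefficient \<alpha> \<Omega> tr z - F x\<bar> \<le> \<bar>tr (foot \<alpha> \<Omega> z) - F z\<bar> + \<bar>F x - F z\<bar>"
    using True by (simp add: coefficient_def)
  then have "\<bar>coefficient \<alpha> \<Omega> tr z - F x\<bar> powr p \<le> (\<bar>tr (foot \<alpha> \<Omega> z) - F z\<bar> + \<bar>F x - F z\<bar>) powr p"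
    using p1 by (intro powr_mono2) auto
  also have "\<dots> \<le> 2 powr (p - 1) * (\<bar>tr (foot \<alpha> \<Omega> z) - F z\<bar> powr p + \<bar>F x - F z\<bar> powr p)"
    by (rule add_powr_le[OF p1]) auto
  also have "\<dots> \<le> 2 powr (p - 1) * (C * (1 / (1 - \<tau>)) powr (p - 1) * bd \<Omega> z powr ?s * ray_energy z
      + C * bd \<Omega> z powr ?s * ray_energy z)"
  proof (intro mult_left_mono add_mono foot_estimate zb)
    have "\<bar>F x - F z\<bar> powr p \<le> C * bd \<Omega> z powr ?s * measure \<mu> (half_cube z)"
      by (rule morrey_half[OF zb(2)]) (use zb(4) in simp)
    also have "\<dots> \<le> C * bd \<Omega> z powr ?s * ray_energy z"
      using C by (intro mult_left_mono ray_energy_ge zb) auto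
    finally show "\<bar>F x - F z\<bar> powr p \<le> C * bd \<Omega> z powr ?s * ray_energy z" .
  qed auto
  also have "\<dots> = coef_const * bd \<Omega> z powr ?s * ray_energy z" by (simp add: coef_const_def algebra_simps)
  finally show ?thesis using True by simp
qed (simp add: coefficient_def)

text \<open>Deviation of the active coefficients from the value of \<open>F\<close>; it controls both the extension and its gradient.\<close>
definition "dev x = (\<Sum>z\<in>active \<Omega> x. \<bar>coefficient \<alpha> \<Omega> tr z - F x\<bar>)"

text \<open>The factor is, up to a constant, the reciprocal of the volume of the cube on which \<open>z\<close> is active.\<close>
definition "active_energy x = (\<Sum>z\<in>active \<Omega> x. bd \<Omega> z powr (- real CARD('n)) * ray_energy z)"

lemma dev_nonneg: "0 \<le> dev x" unfolding dev_def by (intro sum_nonneg) auto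

lemma active_energy_nonneg: "0 \<le> active_energy x"
  unfolding active_energy_def using ray_energy_nonneg by (intro sum_nonneg mult_nonneg_nonneg) auto

definition "dev_const = overlap_bound TYPE('n) powr (p - 1) * (coef_const + overlap_bound TYPE('n))"

lemma dev_const: "0 \<le> dev_const"
  unfolding dev_const_def using coef_const overlap_bound_pos(1)[where 'n = 'n] by simp

text \<open>For \<open>w = 1\<close> this will bound the extension and for \<open>w = 1 / bd \<Omega> x\<close> its gradient. Active points close
  to the boundary contribute \<open>bd \<Omega> z powr (p - n)\<close> times their energy, where the weight turns the power
  into \<open>- n\<close>; all others have the coefficient 0 and contribute \<open>F x\<close>.\<close>
lemma weighted_dev_estimate:
  assumes x: "x \<in> \<Omega>" and w0: "0 \<le> w"
    and w: "\<And>z. z \<in> active \<Omega> x \<Longrightarrow> bd \<Omega> z \<le> 1 \<Longrightarrow> w powr p * bd \<Omega> z powr p \<le> K"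
      "\<And>z. z \<in> active \<Omega> x \<Longrightarrow> 1 < bd \<Omega> z \<Longrightarrow> w powr p \<le> K"
    and K: "0 \<le> K"
  shows "(w * dev x) powr p \<le> K * dev_const * (\<bar>F x\<bar> powr p + active_energy x)"
proof -
  let ?A = "active \<Omega> x" and ?c = "coefficient \<alpha> \<Omega> tr" and ?N = "overlap_bound TYPE('n)" and ?s = "p - real CARD('n)"
  have N: "0 < ?N" by (rule overlap_bound_pos)
  have fin: "finite ?A" and card: "real (card ?A) \<le> ?N" using active_finite[OF x] by auto
  have "dev x powr p \<le> real (card ?A) powr (p - 1) * (\<Sum>z\<in>?A. \<bar>?c z - F x\<bar> powr p)"
    unfolding dev_def by (rule sum_powr_le[OF p1 fin]) auto
  also have "\<dots> \<le> ?N powr (p - 1) * (\<Sum>z\<in>?A. \<bar>?c z - F x\<bar> powr p)"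
    using card p1 by (intro mult_right_mono powr_mono2 sum_nonneg) auto
  finally have "(w * dev x) powr p \<le> w powr p * (?N powr (p - 1) * (\<Sum>z\<in>?A. \<bar>?c z - F x\<bar> powr p))"
    using powr_mult[of w "dev x" p] by (simp add: mult_left_mono)
  also have "\<dots> = ?N powr (p - 1) * (\<Sum>z\<in>?A. w powr p * \<bar>?c z - F x\<bar> powr p)"
    by (simp add: sum_distrib_left mult_ac)
  also have "\<dots> \<le> ?N powr (p - 1) * (\<Sum>z\<in>?A. K * (coef_const * (bd \<Omega> z powr (- real CARD('n)) * ray_energy z) + \<bar>F x\<bar> powr p))"
  proof (intro mult_left_mono sum_mono)
    fix z assume z: "z \<in> ?A"
    have e: "0 \<le> coef_const * (bd \<Omega> z powr (- real CARD('n)) * ray_energy z)"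
      using coef_const ray_energy_nonneg by auto
    show "w powr p * \<bar>?c z - F x\<bar> powr p \<le> K * (coef_const * (bd \<Omega> z powr (- real CARD('n)) * ray_energy z) + \<bar>F x\<bar> powr p)"
    proof (cases "bd \<Omega> z \<le> 1")
      case True
      have "w powr p * \<bar>?c z - F x\<bar> powr p \<le> w powr p * (coef_const * bd \<Omega> z powr ?s * ray_energy z)"
        using coefficient_estimate[OF x z] True by (intro mult_left_mono) auto
      also have "\<dots> = (w powr p * bd \<Omega> z powr p) * (coef_const * (bd \<Omega> z powr (- real CARD('n)) * ray_energy z))"
        by (simp add: powr_diff powr_minus divide_inverse mult_ac)
      also have "\<dots> \<le> K * (coef_const * (bd \<Omega> z powr (- real CARD('n)) * ray_energy z))"
        using w(1)[OF z True] e by (intro mult_right_mono) auto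
      also have "\<dots> \<le> K * (coef_const * (bd \<Omega> z powr (- real CARD('n)) * ray_energy z) + \<bar>F x\<bar> powr p)"
        using K by (intro mult_left_mono) auto
      finally show ?thesis .
    next
      case False
      then have "w powr p * \<bar>?c z - F x\<bar> powr p \<le> K * \<bar>F x\<bar> powr p"
        using coefficient_estimate[OF x z] w(2)[OF z] K by (intro mult_mono) auto
      also have "\<dots> \<le> K * (coef_const * (bd \<Omega> z powr (- real CARD('n)) * ray_energy z) + \<bar>F x\<bar> powr p)"
        using K e by (intro mult_left_mono) auto
      finally show ?thesis .
    qed
  qed auto
  also have "\<dots> = K * ?N powr (p - 1) * (coef_const * active_energy x + real (card ?A) * \<bar>F x\<bar> powr p)"
    by (simp add: active_energy_def sum.distrib sum_distrib_left distrib_left mult_ac)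
  also have "\<dots> \<le> K * ?N powr (p - 1) * ((coef_const + ?N) * (\<bar>F x\<bar> powr p + active_energy x))"
  proof (rule mult_left_mono)
    have "real (card ?A) * \<bar>F x\<bar> powr p \<le> ?N * \<bar>F x\<bar> powr p" using card by (intro mult_right_mono) auto
    moreover have "0 \<le> ?N * active_energy x" "0 \<le> coef_const * \<bar>F x\<bar> powr p"
      using N coef_const active_energy_nonneg by auto
    ultimately show "coef_const * active_energy x + real (card ?A) * \<bar>F x\<bar> powr p \<le> (coef_const + ?N) * (\<bar>F x\<bar> powr p + active_energy x)"
      by (simp add: algebra_simps)
  qed (use K in auto)
  also have "\<dots> = K * dev_const * (\<bar>F x\<bar> powr p + active_energy x)" by (simp add: dev_const_def mult_ac)
  finally show ?thesis .
qed

abbreviation "Ext \<equiv> extension \<alpha> \<Omega> tr"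
abbreviation "Grad \<equiv> whitney_grad \<Omega> (coefficient \<alpha> \<Omega> tr)"

definition "ext_const = 2 powr (p - 1) * (1 + dev_const) + grad_const TYPE('n) powr p * ((4 / 3) powr p * dev_const)"

lemma ext_const: "0 < ext_const" "0 \<le> ext_const"
proof -
  show "0 < ext_const"
    unfolding ext_const_def using dev_const by (intro add_pos_nonneg mult_pos_pos mult_nonneg_nonneg) auto
  then show "0 \<le> ext_const" by simp
qed

lemma extension_pointwise:
  assumes x: "x \<in> \<Omega>"
  shows "\<bar>Ext x\<bar> powr p \<le> ext_const * (\<bar>F x\<bar> powr p + active_energy x)"
    and "infnorm (Grad x) powr p \<le> ext_const * (\<bar>F x\<bar> powr p + active_energy x)"
proof -
  let ?U = "\<bar>F x\<bar> powr p + active_energy x"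
  have U: "0 \<le> ?U" using active_energy_nonneg[of x] by simp
  have bx: "0 < bd \<Omega> x" by (rule bdp[OF x])
  have "(1 * dev x) powr p \<le> 1 * dev_const * ?U"
  proof (rule weighted_dev_estimate[OF x])
    show "1 powr p * bd \<Omega> z powr p \<le> 1" if "z \<in> active \<Omega> x" "bd \<Omega> z \<le> 1" for z
      using powr_mono2[of p "bd \<Omega> z" 1] that active_bd[OF that(1)] p1 by simp
  qed auto
  then have D: "dev x powr p \<le> dev_const * ?U" by simp
  have "\<bar>Ext x\<bar> \<le> \<bar>F x\<bar> + dev x"
    using whitney_ext_diff_le[OF x, of "coefficient \<alpha> \<Omega> tr" "F x"] by (simp add: extension_def dev_def)
  then have "\<bar>Ext x\<bar> powr p \<le> (\<bar>F x\<bar> + dev x) powr p" using p1 by (intro powr_mono2) auto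
  also have "\<dots> \<le> 2 powr (p - 1) * (\<bar>F x\<bar> powr p + dev x powr p)"
    by (rule add_powr_le[OF p1]) (auto simp: dev_nonneg)
  also have "\<dots> \<le> 2 powr (p - 1) * (?U + dev_const * ?U)"
    using D active_energy_nonneg[of x] by (intro mult_left_mono add_mono) auto
  also have "\<dots> = 2 powr (p - 1) * (1 + dev_const) * ?U" by (simp add: algebra_simps)
  also have "\<dots> \<le> ext_const * ?U"
    unfolding ext_const_def using U dev_const by (intro mult_right_mono) auto
  finally show "\<bar>Ext x\<bar> powr p \<le> ext_const * ?U" .
  have "(1 / bd \<Omega> x * dev x) powr p \<le> (4 / 3) powr p * dev_const * ?U"
  proof (rule weighted_dev_estimate[OF x])
    fix z assume z: "z \<in> active \<Omega> x"
    note zb = active_bd[OF z]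
    have "(1 / bd \<Omega> x) powr p * bd \<Omega> z powr p = (1 / bd \<Omega> x * bd \<Omega> z) powr p" by (simp only: powr_mult)
    also have "\<dots> \<le> (4 / 3) powr p"
      using zb bx p1 by (intro powr_mono2) (auto simp: divide_le_eq)
    finally show 1: "(1 / bd \<Omega> x) powr p * bd \<Omega> z powr p \<le> (4 / 3) powr p" .
    assume "1 < bd \<Omega> z"
    then have "1 / bd \<Omega> x \<le> 4 / 3" using zb bx by (simp add: divide_le_eq)
    then show "(1 / bd \<Omega> x) powr p \<le> (4 / 3) powr p" using bx p1 by (intro powr_mono2) auto
  qed (use bx in auto)
  then have G: "(dev x / bd \<Omega> x) powr p \<le> (4 / 3) powr p * dev_const * ?U" by simp
  have "infnorm (Grad x) powr p \<le> (grad_const TYPE('n) * (dev x / bd \<Omega> x)) powr p"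
    using whitney_grad_le[OF x, of "coefficient \<alpha> \<Omega> tr" "F x"] p1 unfolding dev_def[symmetric]
    by (intro powr_mono2) (auto simp: infnorm_pos_le)
  also have "\<dots> = grad_const TYPE('n) powr p * (dev x / bd \<Omega> x) powr p" by (rule powr_mult)
  also have "\<dots> \<le> grad_const TYPE('n) powr p * ((4 / 3) powr p * dev_const * ?U)"
    using G by (intro mult_left_mono) auto
  also have "\<dots> = grad_const TYPE('n) powr p * ((4 / 3) powr p * dev_const) * ?U" by simp
  also have "\<dots> \<le> ext_const * ?U"
    unfolding ext_const_def using U dev_const by (intro mult_right_mono) auto
  finally show "infnorm (Grad x) powr p \<le> ext_const * ?U" .
qed

text \<open>Near the boundary the extension deviates from \<open>F\<close> by at most a multiple of the \<open>(1 - n / p)\<close>-th power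
  of the distance to the boundary.\<close>
lemma extension_trace:
  assumes \<omega>: "\<omega> \<in> alpha_boundary \<alpha> \<Omega>"
  shows "alpha_trace \<alpha> \<Omega> Ext \<omega> = tr \<omega>"
proof (rule alpha_trace_eqI[OF dom \<omega>])
  fix y assume y: "y \<in> \<omega>"
  have y\<Omega>: "y i \<in> \<Omega>" for i
  proof -
    obtain x where "x \<in> rho_Cauchy \<alpha> \<Omega>" "\<omega> = rho_equiv \<alpha> \<Omega> `` {x}" by (rule alpha_boundary_class[OF \<omega>]) (rule that)
    then have "y \<in> rho_equiv \<alpha> \<Omega> `` {x}" using y by simp
    then have "y \<in> rho_Cauchy \<alpha> \<Omega>" unfolding rho_equiv_iff by blast
    then show ?thesis by (auto simp: rho_Cauchy_def)
  qed
  let ?N = "overlap_bound TYPE('n)" and ?s = "p - real CARD('n)"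
  define K where "K = coef_const * (measure \<mu> \<Omega> / (1 - \<tau>))"
  have K: "0 \<le> K" unfolding K_def using coef_const \<tau> by (intro mult_nonneg_nonneg divide_nonneg_nonneg) auto
  have lim0: "(\<lambda>i. bd \<Omega> (y i)) \<longlonglongrightarrow> 0" by (rule alpha_boundary_bd_tendsto_0[OF dom \<alpha> \<omega> y])
  have bound: "\<bar>Ext x - F x\<bar> \<le> ?N * (K * (2 * bd \<Omega> x) powr ?s) powr (1 / p)" if x: "x \<in> \<Omega>" and small: "bd \<Omega> x < 1 / 2" for x
  proof -
    let ?B = "(K * (2 * bd \<Omega> x) powr ?s) powr (1 / p)"
    have "\<bar>Ext x - F x\<bar> \<le> (\<Sum>z\<in>active \<Omega> x. \<bar>coefficient \<alpha> \<Omega> tr z - F x\<bar>)"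
      unfolding extension_def by (rule whitney_ext_diff_le[OF x])
    also have "\<dots> \<le> (\<Sum>z\<in>active \<Omega> x. ?B)"
    proof (rule sum_mono)
      fix z assume z: "z \<in> active \<Omega> x"
      note zb = active_bd[OF z]
      have z1: "bd \<Omega> z \<le> 1" using zb small by linarith
      have "\<bar>coefficient \<alpha> \<Omega> tr z - F x\<bar> powr p \<le> coef_const * bd \<Omega> z powr ?s * ray_energy z"
        using coefficient_estimate[OF x z] z1 by simp
      also have "\<dots> \<le> coef_const * (2 * bd \<Omega> x) powr ?s * (measure \<mu> \<Omega> / (1 - \<tau>))"
        using coef_const zb p by (intro mult_mono powr_mono2 mult_left_mono ray_energy_le ray_energy_nonneg mult_nonneg_nonneg) auto
      also have "\<dots> = K * (2 * bd \<Omega> x) powr ?s" by (simp add: K_def)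
      finally have "(\<bar>coefficient \<alpha> \<Omega> tr z - F x\<bar> powr p) powr (1 / p) \<le> ?B"
        using p1 by (intro powr_mono2) auto
      then show "\<bar>coefficient \<alpha> \<Omega> tr z - F x\<bar> \<le> ?B" using p1 by (simp add: powr_powr)
    qed
    also have "\<dots> = real (card (active \<Omega> x)) * ?B" by simp
    also have "\<dots> \<le> ?N * ?B" using active_finite(2)[OF x] by (intro mult_right_mono) auto
    finally show ?thesis .
  qed
  have "(\<lambda>i. ?N * (K * (2 * bd \<Omega> (y i)) powr ?s) powr (1 / p)) \<longlonglongrightarrow> ?N * (K * (2 * 0) powr ?s) powr (1 / p)"
    using p p1 K bd_nonneg[OF dom]
    by (intro tendsto_mult tendsto_const tendsto_powr' lim0) (auto intro!: always_eventually)
  then have "(\<lambda>i. ?N * (K * (2 * bd \<Omega> (y i)) powr ?s) powr (1 / p)) \<longlonglongrightarrow> 0" using p p1 by simp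
  moreover have "eventually (\<lambda>i. norm (Ext (y i) - F (y i)) \<le> ?N * (K * (2 * bd \<Omega> (y i)) powr ?s) powr (1 / p)) sequentially"
  proof -
    have "eventually (\<lambda>i. bd \<Omega> (y i) < 1 / 2) sequentially" by (rule order_tendstoD(2)[OF lim0]) simp
    then show ?thesis by eventually_elim (simp add: bound[OF y\<Omega>])
  qed
  ultimately have "(\<lambda>i. Ext (y i) - F (y i)) \<longlonglongrightarrow> 0" by (rule Lim_null_comparison[rotated])
  from tendsto_add[OF this trace_tendsto[OF \<omega> y]] show "(\<lambda>i. Ext (y i)) \<longlonglongrightarrow> tr \<omega>" by simp
qed

text \<open>If \<open>y\<close> lies in the \<open>k\<close>-th cube on the way from \<open>z\<close> to its foot, then \<open>bd \<Omega> z\<close> is comparable to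
  \<open>(4 / 3)\<^sup>k bd \<Omega> y\<close> and bounds the distance from \<open>z\<close> to \<open>y\<close>. Such points of the net are separated on the
  same scale.\<close>
lemma ray_cube_overlap:
  assumes y: "y \<in> \<Omega>"
  shows "finite {z \<in> net \<Omega>. y \<in> half_cube (approach \<Omega> z k)} \<and>
    real (card {z \<in> net \<Omega>. y \<in> half_cube (approach \<Omega> z k)}) \<le> overlap_bound TYPE('n)"
proof -
  let ?P = "{z \<in> net \<Omega>. y \<in> half_cube (approach \<Omega> z k)}" and ?q = "(3 / 4 :: real) ^ k"
  define D where "D = bd \<Omega> y / ?q"
  have q: "0 < ?q" "?q \<le> 1" by (rule ratio_power)+
  have D: "0 < D" using bdp[OF y] q by (simp add: D_def)
  have z: "2 / 3 * D \<le> bd \<Omega> z" "infnorm (z - y) \<le> 2 * D" if zP: "z \<in> ?P" for z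
  proof -
    have z\<Omega>: "z \<in> \<Omega>" using zP net(1) by blast
    have m: "y \<in> half_cube (approach \<Omega> z k)" using zP by simp
    note ap = approach_props[OF dom z\<Omega>]
    have b: "?q * bd \<Omega> z / 2 < bd \<Omega> y" "bd \<Omega> y < 3 / 2 * (?q * bd \<Omega> z)"
      using bd_in_half_cube[OF m] by (simp_all add: ap(3))
    have Dq: "bd \<Omega> y = ?q * D" using q by (simp add: D_def)
    have "?q * (bd \<Omega> z / 2) < ?q * D" "?q * D < ?q * (3 / 2 * bd \<Omega> z)" using b unfolding Dq by (simp_all add: mult_ac)
    then have c: "bd \<Omega> z / 2 < D" "D < 3 / 2 * bd \<Omega> z" using q by (simp_all only: mult_less_cancel_left_pos)
    then show "2 / 3 * D \<le> bd \<Omega> z" by simp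
    have "infnorm (z - y) \<le> infnorm (z - approach \<Omega> z k) + infnorm (approach \<Omega> z k - y)" by (rule infnorm_diff_triangle)
    also have "infnorm (z - approach \<Omega> z k) = (1 - ?q) * bd \<Omega> z" using ap(4)[of k] by (simp add: infnorm_sub[of z])
    also have "infnorm (approach \<Omega> z k - y) \<le> ?q * bd \<Omega> z / 2"
      using m by (simp add: mem_cube ap(3) infnorm_sub[of _ y])
    finally have "infnorm (z - y) \<le> bd \<Omega> z - ?q * bd \<Omega> z / 2" by (simp add: algebra_simps)
    also have "\<dots> \<le> bd \<Omega> z" using q bdp[OF z\<Omega>] by simp
    finally show "infnorm (z - y) \<le> 2 * D" using c by simp
  qed
  have "D / 24 \<le> infnorm (z - w)" if zw: "z \<in> ?P" "w \<in> ?P" "z \<noteq> w" for z w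
  proof -
    have "bd \<Omega> z / 16 \<le> infnorm (z - w)" using zw by (intro net(2)) auto
    then show ?thesis using z(1)[OF zw(1)] by linarith
  qed
  then show ?thesis using card_separated_le[OF D z(2)] by blast
qed

text \<open>For each \<open>k\<close> the \<open>k\<close>-th cubes of all points of the net overlap boundedly; the discount factors form a
  geometric series.\<close>
lemma sum_ray_energy:
  "(\<integral>\<^sup>+z. ennreal (ray_energy z) \<partial>count_space (net \<Omega>)) \<le> ennreal (overlap_bound TYPE('n) * measure \<mu> \<Omega> / (1 - \<tau>))"
proof -
  let ?N = "overlap_bound TYPE('n)"
  have N: "0 \<le> ?N" using overlap_bound_pos(1)[where 'n = 'n] by simp
  have "(\<integral>\<^sup>+z. ennreal (ray_energy z) \<partial>count_space (net \<Omega>))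
      = (\<integral>\<^sup>+z. (\<Sum>k. ennreal (\<tau> ^ k) * emeasure \<mu> (half_cube (approach \<Omega> z k))) \<partial>count_space (net \<Omega>))"
  proof (rule nn_integral_cong)
    fix z
    have "ennreal (ray_energy z) = (\<Sum>k. ennreal (\<tau> ^ k * measure \<mu> (half_cube (approach \<Omega> z k))))"
      unfolding ray_energy_def using \<tau> by (intro suminf_ennreal2[symmetric] ray_energy_summable) auto
    then show "ennreal (ray_energy z) = (\<Sum>k. ennreal (\<tau> ^ k) * emeasure \<mu> (half_cube (approach \<Omega> z k)))"
      using \<tau> by (simp add: ennreal_mult fm.emeasure_eq_measure)
  qed
  also have "\<dots> = (\<Sum>k. \<integral>\<^sup>+z. ennreal (\<tau> ^ k) * emeasure \<mu> (half_cube (approach \<Omega> z k)) \<partial>count_space (net \<Omega>))"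
    by (rule nn_integral_suminf) simp
  also have "\<dots> \<le> (\<Sum>k. ennreal (\<tau> ^ k * (?N * measure \<mu> \<Omega>)))"
  proof (rule suminf_le)
    fix k
    have "(\<integral>\<^sup>+z. ennreal (\<tau> ^ k) * emeasure \<mu> (half_cube (approach \<Omega> z k)) \<partial>count_space (net \<Omega>))
        = ennreal (\<tau> ^ k) * (\<integral>\<^sup>+z. emeasure \<mu> (half_cube (approach \<Omega> z k)) \<partial>count_space (net \<Omega>))"
      by (rule nn_integral_cmult) simp
    also have "\<dots> \<le> ennreal (\<tau> ^ k) * (ennreal ?N * emeasure \<mu> (space \<mu>))"
    proof (rule mult_left_mono[OF nn_integral_overlap_le[OF countable_net]])
      show "half_cube (approach \<Omega> z k) \<in> sets \<mu>" if "z \<in> net \<Omega>" for z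
        by (intro half_cube approach_props(2)[OF dom]) (use that net(1) in blast)
    qed (use ray_cube_overlap space in auto)
    also have "\<dots> = ennreal (\<tau> ^ k * (?N * measure \<mu> \<Omega>))"
      using \<tau> N by (simp add: fm.emeasure_eq_measure space ennreal_mult)
    finally show "(\<integral>\<^sup>+z. ennreal (\<tau> ^ k) * emeasure \<mu> (half_cube (approach \<Omega> z k)) \<partial>count_space (net \<Omega>))
        \<le> ennreal (\<tau> ^ k * (?N * measure \<mu> \<Omega>))" .
  qed auto
  also have "\<dots> = ennreal (\<Sum>k. \<tau> ^ k * (?N * measure \<mu> \<Omega>))"
    using \<tau> N by (intro suminf_ennreal2 summable_mult2 summable_geometric) auto
  also have "(\<Sum>k. \<tau> ^ k * (?N * measure \<mu> \<Omega>)) = ?N * measure \<mu> \<Omega> / (1 - \<tau>)"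
    using \<tau> by (subst suminf_mult2[symmetric]) (auto simp: suminf_geometric summable_geometric)
  finally show ?thesis .
qed

lemma integral_active_energy:
  "(\<integral>\<^sup>+x. ennreal (active_energy x) \<partial>lebesgue_on \<Omega>) \<le> ennreal (overlap_bound TYPE('n) * measure \<mu> \<Omega> / (1 - \<tau>))"
proof -
  let ?M = "lebesgue_on \<Omega>" and ?Q = "\<lambda>z. cube z (bd \<Omega> z / 4)"
  define v where "v z = bd \<Omega> z powr (- real CARD('n)) * ray_energy z" for z
  have v0: "0 \<le> v z" for z unfolding v_def using ray_energy_nonneg[of z] by simp
  have op: "open \<Omega>" using dom by (simp add: is_domain_def)
  have Q: "?Q z \<in> sets ?M" "emeasure ?M (?Q z) = ennreal ((bd \<Omega> z / 2) ^ CARD('n))" if z: "z \<in> net \<Omega>" for z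
  proof -
    have z\<Omega>: "z \<in> \<Omega>" using z net(1) by blast
    have sub: "?Q z \<subseteq> \<Omega>" using bdp[OF z\<Omega>] by (intro cube_sub z\<Omega>) auto
    show "?Q z \<in> sets ?M" using op sub by (subst sets_restrict_space_iff) (auto simp: open_cube)
    have "emeasure ?M (?Q z) = emeasure lebesgue (?Q z)" using op sub by (intro emeasure_restrict_space) auto
    then show "emeasure ?M (?Q z) = ennreal ((bd \<Omega> z / 2) ^ CARD('n))"
      using emeasure_cube[of "bd \<Omega> z / 4" z] bdp[OF z\<Omega>] by (simp add: open_cube)
  qed
  have "(\<integral>\<^sup>+x. ennreal (active_energy x) \<partial>?M) = (\<integral>\<^sup>+x. (\<integral>\<^sup>+z. ennreal (v z) * indicator (?Q z) x \<partial>count_space (net \<Omega>)) \<partial>?M)"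
  proof (rule nn_integral_cong)
    fix x assume "x \<in> space ?M"
    then have x: "x \<in> \<Omega>" by simp
    have "(\<integral>\<^sup>+z. ennreal (v z) * indicator (?Q z) x \<partial>count_space (net \<Omega>)) = (\<Sum>z\<in>active \<Omega> x. ennreal (v z) * indicator (?Q z) x)"
      by (rule nn_integral_count_space'[OF active_finite(1)[OF x]]) (auto simp: active_def)
    also have "\<dots> = (\<Sum>z\<in>active \<Omega> x. ennreal (v z))" by (intro sum.cong) (auto simp: active_def)
    also have "\<dots> = ennreal (active_energy x)" unfolding active_energy_def v_def[symmetric] using v0 by (intro sum_ennreal)
    finally show "ennreal (active_energy x) = (\<integral>\<^sup>+z. ennreal (v z) * indicator (?Q z) x \<partial>count_space (net \<Omega>))" by simp
  qed
  also have "\<dots> = (\<integral>\<^sup>+z. (\<integral>\<^sup>+x. ennreal (v z) * indicator (?Q z) x \<partial>?M) \<partial>count_space (net \<Omega>))"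
    using Q(1) by (intro nn_integral_count_space_nn_integral countable_net) auto
  also have "\<dots> \<le> (\<integral>\<^sup>+z. ennreal (ray_energy z) \<partial>count_space (net \<Omega>))"
  proof (rule nn_integral_mono)
    fix z assume "z \<in> space (count_space (net \<Omega>))"
    then have z: "z \<in> net \<Omega>" by simp
    then have bz: "0 < bd \<Omega> z" using net(1) bdp by blast
    have "(\<integral>\<^sup>+x. ennreal (v z) * indicator (?Q z) x \<partial>?M) = ennreal (v z) * emeasure ?M (?Q z)"
      using Q(1)[OF z] by (intro nn_integral_cmult_indicator)
    also have "\<dots> = ennreal (v z * (bd \<Omega> z / 2) ^ CARD('n))"
      unfolding Q(2)[OF z] using v0 bz by (simp add: ennreal_mult)
    also have "\<dots> \<le> ennreal (ray_energy z)"
    proof (rule ennreal_leI)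
      have "v z * (bd \<Omega> z / 2) ^ CARD('n) \<le> v z * bd \<Omega> z ^ CARD('n)"
        using v0 bz by (intro mult_left_mono power_mono) auto
      also have "\<dots> = ray_energy z" using bz by (simp add: v_def powr_minus powr_realpow)
      finally show "v z * (bd \<Omega> z / 2) ^ CARD('n) \<le> ray_energy z" .
    qed
    finally show "(\<integral>\<^sup>+x. ennreal (v z) * indicator (?Q z) x \<partial>?M) \<le> ennreal (ray_energy z)" .
  qed
  also note sum_ray_energy
  finally show ?thesis .
qed

definition "norm_const = ext_const * (1 + overlap_bound TYPE('n) / (1 - \<tau>))"

lemma norm_const: "0 \<le> norm_const"
  unfolding norm_const_def using ext_const \<tau> overlap_bound_pos(1)[where 'n = 'n]
  by (intro mult_nonneg_nonneg add_nonneg_nonneg divide_nonneg_nonneg) auto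

lemma in_Lp_pointwise_bound:
  fixes h :: "real ^ 'n \<Rightarrow> real"
  assumes FL: "in_Lp p \<Omega> F" and hm: "h \<in> borel_measurable (lebesgue_on \<Omega>)"
    and h: "\<And>x. x \<in> \<Omega> \<Longrightarrow> \<bar>h x\<bar> powr p \<le> ext_const * (\<bar>F x\<bar> powr p + active_energy x)"
  shows "in_Lp p \<Omega> h"
    and "(LINT x|lebesgue_on \<Omega>. \<bar>h x\<bar> powr p) \<le> norm_const * ((LINT x|lebesgue_on \<Omega>. \<bar>F x\<bar> powr p) + measure \<mu> \<Omega>)"
proof -
  let ?M = "lebesgue_on \<Omega>" and ?E = "overlap_bound TYPE('n) * measure \<mu> \<Omega> / (1 - \<tau>)"
  define A where "A = (LINT x|?M. \<bar>F x\<bar> powr p)"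
  have A0: "0 \<le> A" unfolding A_def by (rule integral_nonneg_AE) auto
  have E0: "0 \<le> ?E" using \<tau> overlap_bound_pos(1)[where 'n = 'n] by auto
  have FM: "(\<lambda>x. \<bar>F x\<bar> powr p) \<in> borel_measurable ?M" and FI: "integrable ?M (\<lambda>x. \<bar>F x\<bar> powr p)"
    using FL unfolding in_Lp_def by (auto intro: borel_measurable_integrable)
  have [measurable]: "h \<in> borel_measurable ?M" "(\<lambda>x. \<bar>F x\<bar> powr p) \<in> borel_measurable ?M" by fact+
  have iF: "(\<integral>\<^sup>+x. ennreal (\<bar>F x\<bar> powr p) \<partial>?M) = ennreal A"
    unfolding A_def by (intro nn_integral_eq_integral FI) auto
  \<comment> \<open>\<open>e\<close> is the excess of \<open>h\<close> over \<open>F\<close>; both summands below are measurable\<close>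
  define e where "e x = max 0 (\<bar>h x\<bar> powr p / ext_const - \<bar>F x\<bar> powr p)" for x
  have em: "e \<in> borel_measurable ?M" unfolding e_def[abs_def] by measurable
  have "(\<integral>\<^sup>+x. ennreal (\<bar>h x\<bar> powr p) \<partial>?M) \<le> (\<integral>\<^sup>+x. ennreal ext_const * ennreal (\<bar>F x\<bar> powr p) + ennreal ext_const * ennreal (e x) \<partial>?M)"
  proof (rule nn_integral_mono)
    fix x
    have "\<bar>h x\<bar> powr p / ext_const \<le> \<bar>F x\<bar> powr p + e x" by (simp add: e_def)
    then have "\<bar>h x\<bar> powr p \<le> ext_const * \<bar>F x\<bar> powr p + ext_const * e x"
      using ext_const by (simp add: divide_le_eq algebra_simps)
    then have "ennreal (\<bar>h x\<bar> powr p) \<le> ennreal (ext_const * \<bar>F x\<bar> powr p + ext_const * e x)" by (rule ennreal_leI)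
    then show "ennreal (\<bar>h x\<bar> powr p) \<le> ennreal ext_const * ennreal (\<bar>F x\<bar> powr p) + ennreal ext_const * ennreal (e x)"
      using ext_const by (simp add: ennreal_plus ennreal_mult e_def)
  qed
  also have "\<dots> = ennreal ext_const * ennreal A + ennreal ext_const * (\<integral>\<^sup>+x. ennreal (e x) \<partial>?M)"
    using em by (simp add: nn_integral_add nn_integral_cmult iF)
  also have "\<dots> \<le> ennreal ext_const * ennreal A + ennreal ext_const * ennreal ?E"
  proof (intro add_left_mono mult_left_mono)
    have "(\<integral>\<^sup>+x. ennreal (e x) \<partial>?M) \<le> (\<integral>\<^sup>+x. ennreal (active_energy x) \<partial>?M)"
    proof (intro nn_integral_mono ennreal_leI)
      fix x assume "x \<in> space ?M"
      then have x: "x \<in> \<Omega>" by simp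
      have "\<bar>h x\<bar> powr p / ext_const \<le> \<bar>F x\<bar> powr p + active_energy x"
        using h[OF x] ext_const by (simp add: divide_le_eq mult.commute)
      then show "e x \<le> active_energy x"
        using active_energy_nonneg[of x] by (simp add: e_def)
    qed
    also note integral_active_energy
    finally show "(\<integral>\<^sup>+x. ennreal (e x) \<partial>?M) \<le> ennreal ?E" .
  qed simp
  finally have "(\<integral>\<^sup>+x. ennreal (\<bar>h x\<bar> powr p) \<partial>?M) \<le> ennreal ext_const * ennreal A + ennreal ext_const * ennreal ?E" .
  also have "ennreal ext_const * ennreal A + ennreal ext_const * ennreal ?E = ennreal (ext_const * A + ext_const * ?E)"
    by (simp only: ennreal_plus[OF mult_nonneg_nonneg[OF ext_const(2) A0] mult_nonneg_nonneg[OF ext_const(2) E0]]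
        ennreal_mult[OF ext_const(2) A0] ennreal_mult[OF ext_const(2) E0])
  also have "\<dots> \<le> ennreal (norm_const * (A + measure \<mu> \<Omega>))"
  proof (rule ennreal_leI)
    have "norm_const * (A + measure \<mu> \<Omega>) = ext_const * A + ext_const * ?E + ext_const * measure \<mu> \<Omega> + ext_const * (overlap_bound TYPE('n) / (1 - \<tau>) * A)"
      by (simp add: norm_const_def algebra_simps add_divide_distrib)
    moreover have "0 \<le> ext_const * measure \<mu> \<Omega>" "0 \<le> ext_const * (overlap_bound TYPE('n) / (1 - \<tau>) * A)"
      using ext_const A0 \<tau> overlap_bound_pos(1)[where 'n = 'n] by (auto intro!: mult_nonneg_nonneg divide_nonneg_nonneg)
    ultimately show "ext_const * A + ext_const * ?E \<le> norm_const * (A + measure \<mu> \<Omega>)" by linarith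
  qed
  finally have fin: "(\<integral>\<^sup>+x. ennreal (\<bar>h x\<bar> powr p) \<partial>?M) \<le> ennreal (norm_const * (A + measure \<mu> \<Omega>))" .
  have int: "integrable ?M (\<lambda>x. \<bar>h x\<bar> powr p)"
    by (rule integrableI_nonneg) (use fin in \<open>auto intro: le_less_trans[OF _ ennreal_less_top]\<close>)
  then show "in_Lp p \<Omega> h" using hm by (simp add: in_Lp_def)
  have "ennreal (LINT x|?M. \<bar>h x\<bar> powr p) \<le> ennreal (norm_const * (A + measure \<mu> \<Omega>))"
    using fin nn_integral_eq_integral[OF int] by simp
  then show "(LINT x|?M. \<bar>h x\<bar> powr p) \<le> norm_const * ((LINT x|?M. \<bar>F x\<bar> powr p) + measure \<mu> \<Omega>)"
    using norm_const A0 unfolding A_def by (subst (asm) ennreal_le_iff) auto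
qed

end

section \<open>The norm of the extension\<close>

text \<open>Lebesgue measure is complete, so measurability passes to functions that agree almost everywhere.\<close>
lemma in_Lp_cong_AE:
  fixes f g :: "real ^ 'n \<Rightarrow> real"
  assumes op: "open \<Omega>" and f: "in_Lp p \<Omega> f" and ae: "AE x in lebesgue_on \<Omega>. f x = g x"
  shows "in_Lp p \<Omega> g" "(LINT x|lebesgue_on \<Omega>. \<bar>f x\<bar> powr p) = (LINT x|lebesgue_on \<Omega>. \<bar>g x\<bar> powr p)"
proof -
  have \<Omega>: "\<Omega> \<inter> space lebesgue \<in> sets lebesgue" using op by simp
  have fm: "f \<in> borel_measurable (lebesgue_on \<Omega>)" using f by (simp add: in_Lp_def)
  then have 1: "(\<lambda>x. f x * indicator \<Omega> x) \<in> borel_measurable lebesgue"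
    using borel_measurable_restrict_space_iff[OF \<Omega>, of f] by (simp add: mult.commute)
  have "AE x in lebesgue. x \<in> \<Omega> \<longrightarrow> f x = g x" using ae \<Omega> by (simp add: AE_restrict_space_iff)
  then have "AE x in lebesgue. f x * indicator \<Omega> x = g x * indicator \<Omega> x" by eventually_elim (auto simp: indicator_def)
  then have "(\<lambda>x. g x * indicator \<Omega> x) \<in> borel_measurable lebesgue" by (rule borel_measurable_AE[OF 1])
  then have gm: "g \<in> borel_measurable (lebesgue_on \<Omega>)"
    using borel_measurable_restrict_space_iff[OF \<Omega>, of g] by (simp add: mult.commute)
  have fp: "(\<lambda>x. \<bar>f x\<bar> powr p) \<in> borel_measurable (lebesgue_on \<Omega>)" "(\<lambda>x. \<bar>g x\<bar> powr p) \<in> borel_measurable (lebesgue_on \<Omega>)"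
    using fm gm by measurable
  have ae': "AE x in lebesgue_on \<Omega>. \<bar>f x\<bar> powr p = \<bar>g x\<bar> powr p" using ae by eventually_elim simp
  have "integrable (lebesgue_on \<Omega>) (\<lambda>x. \<bar>g x\<bar> powr p)"
    using f integrable_cong_AE[OF fp ae'] by (simp add: in_Lp_def)
  then show "in_Lp p \<Omega> g" using gm by (simp add: in_Lp_def)
  show "(LINT x|lebesgue_on \<Omega>. \<bar>f x\<bar> powr p) = (LINT x|lebesgue_on \<Omega>. \<bar>g x\<bar> powr p)"
    by (rule integral_cong_AE[OF fp ae'])
qed

lemma weak_gradient_cong:
  fixes G :: "real ^ 'n \<Rightarrow> real ^ 'n"
  assumes op: "open \<Omega>" and G: "has_weak_gradient \<Omega> F G" and L: "in_Lp p \<Omega> (\<lambda>x. infnorm (G x))"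
  shows "has_weak_gradient \<Omega> F (weak_gradient \<Omega> F)" "in_Lp p \<Omega> (\<lambda>x. infnorm (weak_gradient \<Omega> F x))"
    "Lp_norm p \<Omega> (\<lambda>x. infnorm (weak_gradient \<Omega> F x)) = (LINT x|lebesgue_on \<Omega>. infnorm (G x) powr p) powr (1 / p)"
proof -
  show 1: "has_weak_gradient \<Omega> F (weak_gradient \<Omega> F)" unfolding weak_gradient_def by (rule someI[where P = "has_weak_gradient \<Omega> F", OF G])
  have "AE x in lebesgue_on \<Omega>. G x = weak_gradient \<Omega> F x" by (rule weak_gradient_unique[OF op G 1])
  then have ae: "AE x in lebesgue_on \<Omega>. infnorm (G x) = infnorm (weak_gradient \<Omega> F x)" by eventually_elim simp
  show "in_Lp p \<Omega> (\<lambda>x. infnorm (weak_gradient \<Omega> F x))" by (rule in_Lp_cong_AE(1)[OF op L ae])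
  show "Lp_norm p \<Omega> (\<lambda>x. infnorm (weak_gradient \<Omega> F x)) = (LINT x|lebesgue_on \<Omega>. infnorm (G x) powr p) powr (1 / p)"
    using in_Lp_cong_AE(2)[OF op L ae] by (simp add: Lp_norm_def real_abs_infnorm)
qed

text \<open>The function \<open>x\<^sup>1\<^sup>/\<^sup>p\<close> is above its chord from 0 to \<open>A + B\<close>.\<close>
lemma root_add_le:
  fixes p :: real
  assumes p: "1 < p" and A: "0 \<le> A" "0 \<le> B"
  shows "(A + B) powr (1 / p) \<le> A powr (1 / p) + B powr (1 / p)"
proof (cases "A + B = 0")
  case True
  then show ?thesis by simp
next
  case False
  define S where "S = A + B"
  have S: "0 < S" using False A by (simp add: S_def)
  have *: "x / S * S powr (1 / p) \<le> x powr (1 / p)" if x: "0 \<le> x" "x \<le> S" for x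
  proof -
    have "x / S \<le> (x / S) powr (1 / p)"
    proof (cases "x = 0")
      case F: False
      have "(x / S) powr 1 \<le> (x / S) powr (1 / p)"
        using F x S p by (intro powr_mono') auto
      then show ?thesis using x S by simp
    qed simp
    then have "x / S * S powr (1 / p) \<le> (x / S) powr (1 / p) * S powr (1 / p)" by (intro mult_right_mono) auto
    also have "\<dots> = x powr (1 / p)" using S by (simp add: powr_mult[symmetric])
    finally show ?thesis .
  qed
  have "S powr (1 / p) = A / S * S powr (1 / p) + B / S * S powr (1 / p)"
    using S by (simp add: S_def distrib_right[symmetric] add_divide_distrib[symmetric])
  then show ?thesis using *[of A] *[of B] A by (simp add: S_def)
qed

definition extension_const :: "'n::finite itself \<Rightarrow> real \<Rightarrow> real" where
  "extension_const T p = 2 * morrey_function.norm_const T p (sobolev_function.morrey_C T p) powr (1 / p)"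

text \<open>The constants of the locales depend on \<open>p\<close> and the dimension only, which makes the bound uniform
  in the domain and the function.\<close>
lemma extension_bounded:
  fixes \<Omega> :: "(real ^ 'n) set"
  assumes dom: "is_domain \<Omega>" and p: "real CARD('n) < p" and \<alpha>: "\<alpha> = (p - real CARD('n)) / (p - 1)"
    and F: "F \<in> W1p_cont p \<Omega>"
  defines "H \<equiv> extension \<alpha> \<Omega> (alpha_trace \<alpha> \<Omega> F)"
  shows "H \<in> W1p_cont p \<Omega>" "alpha_trace \<alpha> \<Omega> H = alpha_trace \<alpha> \<Omega> F"
    "W1p_norm p \<Omega> H \<le> extension_const TYPE('n) p * W1p_norm p \<Omega> F"
proof -
  have op: "open \<Omega>" using dom by (simp add: is_domain_def)
  have FL: "in_Lp p \<Omega> F" and Fc: "continuous_on \<Omega> F" using F by (auto simp: W1p_cont_def in_W1p_def)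
  obtain G0 where G0: "has_weak_gradient \<Omega> F G0" "in_Lp p \<Omega> (\<lambda>x. infnorm (G0 x))"
    using F by (auto simp: W1p_cont_def in_W1p_def)
  define G where "G = weak_gradient \<Omega> F"
  interpret s: sobolev_function p \<Omega> F G
    unfolding G_def by unfold_locales (fact dom p Fc weak_gradient_cong(1)[OF op G0] weak_gradient_cong(2)[OF op G0])+
  interpret m: morrey_function p \<Omega> F "energy p \<Omega> G" "s.morrey_C"
  proof (rule morrey_function.intro)
    show "0 < s.morrey_C" unfolding s.morrey_C_def by (rule add_nonneg_pos) auto
    show "space (energy p \<Omega> G) = \<Omega>" by (rule s.space_energy)
    show "cube c r \<in> sets (energy p \<Omega> G)" if "cube c r \<subseteq> \<Omega>" for c r
      using s.cube_sets[OF that] by (simp add: s.space_energy)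
    show "\<bar>F x - F y\<bar> powr p \<le> s.morrey_C * r powr (p - real CARD('n)) * measure (energy p \<Omega> G) (cube c r)"
      if "cube c r \<subseteq> \<Omega>" "0 < r" "infnorm (x - c) \<le> r / 2" "infnorm (y - c) \<le> r / 2" for c r x y
      by (rule s.morrey[OF that])
  qed (fact dom p s.finite_energy)+
  have \<alpha>m: "m.\<alpha> = \<alpha>" by (simp add: m.\<alpha>_def \<alpha>)
  define f where "f = alpha_trace \<alpha> \<Omega> F"
  define D where "D = whitney_grad \<Omega> (coefficient \<alpha> \<Omega> f)"
  define K where "K = m.norm_const"
  define A where "A = (LINT x|lebesgue_on \<Omega>. \<bar>F x\<bar> powr p)"
  define B where "B = (LINT x|lebesgue_on \<Omega>. infnorm (G x) powr p)"
  have p1: "1 < p" by (rule s.p1)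
  have AB: "0 \<le> A" "0 \<le> B" unfolding A_def B_def by (auto intro!: integral_nonneg_AE)
  have H: "H = whitney_ext \<Omega> (coefficient \<alpha> \<Omega> f)" unfolding H_def extension_def f_def ..
  have Hc: "continuous_on \<Omega> H" unfolding H by (rule m.continuous_whitney_ext)
  have Dc: "continuous_on \<Omega> D" unfolding D_def by (rule m.continuous_whitney_grad)
  have wg: "has_weak_gradient \<Omega> H D"
    unfolding H D_def by (rule has_weak_gradient_C1[OF op m.has_derivative_whitney_ext m.continuous_whitney_grad])
  have meas: "u \<in> borel_measurable (lebesgue_on \<Omega>)" if "continuous_on \<Omega> u" for u :: "real ^ 'n \<Rightarrow> real"
    using that op by (intro continuous_imp_measurable_on_sets_lebesgue) auto
  have Hb: "\<bar>H x\<bar> powr p \<le> m.ext_const * (\<bar>F x\<bar> powr p + m.active_energy x)"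
    and Db: "\<bar>infnorm (D x)\<bar> powr p \<le> m.ext_const * (\<bar>F x\<bar> powr p + m.active_energy x)" if "x \<in> \<Omega>" for x
    using m.extension_pointwise[OF that] unfolding H_def D_def f_def \<alpha>m by (simp_all add: real_abs_infnorm)
  have HL: "in_Lp p \<Omega> H" "(LINT x|lebesgue_on \<Omega>. \<bar>H x\<bar> powr p) \<le> K * (A + B)"
    using m.in_Lp_pointwise_bound[OF FL meas[OF Hc] Hb] s.energy_space by (simp_all add: K_def A_def B_def)
  have DL: "in_Lp p \<Omega> (\<lambda>x. infnorm (D x))" "(LINT x|lebesgue_on \<Omega>. infnorm (D x) powr p) \<le> K * (A + B)"
    using m.in_Lp_pointwise_bound[OF FL meas[OF continuous_on_infnorm[OF Dc]] Db] s.energy_space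
    by (simp_all add: K_def A_def B_def real_abs_infnorm)
  show "H \<in> W1p_cont p \<Omega>" using HL(1) DL(1) wg Hc by (auto simp: W1p_cont_def in_W1p_def)
  show "alpha_trace \<alpha> \<Omega> H = alpha_trace \<alpha> \<Omega> F"
  proof
    fix \<omega>
    show "alpha_trace \<alpha> \<Omega> H \<omega> = alpha_trace \<alpha> \<Omega> F \<omega>"
    proof (cases "\<omega> \<in> alpha_boundary \<alpha> \<Omega>")
      case True
      then show ?thesis using m.extension_trace[of \<omega>] unfolding \<alpha>m H_def by simp
    qed (simp add: alpha_trace_def)
  qed
  have K0: "0 \<le> K" unfolding K_def by (rule m.norm_const)
  have root: "u powr (1 / p) \<le> K powr (1 / p) * (A powr (1 / p) + B powr (1 / p))" if u: "0 \<le> u" "u \<le> K * (A + B)" for u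
  proof -
    have "u powr (1 / p) \<le> (K * (A + B)) powr (1 / p)" using u p1 by (intro powr_mono2) auto
    also have "\<dots> = K powr (1 / p) * (A + B) powr (1 / p)" by (rule powr_mult)
    also have "\<dots> \<le> K powr (1 / p) * (A powr (1 / p) + B powr (1 / p))"
      by (intro mult_left_mono root_add_le[OF p1 AB]) auto
    finally show ?thesis .
  qed
  have "Lp_norm p \<Omega> H \<le> K powr (1 / p) * (A powr (1 / p) + B powr (1 / p))"
    unfolding Lp_norm_def by (intro root HL(2) integral_nonneg_AE) simp
  moreover have "Lp_norm p \<Omega> (\<lambda>x. infnorm (weak_gradient \<Omega> H x)) \<le> K powr (1 / p) * (A powr (1 / p) + B powr (1 / p))"
    unfolding weak_gradient_cong(3)[OF op wg DL(1)] by (intro root DL(2) integral_nonneg_AE) simp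
  moreover have "W1p_norm p \<Omega> F = A powr (1 / p) + B powr (1 / p)"
    by (simp add: W1p_norm_def Lp_norm_def A_def B_def G_def real_abs_infnorm)
  ultimately show "W1p_norm p \<Omega> H \<le> extension_const TYPE('n) p * W1p_norm p \<Omega> F"
    by (simp add: W1p_norm_def[of p \<Omega> H] extension_const_def K_def)
qed

theorem theorem1p12:
  fixes p \<alpha> :: real
  assumes "real CARD('n::finite) < p"
    and "\<alpha> = (p - real CARD('n)) / (p - 1)"
  shows "\<exists>C::real. \<forall>\<Omega> :: (real ^ 'n) set. is_domain \<Omega> \<longrightarrow>
    (\<exists>E :: ((nat \<Rightarrow> real ^ 'n) set \<Rightarrow> real) \<Rightarrow> (real ^ 'n \<Rightarrow> real).
       (\<forall>f \<in> trace_space \<alpha> p \<Omega>. E f \<in> W1p_cont p \<Omega>) \<and>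
       (\<forall>f \<in> trace_space \<alpha> p \<Omega>. \<forall>g \<in> trace_space \<alpha> p \<Omega>. \<forall>a b. \<forall>x \<in> \<Omega>.
          E (\<lambda>\<omega>. a * f \<omega> + b * g \<omega>) x = a * E f x + b * E g x) \<and>
       (\<forall>f \<in> trace_space \<alpha> p \<Omega>. W1p_norm p \<Omega> (E f) \<le> C * trace_norm \<alpha> p \<Omega> f) \<and>
       (\<forall>f \<in> trace_space \<alpha> p \<Omega>. alpha_trace \<alpha> \<Omega> (E f) = f))"
proof (intro exI[of _ "extension_const TYPE('n) p + 1"] allI impI)
  fix \<Omega> :: "(real ^ 'n) set" assume dom: "is_domain \<Omega>"
  note ext = extension_bounded[OF dom assms]
  let ?c = "extension_const TYPE('n) p"
  have c0: "0 \<le> ?c" by (simp add: extension_const_def)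
  have nn: "0 \<le> W1p_norm p \<Omega> F" for F by (simp add: W1p_norm_def Lp_norm_def)
  have "W1p_norm p \<Omega> (extension \<alpha> \<Omega> f) \<le> (?c + 1) * trace_norm \<alpha> p \<Omega> f" if f: "f \<in> trace_space \<alpha> p \<Omega>" for f
  proof -
    let ?S = "{F \<in> W1p_cont p \<Omega>. alpha_trace \<alpha> \<Omega> F = f}"
    have ne: "?S \<noteq> {}" using f by (auto simp: trace_space_def)
    have "W1p_norm p \<Omega> (extension \<alpha> \<Omega> f) / (?c + 1) \<le> W1p_norm p \<Omega> F" if "F \<in> ?S" for F
    proof -
      have "W1p_norm p \<Omega> (extension \<alpha> \<Omega> f) \<le> ?c * W1p_norm p \<Omega> F" using ext(3)[of F] that by auto
      also have "\<dots> \<le> (?c + 1) * W1p_norm p \<Omega> F" using nn by (intro mult_right_mono) auto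
      finally show ?thesis using c0 by (simp add: divide_le_eq mult.commute)
    qed
    then have "W1p_norm p \<Omega> (extension \<alpha> \<Omega> f) / (?c + 1) \<le> trace_norm \<alpha> p \<Omega> f"
      unfolding trace_norm_def by (intro cINF_greatest ne)
    then show ?thesis using c0 by (simp add: divide_le_eq mult.commute)
  qed
  then show "\<exists>E :: ((nat \<Rightarrow> real ^ 'n) set \<Rightarrow> real) \<Rightarrow> (real ^ 'n \<Rightarrow> real).
       (\<forall>f \<in> trace_space \<alpha> p \<Omega>. E f \<in> W1p_cont p \<Omega>) \<and>
       (\<forall>f \<in> trace_space \<alpha> p \<Omega>. \<forall>g \<in> trace_space \<alpha> p \<Omega>. \<forall>a b. \<forall>x \<in> \<Omega>.
          E (\<lambda>\<omega>. a * f \<omega> + b * g \<omega>) x = a * E f x + b * E g x) \<and>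
       (\<forall>f \<in> trace_space \<alpha> p \<Omega>. W1p_norm p \<Omega> (E f) \<le> (?c + 1) * trace_norm \<alpha> p \<Omega> f) \<and>
       (\<forall>f \<in> trace_space \<alpha> p \<Omega>. alpha_trace \<alpha> \<Omega> (E f) = f)"
    using ext(1,2) by (intro exI[of _ "extension \<alpha> \<Omega>"]) (auto simp: extension_linear trace_space_def)
qed

end
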